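(* Let $s(t)=\sum_{k} I_k\, g(t-kT_s)$ be the real linearly modulated baseband-equivalent transmitted signal with symbol period $T_s$ and raised-cosine pulse $g$ of roll-off factor $\beta$ (both specified in the context). Consider a multipath channel with $N$ paths whose baseband-equivalent received signal in the absence of noise is $r(t)=\sqrt{E_s}\sum_{n=0}^{N-1}\gamma_n s(t-\tau_n)$, where $\gamma_n=\alpha_n e^{-j\phi_n}$, and $\alpha_n,\tau_n,\phi_n$ are the gain, absolute delay and phase of the $n$th path. Let $\hat\tau$ be the delay to which the receiver is synchronized. In mediumband channels, where the delay spread $T_m=\max_n|\tau_n-\tau_0|$ satisfies neither narrowband nor wideband assumptions, the baseband-equivalent received signal in the absence of noise can be accurately modelled as $$r(t)=\sqrt{E_s}\,h_o\,s(t-\hat\tau)+\sqrt{E_s}\,\eta_o\,u(t),$$ and the baseband-equivalent received signal in the presence of noise as $$r'(t)=r(t)+n(t),$$ where $s(t-\hat\tau)$ is the desired signal, $u(t)$ is a complex uncorrelated zero-mean unit-variance interfering signal, and $n(t)$ is a complex zero-mean additive white Gaussian noise signal with variance $\sigma^2$. The fading coefficients $h_o$ and $\eta_o$ are respectively given by $$h_o=\frac{\sum_{n=0}^{N-1}\gamma_n R(\tau_n-\hat\tau)}{1-\frac{\beta}{4}},$$ $$\eta_o=\sqrt{(1-0.25\beta)\left[\left(\sum_{n=0}^{N-1}|\gamma_n|^2\right)-|h_o|^2\right]+\sum_{n=0}^{N-1}\sum_{\substack{m=0\\ m\ne n}}^{N-1}\gamma_n\gamma_m^*R(\tau_n-\tau_m)},$$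 where $R(\tau)=\mathcal{E}\{s(t)s(t+\tau)\}$ is the autocorrelation function of $s(t)$, which is given by $$R(\tau)=\operatorname{sinc}\!\left(\frac{\tau}{T_s}\right)\frac{\cos\!\left(\beta\frac{\pi\tau}{T_s}\right)}{1-\left(\frac{2\beta\tau}{T_s}\right)^2}-\frac{\beta}{4}\operatorname{sinc}\!\left(\beta\frac{\tau}{T_s}\right)\frac{\cos\!\left(\frac{\pi\tau}{T_s}\right)}{1-\left(\frac{\beta\tau}{T_s}\right)^2}.$$ The noise variance $\sigma^2$ does not depend on the fading parameters, but only on the noise bandwidth of the pulse-shaping filter at the receiver and on the spectral density $N_0$ of the thermal noise. At room temperature, $N_0=-174$ dBm/Hz.
   Context: Notation: $j=\sqrt{-1}$, $z^*$ is the complex conjugate of $z$, $\operatorname{sinc}(x)=\sin(\pi x)/(\pi x)$ with $\operatorname{sinc}(0)=1$. Symbols: $\{I_k\}$ is a real random sequence of amplitudes drawn from a symmetric one-dimensional constellation (e.g. BPSK, 4-PAM), with $\mathcal{E}\{I_k\}=0$, $\mathcal{E}\{|I_k|^2\}=1$ and $\mathcal{E}\{I_kI_{k+q}\}=0$ for $q\neq 0$. Pulse: $g$ is the raised-cosine pulse (combining root-raised-cosine transmit and receive filters) with roll-off factor $\beta$: $g(t)=\frac{\pi}{4}\operatorname{sinc}\left(\frac{1}{2\beta}\right)$ for $t=\pm\frac{T_s}{2\beta}$, and $g(t)=\operatorname{sinc}\left(\frac{t}{T_s}\right)\frac{\cos(\pi\beta t/T_s)}{1-(2\beta t/T_s)^2}$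 otherwise. Expectation: $\mathcal{E}$ is taken over the random process $s(t)$, conditionally on the fading parameters $\{\gamma_n\}$. The autocorrelation of $s$ is evaluated by the standard formula for linearly modulated signals, $\mathcal{E}\{s(t)s(t+\tau)\}=\frac{1}{T_s}\sum_q\psi_{ii}(q)\psi_{gg}(\tau-qT_s)$, with $\psi_{ii}(q)=\mathcal{E}\{I_kI_{k+q}\}$ and $\psi_{gg}$ the time autocorrelation function of $g$; in particular $\mathcal{E}\{|s(t)|^2\}=1-\beta/4$. Channel: $\phi_n=2\pi F_c\tau_n$ with $F_c$ the carrier frequency; the phases are fixed at least over one frame; path $0$ is the earliest one. $E_s$ is a factor controlling the transmit power. The timing $\hat\tau$ may or may not be optimal. Narrowband assumption: $T_m\le 0.1T_s$ is at least approximately satisfied. Broadband (wideband) assumption: the delay spread is significantly greater than $T_s$. "Mediumband" is the regime in between, for instance $T_s/10\le T_m\le 9T_s/10$. Meaning of "modelled": the error signal $e(t)=r(t)-\sqrt{E_s}\,h_o\,s(t-\hat\tau)$ is a zero-mean process with variance $E_s\eta_o^2$, and in statistically equivalent form it may be modelled by $\sqrt{E_s}\,\eta_o u(t)$. "Uncorrelated" refers to zero correlation between the interfering signal and the desired signal. *)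

theory Defs
  imports "HOL-Probability.Probability"
begin

subsection \<open>Pulse and transmitted signal\<close>

definition nsinc :: "real \<Rightarrow> real" where
  "nsinc x = sinc (pi * x)"

definition rc_pulse :: "real \<Rightarrow> real \<Rightarrow> real \<Rightarrow> real" where
  "rc_pulse Ts \<beta> t =
     (if t = Ts / (2 * \<beta>) \<or> t = - (Ts / (2 * \<beta>)) then pi / 4 * nsinc (1 / (2 * \<beta>))
      else nsinc (t / Ts) * (cos (pi * \<beta> * t / Ts) / (1 - (2 * \<beta> * t / Ts)\<^sup>2)))"

definition symbol_sequence :: "'w measure \<Rightarrow> real set \<Rightarrow> (int \<Rightarrow> 'w \<Rightarrow> real) \<Rightarrow> bool" where
  "symbol_sequence M A I \<longleftrightarrow>
     finite A \<and> uminus ` A = A \<and>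
     (\<forall>k. I k \<in> M \<rightarrow>\<^sub>M count_space A) \<and>
     (\<forall>k. integral\<^sup>L M (I k) = 0) \<and>
     (\<forall>k. integral\<^sup>L M (\<lambda>\<omega>. \<bar>I k \<omega>\<bar>\<^sup>2) = 1) \<and>
     (\<forall>k q. q \<noteq> 0 \<longrightarrow> integral\<^sup>L M (\<lambda>\<omega>. I k \<omega> * I (k + q) \<omega>) = 0)"

definition tx_signal ::
  "real \<Rightarrow> real \<Rightarrow> (int \<Rightarrow> 'w \<Rightarrow> real) \<Rightarrow> real \<Rightarrow> 'w \<Rightarrow> real" where
  "tx_signal Ts \<beta> I t \<omega> = (\<Sum>\<^sub>\<infinity>k\<in>UNIV. I k \<omega> * rc_pulse Ts \<beta> (t - of_int k * Ts))"


subsection \<open>Second-order statistics\<close>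

text \<open>
  A linearly modulated signal is cyclostationary with period \<open>Ts\<close>: the ensemble average
  of \<open>s t * s (t + \<tau>)\<close> is a non-constant \<open>Ts\<close>-periodic function of \<open>t\<close>. As usual for
  such signals, second-order quantities are therefore ensemble averages that are also averaged
  over one symbol period (equivalently, over a uniformly distributed timing phase). It is this
  average that the formula \<open>1 / Ts * (\<Sum>q. \<psi>_ii q * \<psi>_gg (\<tau> - q * Ts))\<close> evaluates.
  The argument \<open>t\<close> below is the beginning of the averaging window.
\<close>

definition avg_expectation ::
  "'w measure \<Rightarrow> real \<Rightarrow> (real \<Rightarrow> 'w \<Rightarrow> 'b) \<Rightarrow> real \<Rightarrow> 'b::{banach, second_countable_topology}" where
  "avg_expectation M Ts X t =
     (1 / Ts) *\<^sub>R set_lebesgue_integral lborel {t..t + Ts} (\<lambda>v. integral\<^sup>L M (X v))"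

definition has_avg_expectation ::
  "'w measure \<Rightarrow> real \<Rightarrow> (real \<Rightarrow> 'w \<Rightarrow> 'b::{banach, second_countable_topology})
     \<Rightarrow> real \<Rightarrow> 'b \<Rightarrow> bool" where
  "has_avg_expectation M Ts X t y \<longleftrightarrow>
     (\<forall>v. integrable M (X v)) \<and>
     set_integrable lborel {t..t + Ts} (\<lambda>v. integral\<^sup>L M (X v)) \<and>
     avg_expectation M Ts X t = y"

definition zero_mean :: "'w measure \<Rightarrow> (real \<Rightarrow> 'w \<Rightarrow> complex) \<Rightarrow> bool" where
  "zero_mean M X \<longleftrightarrow> (\<forall>t. integrable M (X t) \<and> integral\<^sup>L M (X t) = 0)"

definition has_variance ::
  "'w measure \<Rightarrow> real \<Rightarrow> (real \<Rightarrow> 'w \<Rightarrow> complex) \<Rightarrow> real \<Rightarrow> bool" where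
  "has_variance M Ts X v \<longleftrightarrow>
     (\<forall>t. integrable M (X t)) \<and>
     (\<forall>t. has_avg_expectation M Ts (\<lambda>t \<omega>. (cmod (X t \<omega> - integral\<^sup>L M (X t)))\<^sup>2) t v)"

definition uncorrelated ::
  "'w measure \<Rightarrow> real \<Rightarrow> (real \<Rightarrow> 'w \<Rightarrow> complex) \<Rightarrow> (real \<Rightarrow> 'w \<Rightarrow> complex) \<Rightarrow> bool" where
  "uncorrelated M Ts X Y \<longleftrightarrow>
     (\<forall>t. integrable M (X t)) \<and> (\<forall>t. integrable M (Y t)) \<and>
     (\<forall>t. has_avg_expectation M Ts
            (\<lambda>t \<omega>. (X t \<omega> - integral\<^sup>L M (X t)) * cnj (Y t \<omega> - integral\<^sup>L M (Y t))) t 0)"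

definition autocorr :: "'w measure \<Rightarrow> real \<Rightarrow> (real \<Rightarrow> 'w \<Rightarrow> real) \<Rightarrow> real \<Rightarrow> real" where
  "autocorr M Ts s \<tau> = avg_expectation M Ts (\<lambda>t \<omega>. s t \<omega> * s (t + \<tau>) \<omega>) 0"

definition symbol_autocorr :: "'w measure \<Rightarrow> (int \<Rightarrow> 'w \<Rightarrow> real) \<Rightarrow> int \<Rightarrow> real" where
  "symbol_autocorr M I q = integral\<^sup>L M (\<lambda>\<omega>. I 0 \<omega> * I q \<omega>)"

definition time_autocorr :: "(real \<Rightarrow> real) \<Rightarrow> real \<Rightarrow> real" where
  "time_autocorr g \<tau> = integral\<^sup>L lborel (\<lambda>t. g t * g (t + \<tau>))"

text \<open>The closed form of the autocorrelation has removable singularities at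
  \<open>\<bar>\<tau>\<bar> = Ts / (2 * \<beta>)\<close> and \<open>\<bar>\<tau>\<bar> = Ts / \<beta>\<close>, where division by zero makes
  the term below meaningless.\<close>

definition autocorr_formula :: "real \<Rightarrow> real \<Rightarrow> real \<Rightarrow> real" where
  "autocorr_formula Ts \<beta> \<tau> =
     nsinc (\<tau> / Ts) * (cos (\<beta> * (pi * \<tau> / Ts)) / (1 - (2 * \<beta> * \<tau> / Ts)\<^sup>2))
     - \<beta> / 4 * nsinc (\<beta> * (\<tau> / Ts)) * (cos (pi * \<tau> / Ts) / (1 - (\<beta> * \<tau> / Ts)\<^sup>2))"


subsection \<open>Multipath channel\<close>

definition path_coeff :: "(nat \<Rightarrow> real) \<Rightarrow> (nat \<Rightarrow> real) \<Rightarrow> nat \<Rightarrow> complex" where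
  "path_coeff \<alpha> \<phi> n = complex_of_real (\<alpha> n) * exp (- (\<i> * complex_of_real (\<phi> n)))"

definition delay_spread :: "nat \<Rightarrow> (nat \<Rightarrow> real) \<Rightarrow> real" where
  "delay_spread N \<tau> = Max ((\<lambda>n. \<bar>\<tau> n - \<tau> 0\<bar>) ` {..<N})"

text \<open>The factor \<open>\<kappa> > 1\<close> stands for the unspecified meaning of ``significantly''
  in ``a delay spread significantly greater than the symbol period''. The boundary case
  \<open>Tm = Ts / 10\<close> is counted as mediumband, hence the strict inequality.\<close>

definition narrowband :: "real \<Rightarrow> real \<Rightarrow> bool" where
  "narrowband Ts Tm \<longleftrightarrow> Tm < 0.1 * Ts"

definition broadband :: "real \<Rightarrow> real \<Rightarrow> real \<Rightarrow> bool" where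
  "broadband \<kappa> Ts Tm \<longleftrightarrow> Tm \<ge> \<kappa> * Ts"

definition mediumband :: "real \<Rightarrow> real \<Rightarrow> real \<Rightarrow> bool" where
  "mediumband \<kappa> Ts Tm \<longleftrightarrow> \<not> narrowband Ts Tm \<and> \<not> broadband \<kappa> Ts Tm"

definition received ::
  "real \<Rightarrow> nat \<Rightarrow> (nat \<Rightarrow> complex) \<Rightarrow> (nat \<Rightarrow> real) \<Rightarrow> (real \<Rightarrow> 'w \<Rightarrow> real) \<Rightarrow> real \<Rightarrow> 'w \<Rightarrow> complex"
  where
  "received Es N \<gamma> \<tau> s t \<omega> =
     complex_of_real (sqrt Es) * (\<Sum>n<N. \<gamma> n * complex_of_real (s (t - \<tau> n) \<omega>))"

definition desired_fading ::
  "real \<Rightarrow> (real \<Rightarrow> real) \<Rightarrow> nat \<Rightarrow> (nat \<Rightarrow> complex) \<Rightarrow> (nat \<Rightarrow> real) \<Rightarrow> real \<Rightarrow> complex" where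
  "desired_fading \<beta> R N \<gamma> \<tau> \<tau>h =
     (\<Sum>n<N. \<gamma> n * complex_of_real (R (\<tau> n - \<tau>h))) / complex_of_real (1 - \<beta> / 4)"

definition interference_fading ::
  "real \<Rightarrow> (real \<Rightarrow> real) \<Rightarrow> nat \<Rightarrow> (nat \<Rightarrow> complex) \<Rightarrow> (nat \<Rightarrow> real) \<Rightarrow> real \<Rightarrow> complex" where
  "interference_fading \<beta> R N \<gamma> \<tau> \<tau>h =
     csqrt (complex_of_real
              ((1 - 0.25 * \<beta>) *
               ((\<Sum>n<N. (cmod (\<gamma> n))\<^sup>2) - (cmod (desired_fading \<beta> R N \<gamma> \<tau> \<tau>h))\<^sup>2))
            + (\<Sum>n<N. \<Sum>m\<in>{..<N} - {n}. \<gamma> n * cnj (\<gamma> m) * complex_of_real (R (\<tau> n - \<tau> m))))"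


subsection \<open>Receiver noise\<close>

definition circular_gaussian :: "'w measure \<Rightarrow> ('w \<Rightarrow> complex) \<Rightarrow> real \<Rightarrow> bool" where
  "circular_gaussian M X v \<longleftrightarrow>
     X \<in> borel_measurable M \<and> v \<ge> 0 \<and>
     (if v = 0 then AE \<omega> in M. X \<omega> = 0
      else distributed M lborel (\<lambda>\<omega>. Re (X \<omega>)) (normal_density 0 (sqrt (v / 2))) \<and>
           distributed M lborel (\<lambda>\<omega>. Im (X \<omega>)) (normal_density 0 (sqrt (v / 2))) \<and>
           prob_space.indep_var M borel (\<lambda>\<omega>. Re (X \<omega>)) borel (\<lambda>\<omega>. Im (X \<omega>)))"

definition square_integrable :: "(real \<Rightarrow> complex) \<Rightarrow> bool" where
  "square_integrable f \<longleftrightarrow>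
     f \<in> borel_measurable lborel \<and> integrable lborel (\<lambda>x. (cmod (f x))\<^sup>2)"

text \<open>Complex white Gaussian noise of spectral density \<open>N0\<close>, in its spectral
  representation: \<open>W f\<close> is the stochastic integral of the frequency function \<open>f\<close>
  with respect to an orthogonal Gaussian measure of intensity \<open>N0\<close>.\<close>

definition white_gaussian_noise ::
  "'w measure \<Rightarrow> real \<Rightarrow> ((real \<Rightarrow> complex) \<Rightarrow> 'w \<Rightarrow> complex) \<Rightarrow> bool" where
  "white_gaussian_noise M N0 W \<longleftrightarrow>
     (\<forall>f. square_integrable f \<longrightarrow>
        circular_gaussian M (W f) (N0 * integral\<^sup>L lborel (\<lambda>x. (cmod (f x))\<^sup>2))) \<and>
     (\<forall>f g a b. square_integrable f \<longrightarrow> square_integrable g \<longrightarrow>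
        (AE \<omega> in M. W (\<lambda>x. a * f x + b * g x) \<omega> = a * W f \<omega> + b * W g \<omega>))"

text \<open>Frequency response of the root-raised-cosine receive filter with unit passband gain
  (the square root of the raised-cosine spectrum).\<close>

definition rrc_response :: "real \<Rightarrow> real \<Rightarrow> real \<Rightarrow> real" where
  "rrc_response Ts \<beta> f =
     (if \<bar>f\<bar> \<le> (1 - \<beta>) / (2 * Ts) then 1
      else if \<bar>f\<bar> \<le> (1 + \<beta>) / (2 * Ts)
        then cos (pi * Ts / (2 * \<beta>) * (\<bar>f\<bar> - (1 - \<beta>) / (2 * Ts)))
      else 0)"

definition noise_bandwidth :: "(real \<Rightarrow> real) \<Rightarrow> real" where
  "noise_bandwidth H = integral\<^sup>L lborel (\<lambda>f. (H f)\<^sup>2) / (H 0)\<^sup>2"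

definition filtered_noise ::
  "((real \<Rightarrow> complex) \<Rightarrow> 'w \<Rightarrow> complex) \<Rightarrow> (real \<Rightarrow> real) \<Rightarrow> real \<Rightarrow> 'w \<Rightarrow> complex" where
  "filtered_noise W H t = W (\<lambda>f. complex_of_real (H f) * cis (2 * pi * f * t))"

definition circular_gaussian_process :: "'w measure \<Rightarrow> (real \<Rightarrow> 'w \<Rightarrow> complex) \<Rightarrow> bool" where
  "circular_gaussian_process M X \<longleftrightarrow>
     (\<forall>S c. finite S \<longrightarrow> (\<exists>v. circular_gaussian M (\<lambda>\<omega>. \<Sum>t\<in>S. c t * X t \<omega>) v))"

definition has_spectral_density ::
  "'w measure \<Rightarrow> (real \<Rightarrow> 'w \<Rightarrow> complex) \<Rightarrow> (real \<Rightarrow> real) \<Rightarrow> bool" where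
  "has_spectral_density M X S \<longleftrightarrow>
     integrable lborel S \<and>
     (\<forall>t \<tau>. integrable M (\<lambda>\<omega>. X (t + \<tau>) \<omega> * cnj (X t \<omega>)) \<and>
        integral\<^sup>L M (\<lambda>\<omega>. X (t + \<tau>) \<omega> * cnj (X t \<omega>)) =
        integral\<^sup>L lborel (\<lambda>f. complex_of_real (S f) * cis (2 * pi * f * \<tau>)))"

text \<open>SI units: temperature in K, spectral densities in W/Hz. The numerical factor is the
  Boltzmann constant.\<close>

definition thermal_noise_density :: "real \<Rightarrow> real" where
  "thermal_noise_density T = 1.380649 / 10 ^ 23 * T"

definition in_dBm_per_Hz :: "real \<Rightarrow> real" where
  "in_dBm_per_Hz x = 10 * log 10 (x / (1 / 1000))"

end

theory Submission
  imports Defs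
begin

text \<open>
  Let \<open>p\<close>, \<open>q\<close> be continuous pulses decaying like \<open>1 / t\<^sup>2\<close>. Since the symbols are
  uncorrelated, the signals modulated by \<open>p\<close> and \<open>q\<close> have correlation
  \<open>\<Sum>k. p (t - k Ts) * cnj (q (t - k Ts))\<close> at time \<open>t\<close>, and averaging over one symbol period turns
  this sum into the inner product of \<open>p\<close> and \<open>q\<close> divided by \<open>Ts\<close>. The error signal is itself
  modulated by one pulse, the composite channel pulse minus \<open>h\<^sub>o\<close> times the desired pulse; the
  formula for \<open>h\<^sub>o\<close> says precisely that it is orthogonal to the desired pulse, and \<open>\<eta>\<^sub>o\<close> is its
  norm by Pythagoras. If \<open>\<eta>\<^sub>o = 0\<close> the error pulse, being continuous, vanishes identically, so
  the decomposition still holds for every outcome.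

  The closed form of the autocorrelation comes from Parseval's identity: the pulse is the Fourier
  transform of the squared root-raised-cosine response \<open>H\<^sup>2\<close>, so its autocorrelation is the
  transform of \<open>H\<^sup>4\<close>, and both transforms are elementary away from finitely many points. Fourier
  inversion for \<open>H\<^sup>2\<close> is read off from Levy's inversion theorem for the distribution with that
  density. The noise statements follow by polarization of the isometry defining white noise.
\<close>

subsection \<open>Fourier transforms on the line\<close>

text \<open>The decay like \<open>1 / t\<^sup>2\<close> is the pivot and comes from
  \<open>\<beta> > 0\<close>: a bare sinc decays only like \<open>1 / t\<close>. It makes all
  lattice sums absolutely convergent, and it makes the pulse integrable, which is what Fourier
  inversion asks of the transform of \<open>H\<^sup>2\<close>. Levy's theorem applies because, for
  symbol period 1, \<open>H\<^sup>2\<close> is nonnegative with integral \<open>g 0 = 1\<close>,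
  hence a probability density. The poles of the closed forms are only apparent. They arise from
  dividing by a frequency in an antiderivative, and comparing continuous functions off a finite set
  removes them. The constant \<open>1 - \<beta> / 4\<close> is the autocorrelation at lag zero, the
  mean power of \<open>s\<close>. Dividing by it turns \<open>h\<^sub>o\<close> into a projection
  coefficient. One demand survives when \<open>\<eta>\<^sub>o = 0\<close>: some \<open>u\<close> of
  unit variance, uncorrelated with the desired signal, must still be exhibited although the error no
  longer determines it.\<close>

definition fourier :: "(real \<Rightarrow> complex) \<Rightarrow> real \<Rightarrow> complex" where
  "fourier A t = (LBINT x. A x * cis (t * x))"

lemma borel_measurable_cis [measurable]: "cis \<in> borel_measurable borel"
  by (intro borel_measurable_continuous_onI continuous_intros)

lemma integrable_mult_cis [simp]:
  assumes "integrable lborel A"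
  shows "integrable lborel (\<lambda>x. A x * cis (t * x))"
proof -
  have [measurable]: "A \<in> borel_measurable borel"
    using borel_measurable_integrable[OF assms] by simp
  show ?thesis
    by (rule Bochner_Integration.integrable_bound[OF assms]) (auto simp: norm_mult)
qed

lemma continuous_on_fourier:
  assumes "integrable lborel A"
  shows "continuous_on UNIV (fourier A)"
proof (rule continuous_on_sequentiallyI)
  fix u :: "nat \<Rightarrow> real" and a
  assume u: "u \<longlonglongrightarrow> a"
  have [measurable]: "A \<in> borel_measurable borel"
    using borel_measurable_integrable[OF assms] by simp
  show "(\<lambda>n. fourier A (u n)) \<longlonglongrightarrow> fourier A a"
    unfolding fourier_def
  proof (rule integral_dominated_convergence[where w = "\<lambda>x. norm (A x)"])
    show "AE x in lborel. (\<lambda>n. A x * cis (u n * x)) \<longlonglongrightarrow> A x * cis (a * x)"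
      by (intro AE_I2 tendsto_intros u)
  qed (use assms in \<open>auto simp: norm_mult\<close>)
qed

text \<open>Both sides are one double integral with the symmetric kernel \<open>cis (x * t)\<close>,
  and Fubini applies since its modulus is a product of integrable functions. Taking an indicator for
  \<open>A\<close> serves inversion; taking a translated transform for \<open>B\<close> serves
  Parseval.\<close>

lemma fourier_multiplication:
  assumes A: "integrable lborel A" and B: "integrable lborel B"
  shows "(LBINT x. A x * fourier B x) = (LBINT t. fourier A t * B t)"
proof -
  have [measurable]: "A \<in> borel_measurable borel" "B \<in> borel_measurable borel"
    using borel_measurable_integrable[OF A] borel_measurable_integrable[OF B] by simp_all
  have int: "integrable (lborel \<Otimes>\<^sub>M lborel) (\<lambda>(x, t). A x * (B t * cis (x * t)))"
  proof (rule lborel_pair.Fubini_integrable)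
    show "integrable lborel (\<lambda>x. LBINT t. norm (case (x, t) of (x, t) \<Rightarrow> A x * (B t * cis (x * t))))"
      using A by (simp add: norm_mult)
  qed (use A B in \<open>auto intro!: AE_I2 integrable_mult_right\<close>)
  have "(LBINT x. A x * fourier B x) = (LBINT x. LBINT t. A x * (B t * cis (x * t)))"
    unfolding fourier_def by (intro Bochner_Integration.integral_cong refl integral_mult_right_zero[symmetric])
  also have "\<dots> = (LBINT t. LBINT x. A x * (B t * cis (x * t)))"
    using lborel_pair.Fubini_integral[OF int] by simp
  also have "\<dots> = (LBINT t. fourier A t * B t)"
    unfolding fourier_def
    by (simp add: mult.left_commute[of "A _"] mult.commute[of "integral\<^sup>L lborel _"] mult.commute[of _ "_ :: real"])
  finally show ?thesis .
qed

text \<open>The sign in \<open>fourier\<close> is that of characteristic functions, so Levy's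
  theorem applies to the law with density \<open>D\<close>. The same sign, used twice, produces the
  reflection \<open>- x\<close>, and the missing normalisation produces
  \<open>2 * pi\<close>.\<close>

lemma fourier_inversion:
  fixes D :: "real \<Rightarrow> real"
  assumes D: "continuous_on UNIV D" "\<And>x. D x \<ge> 0" "integrable lborel D" "(LBINT x. D x) = 1"
  assumes int: "integrable lborel (fourier (\<lambda>x. of_real (D x)))"
  shows "fourier (fourier (\<lambda>x. of_real (D x))) x = of_real (2 * pi * D (- x))"
proof -
  define \<phi> where "\<phi> = fourier (\<lambda>x. complex_of_real (D x))"
  have [measurable]: "D \<in> borel_measurable borel"
    using D(1) by (rule borel_measurable_continuous_onI)
  define M where "M = density lborel (\<lambda>x. ennreal (D x))"
  have "emeasure M UNIV = 1"
    using D by (simp add: M_def emeasure_density nn_integral_eq_integral)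
  then interpret real_distribution M
    by (intro real_distribution.intro prob_spaceI real_distribution_axioms.intro) (auto simp: M_def)
  have char: "char M t = \<phi> t" for t
    by (simp add: char_def M_def \<phi>_def fourier_def integral_density D scaleR_conv_of_real
        cis_conv_exp)
  have meas: "measure M {a<..b} = integral {a..b} D" if "a \<le> b" for a b
  proof -
    have "measure M {a<..b} = (\<integral>x. indicator {a<..b} x \<partial>M)"
      by simp
    also have "\<dots> = (LBINT x:{a<..b}. D x)"
      unfolding M_def by (subst integral_density) (simp_all add: D set_lebesgue_integral_def mult.commute)
    also have "\<dots> = (LBINT x:{a..b}. D x)"
      by (rule set_integral_discrete_difference[where X = "{a}"]) auto
    also have "\<dots> = integral {a..b} D"
      by (rule set_borel_integral_eq_integral)
         (unfold set_integrable_def, intro integrable_mult_indicator D(3), simp)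
    finally show ?thesis .
  qed
  have sing: "measure M {a} = 0" for a
    by (simp add: M_def measure_def emeasure_density)
  \<comment> \<open>The candidate for \<open>D\<close> suggested by the inversion formula. It is
    compared with \<open>D\<close> through integrals over intervals, since Levy's theorem speaks
    about the measure of intervals.\<close>
  define E where "E = (\<lambda>x. fourier \<phi> (- x) / of_real (2 * pi))"
  have contE: "continuous_on UNIV E"
    unfolding E_def using int
    by (intro continuous_intros continuous_on_compose2[OF continuous_on_fourier])
       (auto simp: \<phi>_def)
  have contD: "continuous_on UNIV (\<lambda>x. complex_of_real (D x))"
    by (intro continuous_intros D)
  have eq: "integral {a..b} E = integral {a..b} (\<lambda>x. complex_of_real (D x))" if "a \<le> b" for a b
  proof -
    \<comment> \<open>The interval is reflected because \<open>E\<close> evaluates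
      \<open>fourier \<phi>\<close> at \<open>- x\<close>.\<close>
    define A where "A = (\<lambda>x. complex_of_real (indicator {-b..-a} x))"
    have intA: "integrable lborel A"
      unfolding A_def by (intro integrable_of_real integrable_real_indicator) (auto simp: emeasure_lborel_Icc_eq)
    have ftA: "fourier A t = (iexp (-(t * a)) - iexp (-(t * b))) / (\<i> * t)" if "t \<noteq> 0" for t
    proof -
      \<comment> \<open>An antiderivative of \<open>cis (t * x)\<close>, given by its real and
        imaginary parts so that real differentiation rules apply.\<close>
      define F where "F = (\<lambda>x. Complex (sin (t * x) / t) (- cos (t * x) / t))"
      have F: "F x = cis (t * x) / (\<i> * t)" for x
        using that by (simp add: F_def complex_eq_iff Re_divide Im_divide power2_eq_square)
      have "fourier A t = (CLBINT x=ereal (-b)..ereal (-a). cis (t * x))"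
        using \<open>a \<le> b\<close> unfolding fourier_def A_def
        by (subst interval_integral_Icc) (auto simp: set_lebesgue_integral_def scaleR_conv_of_real)
      also have "\<dots> = F (-a) - F (-b)"
      proof (rule interval_integral_FTC_finite)
        show "(F has_vector_derivative cis (t * x)) (at x within S)" for x S
          unfolding has_vector_derivative_complex_iff F_def
          using that by (auto intro!: derivative_eq_intros)
      qed (auto intro!: continuous_intros)
      finally show ?thesis by (simp add: F cis_conv_exp diff_divide_distrib)
    qed
    have "(LBINT x. A x * fourier \<phi> x) = (LBINT t. fourier A t * \<phi> t)"
      using int by (intro fourier_multiplication intA) (simp add: \<phi>_def)
    moreover have "(LBINT x. A x * fourier \<phi> x) = of_real (2 * pi) * integral {a..b} E"
    proof -
      have "(LBINT x. A x * fourier \<phi> x) = (CLBINT x:{-b..-a}. fourier \<phi> x)"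
        unfolding A_def by (auto simp: set_lebesgue_integral_def scaleR_conv_of_real)
      also have "\<dots> = integral {-b..-a} (fourier \<phi>)"
        using int unfolding \<phi>_def
        by (intro set_borel_integral_eq_integral(2) borel_integrable_atLeastAtMost'
            continuous_on_subset[OF continuous_on_fourier]) auto
      also have "\<dots> = integral {a..b} (\<lambda>x. of_real (2 * pi) * E x)"
        using Henstock_Kurzweil_Integration.integral_reflect_real[of b a "\<lambda>x. fourier \<phi> (-x)"]
        by (simp add: E_def)
      finally show ?thesis by simp
    qed
    moreover have "(LBINT t. fourier A t * \<phi> t) = of_real (2 * pi) * of_real (integral {a..b} D)"
    proof -
      let ?F = "\<lambda>t. (iexp (-(t * a)) - iexp (-(t * b))) / (\<i> * t) * \<phi> t"
      have meas\<phi> [measurable]: "\<phi> \<in> borel_measurable borel"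
        using int by (simp add: \<phi>_def integrable_iff_bounded)
      have [measurable]: "fourier A \<in> borel_measurable borel"
        by (intro borel_measurable_continuous_onI continuous_on_fourier intA)
      have bnd: "norm (fourier A t) \<le> (LBINT x. norm (A x))" for t
        unfolding fourier_def by (rule order.trans[OF integral_norm_bound]) (simp add: norm_mult)
      have "(\<lambda>T::nat. 1 / (2 * pi) * (CLBINT t=-T..T. ?F t)) \<longlonglongrightarrow> of_real (integral {a..b} D)"
        using Levy_Inversion[OF that sing sing] by (simp add: char meas[OF that])
      moreover have "(CLBINT t=-T..T. ?F t) = (LBINT t. indicator {-real T..real T} t *\<^sub>R (fourier A t * \<phi> t))" for T :: nat
      proof -
        have "(CLBINT t=-T..T. ?F t) = (CLBINT t:{-real T..real T}. ?F t)"
          using interval_integral_Icc[of "- real T" "real T" ?F] by simp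
        \<comment> \<open>The closed form \<open>ftA\<close> is available only for
          \<open>t \<noteq> 0\<close>; the exceptional point is a null set.\<close>
        also have "\<dots> = (CLBINT t:{-real T..real T}. fourier A t * \<phi> t)"
          unfolding set_lebesgue_integral_def
          by (rule integral_discrete_difference[where X = "{0}"]) (auto simp: ftA)
        finally show ?thesis by (simp add: set_lebesgue_integral_def)
      qed
      \<comment> \<open>Levy's theorem yields a limit over symmetric windows. As
        \<open>\<phi>\<close> is integrable and \<open>fourier A\<close> bounded, this limit is an
        honest Lebesgue integral.\<close>
      moreover have "(\<lambda>T::nat. LBINT t. indicator {-real T..real T} t *\<^sub>R (fourier A t * \<phi> t))
          \<longlonglongrightarrow> (LBINT t. fourier A t * \<phi> t)"
      proof (rule integral_dominated_convergence[where w = "\<lambda>t. (LBINT x. norm (A x)) * norm (\<phi> t)"])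
        show "integrable lborel (\<lambda>t. (LBINT x. norm (A x)) * norm (\<phi> t))"
          using int by (simp add: \<phi>_def)
        show "AE t in lborel. (\<lambda>T::nat. indicator {-real T..real T} t *\<^sub>R (fourier A t * \<phi> t)) \<longlonglongrightarrow> fourier A t * \<phi> t"
        proof (rule AE_I2)
          fix t :: real
          obtain n :: nat where "\<bar>t\<bar> \<le> n" using real_arch_simple by blast
          then have "eventually (\<lambda>T::nat. fourier A t * \<phi> t = indicator {-real T..real T} t *\<^sub>R (fourier A t * \<phi> t)) sequentially"
            by (intro eventually_sequentiallyI[of n]) (auto simp: indicator_def)
          then show "(\<lambda>T::nat. indicator {-real T..real T} t *\<^sub>R (fourier A t * \<phi> t)) \<longlonglongrightarrow> fourier A t * \<phi> t"
            by (rule Lim_transform_eventually[OF tendsto_const])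
        qed
        show "AE t in lborel. norm (indicator {-real T..real T} t *\<^sub>R (fourier A t * \<phi> t)) \<le> (LBINT x. norm (A x)) * norm (\<phi> t)" for T :: nat
          using bnd by (auto simp: norm_mult indicator_def intro!: mult_right_mono)
      qed simp_all
      ultimately have "(\<lambda>T::nat. 1 / (2 * pi) * (LBINT t. indicator {-real T..real T} t *\<^sub>R (fourier A t * \<phi> t)))
          \<longlonglongrightarrow> of_real (integral {a..b} D)"
        and "(\<lambda>T::nat. 1 / (2 * pi) * (LBINT t. indicator {-real T..real T} t *\<^sub>R (fourier A t * \<phi> t)))
          \<longlonglongrightarrow> 1 / (2 * pi) * (LBINT t. fourier A t * \<phi> t)"
        by (simp_all only: tendsto_mult_left)
      from LIMSEQ_unique[OF this] show ?thesis by (simp add: field_simps)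
    qed
    ultimately have "integral {a..b} E = of_real (integral {a..b} D)"
      by simp
    also have "\<dots> = integral {a..b} (\<lambda>x. complex_of_real (D x))"
      using integral_linear[OF integrable_continuous_real[OF continuous_on_subset[OF D(1)]]
          bounded_linear_of_real[where 'a = complex], of a b]
      by (simp add: o_def)
    finally show ?thesis .
  qed
  \<comment> \<open>The integrals from \<open>x - 1\<close> agree as functions of their upper end,
    and \<open>x\<close> is interior to the window, so the derivatives there, the two integrands,
    agree.\<close>
  have "E x = of_real (D x)" for x
  proof -
    have "((\<lambda>u. integral {x-1..u} E) has_vector_derivative E x) (at x within {x-1..x+1})"
      and *: "((\<lambda>u. integral {x-1..u} (\<lambda>x. complex_of_real (D x))) has_vector_derivative of_real (D x)) (at x within {x-1..x+1})"
      by (intro integral_has_vector_derivative continuous_on_subset[OF contE] continuous_on_subset[OF contD]; simp)+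
    moreover have "((\<lambda>u. integral {x-1..u} E) has_vector_derivative of_real (D x)) (at x within {x-1..x+1})"
      by (rule has_vector_derivative_transform[OF _ _ *]) (auto simp: eq)
    ultimately show ?thesis
      by (simp add: at_within_Icc_at vector_derivative_unique_at)
  qed
  from this[of "-x"] show ?thesis
    by (simp add: E_def \<phi>_def field_simps)
qed

lemma eventually_not_in_finite:
  fixes x :: "'a::t1_space"
  assumes "finite S"
  shows "eventually (\<lambda>y. y \<notin> S) (at x)"
  using islimpt_finite[OF assms, of x] by (simp add: islimpt_iff_eventually)

text \<open>Every real is a limit of points outside a finite set. This carries a closed form across
  its removable singularities.\<close>

lemma continuous_eq_off_finite:
  fixes f g :: "real \<Rightarrow> 'a::t2_space"
  assumes "continuous_on UNIV f" "continuous_on UNIV g" "finite S" "\<And>x. x \<notin> S \<Longrightarrow> f x = g x"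
  shows "f x = g x"
proof (rule tendsto_unique)
  show "(f \<longlongrightarrow> f x) (at x)" using assms(1) by (simp add: continuous_on_def)
  have "(g \<longlongrightarrow> g x) (at x)" using assms(2) by (simp add: continuous_on_def)
  moreover have "eventually (\<lambda>y. g y = f y) (at x)"
    using eventually_not_in_finite[OF assms(3)] by eventually_elim (simp add: assms(4))
  ultimately show "(f \<longlongrightarrow> g x) (at x)" by (rule Lim_transform_eventually)
qed simp

text \<open>The sine part is odd and cancels under reflection; the cosine part is even and doubles
  the integral over the positive half of the support.\<close>

lemma fourier_even:
  assumes K: "continuous_on UNIV K" "\<And>x. K (- x) = K x" "\<And>x. \<bar>x\<bar> \<ge> b \<Longrightarrow> K x = 0" and b: "b \<ge> 0"
    and int: "((\<lambda>x. K x * cos (w * x)) has_integral I) {0..b}"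
  shows "fourier (\<lambda>x. complex_of_real (K x)) w = of_real (2 * I)"
proof -
  have setint: "set_integrable lborel {-b..b} f" if "continuous_on UNIV f" for f :: "real \<Rightarrow> real"
    by (intro borel_integrable_atLeastAtMost' continuous_on_subset[OF that]) auto
  have K0: "indicator {-b..b} x * K x = K x" for x
    using K(3)[of x] by (cases "\<bar>x\<bar> \<ge> b") (auto simp: indicator_def)
  have intC: "integrable lborel (\<lambda>x. K x * cos (w * x))" "integrable lborel (\<lambda>x. K x * sin (w * x))"
    using setint[of "\<lambda>x. K x * cos (w * x)"] setint[of "\<lambda>x. K x * sin (w * x)"]
    by (simp_all add: set_integrable_def K0 K(1) mult.assoc[symmetric] continuous_intros)
  have odd: "(LBINT x. K x * sin (w * x)) = 0"
    using lborel_integral_real_affine[of "-1" "\<lambda>x. K x * sin (w * x)" 0] by (simp add: K)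
  have "(LBINT x. K x * cos (w * x)) = (LBINT x:{-b..b}. K x * cos (w * x))"
    by (simp add: set_lebesgue_integral_def K0 mult.assoc[symmetric])
  also have "\<dots> = integral {-b..b} (\<lambda>x. K x * cos (w * x))"
    by (intro set_borel_integral_eq_integral setint continuous_intros K)
  also have "\<dots> = 2 * I"
  proof (rule integral_unique)
    have "((\<lambda>x. K x * cos (w * x)) has_integral I) {-b..0}"
      using int has_integral_reflect_real[where f = "\<lambda>x. K x * cos (w * x)" and a = 0 and b = b and i = I] by (simp add: K)
    from has_integral_combine[OF _ _ this int] show "((\<lambda>x. K x * cos (w * x)) has_integral 2 * I) {-b..b}"
      using b by simp
  qed
  finally have even: "(LBINT x. K x * cos (w * x)) = 2 * I" .
  have "fourier (\<lambda>x. complex_of_real (K x)) w =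
      (LBINT x. complex_of_real (K x * cos (w * x)) + \<i> * complex_of_real (K x * sin (w * x)))"
    unfolding fourier_def
    by (intro Bochner_Integration.integral_cong refl) (simp add: complex_eq_iff)
  also have "\<dots> = (LBINT x. complex_of_real (K x * cos (w * x))) + \<i> * (LBINT x. complex_of_real (K x * sin (w * x)))"
    by (subst Bochner_Integration.integral_add)
       (use intC in \<open>auto intro!: integrable_mult_right integrable_of_real simp del: of_real_mult\<close>)
  finally show "fourier (\<lambda>x. complex_of_real (K x)) w = of_real (2 * I)"
    unfolding integral_complex_of_real by (simp add: even odd)
qed

text \<open>Translating \<open>F\<close> by \<open>v\<close> multiplies its transform by the phase
  \<open>cis (- (v * x))\<close>, while inversion makes the transform of \<open>F\<close> itself
  \<open>2 * pi * D\<close>. The multiplication formula then moves the product of two transforms to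
  an integral of \<open>D\<close> squared; evenness of \<open>D\<close> absorbs the sign of the
  phase.\<close>

lemma parseval_autocorrelation:
  fixes D :: "real \<Rightarrow> real"
  defines "F \<equiv> fourier (\<lambda>x. complex_of_real (D x))"
  assumes D: "continuous_on UNIV D" "\<And>x. D x \<ge> 0" "integrable lborel D" "(LBINT x. D x) = 1"
    and even: "\<And>x. D (- x) = D x" and int: "integrable lborel F"
  shows "(LBINT w. F w * F (w + v)) = of_real (2 * pi) * fourier (\<lambda>x. complex_of_real ((D x)\<^sup>2)) v"
proof -
  have int': "integrable lborel (\<lambda>w. F (w + v))"
    using lborel_integrable_real_affine[OF int, of 1 v] by (simp add: add.commute)
  have shift: "fourier (\<lambda>w. F (w + v)) x = cis (- (v * x)) * of_real (2 * pi * D x)" for x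
  proof -
    have "fourier (\<lambda>w. F (w + v)) x = (LBINT w. F w * cis (x * (w - v)))"
      unfolding fourier_def
      by (subst lborel_integral_real_affine[of 1 _ "v"]) (simp_all add: add.commute)
    also have "\<dots> = (LBINT w. cis (- (v * x)) * (F w * cis (x * w)))"
      by (intro Bochner_Integration.integral_cong refl) (simp add: cis_mult right_diff_distrib mult_ac)
    also have "\<dots> = cis (- (v * x)) * fourier F x"
      by (simp add: fourier_def)
    also have "fourier F x = of_real (2 * pi * D x)"
      using fourier_inversion[OF D int[unfolded F_def]] by (simp add: F_def even)
    finally show ?thesis .
  qed
  have "(LBINT w. F w * F (w + v)) = (LBINT x. complex_of_real (D x) * fourier (\<lambda>w. F (w + v)) x)"
    unfolding F_def using int' D by (subst fourier_multiplication) (auto simp: F_def)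
  also have "\<dots> = (LBINT x. of_real (2 * pi) * (complex_of_real ((D x)\<^sup>2) * cis (v * - x)))"
    by (intro Bochner_Integration.integral_cong refl) (simp add: shift power2_eq_square mult_ac)
  also have "\<dots> = of_real (2 * pi) * (LBINT x. complex_of_real ((D x)\<^sup>2) * cis (v * - x))"
    by simp
  also have "(LBINT x. complex_of_real ((D x)\<^sup>2) * cis (v * - x)) = fourier (\<lambda>x. complex_of_real ((D x)\<^sup>2)) v"
    using lborel_integral_real_affine[of "-1" "\<lambda>x. complex_of_real ((D x)\<^sup>2) * cis (v * - x)" 0]
    by (simp add: even fourier_def)
  finally show ?thesis .
qed

section \<open>Elementary integrals of powers of a cosine against a cosine\<close>

lemma has_real_derivative_sin_affine:
  fixes p q n :: real
  assumes "p + q \<noteq> 0"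
  shows "((\<lambda>x. sin (p * (x - c) + q * x) / (n * (p + q))) has_real_derivative cos (p * (x - c) + q * x) / n) (at x within S)"
proof -
  have "((\<lambda>x. sin (p * (x - c) + q * x)) has_real_derivative cos (p * (x - c) + q * x) * (p + q)) (at x within S)"
    by (auto intro!: derivative_eq_intros)
  from DERIV_cdivide[OF this, of "n * (p + q)"] show ?thesis
    using assms by (simp only: nonzero_mult_divide_mult_cancel_right not_False_eq_True)
qed

text \<open>Halving the square and turning products into sums leaves cosines of frequencies
  \<open>w\<close> and \<open>a \<plusminus> w\<close>, integrated term by term. The excluded values
  of \<open>w\<close> are those where one of these frequencies vanishes. The arguments stay in the
  form \<open>a * (x - c) + w * x\<close> so that the endpoint \<open>c\<close> simplifies.\<close>

lemma has_integral_cos_squared_mult_cos: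
  fixes a c d w :: real
  assumes "c \<le> d" "w \<noteq> 0" "w \<noteq> a" "w \<noteq> - a"
  defines "F \<equiv> \<lambda>x. sin (w * x) / (2 * w) + sin (a * (x - c) + w * x) / (4 * (a + w))
                    + sin (a * (x - c) - w * x) / (4 * (a - w))"
  shows "((\<lambda>x. (cos (a / 2 * (x - c)))\<^sup>2 * cos (w * x)) has_integral (F d - F c)) {c..d}"
proof (rule fundamental_theorem_of_calculus[OF \<open>c \<le> d\<close>])
  fix x
  have nz: "a + w \<noteq> 0" "a - w \<noteq> 0" using assms by auto
  have "(cos (a / 2 * (x - c)))\<^sup>2 = (1 + cos (a * (x - c))) / 2"
    using cos_double_cos[of "a / 2 * (x - c)"] by simp
  moreover have "cos (p + q) / 4 + cos (p - q) / 4 = cos p * cos q / 2" for p q :: real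
    by (simp add: cos_add cos_diff field_simps)
  ultimately have eq: "(cos (a / 2 * (x - c)))\<^sup>2 * cos (w * x) =
      cos (w * x) / 2 + cos (a * (x - c) + w * x) / 4 + cos (a * (x - c) - w * x) / 4"
    by (simp only: add.assoc) (simp add: ring_distribs)
  have "(F has_real_derivative (cos (a / 2 * (x - c)))\<^sup>2 * cos (w * x)) (at x within {c..d})"
  proof -
    note d = has_real_derivative_sin_affine[where c = c and x = x and S = "{c..d}"]
    have "((\<lambda>x. sin (w * x) / (2 * w)) has_real_derivative cos (w * x) / 2) (at x within {c..d})"
      using d[of 0 w 2] \<open>w \<noteq> 0\<close> by simp
    moreover have "((\<lambda>x. sin (a * (x - c) - w * x) / (4 * (a - w))) has_real_derivative cos (a * (x - c) - w * x) / 4) (at x within {c..d})"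
      using d[of a "- w" 4] nz(2) by (simp only: mult_minus_left not_False_eq_True simp_thms flip: diff_conv_add_uminus)
    ultimately show ?thesis
      unfolding eq F_def by (intro DERIV_add d nz)
  qed
  then show "(F has_vector_derivative (cos (a / 2 * (x - c)))\<^sup>2 * cos (w * x)) (at x within {c..d})"
    by (simp only: has_real_derivative_iff_has_vector_derivative)
qed

text \<open>With y = \<open>a / 2 * (x - c)\<close>, the fourth power of cos y is its square minus
  (1 - cos 4y) / 8. Hence the autocorrelation is the pulse minus a correction: \<open>F\<close>
  yields the former, \<open>G\<close> the latter, and \<open>G\<close> brings in the additional
  poles at twice the frequency \<open>a\<close>.\<close>

lemma has_integral_cos_pow4_mult_cos:
  fixes a c d w :: real
  assumes "c \<le> d" "w \<noteq> 0" "w \<noteq> a" "w \<noteq> - a" "w \<noteq> 2 * a" "w \<noteq> - 2 * a"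
  defines "F \<equiv> \<lambda>x. sin (w * x) / (2 * w) + sin (a * (x - c) + w * x) / (4 * (a + w))
                    + sin (a * (x - c) - w * x) / (4 * (a - w))"
  defines "G \<equiv> \<lambda>x. sin (w * x) / (8 * w) - sin (2 * a * (x - c) + w * x) / (16 * (2 * a + w))
                    - sin (2 * a * (x - c) - w * x) / (16 * (2 * a - w))"
  shows "((\<lambda>x. (cos (a / 2 * (x - c))) ^ 4 * cos (w * x)) has_integral ((F d - F c) - (G d - G c))) {c..d}"
proof -
  have "((\<lambda>x. (1 - cos (2 * a * (x - c))) / 8 * cos (w * x)) has_integral (G d - G c)) {c..d}"
  proof (rule fundamental_theorem_of_calculus[OF \<open>c \<le> d\<close>])
    fix x
    have nz: "2 * a + w \<noteq> 0" "2 * a - w \<noteq> 0" using assms by auto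
    have eq: "(1 - cos (2 * a * (x - c))) / 8 * cos (w * x) =
        cos (w * x) / 8 - cos (2 * a * (x - c) + w * x) / 16 - cos (2 * a * (x - c) - w * x) / 16"
      unfolding cos_add cos_diff by algebra
    have "(G has_real_derivative (1 - cos (2 * a * (x - c))) / 8 * cos (w * x)) (at x within {c..d})"
      unfolding eq G_def
      using has_real_derivative_sin_affine[of 0 w c 8 x] has_real_derivative_sin_affine[of "2 * a" w c 16 x]
        has_real_derivative_sin_affine[of "2 * a" "- w" c 16 x] \<open>w \<noteq> 0\<close> nz
      by (intro DERIV_diff) (simp_all del: distrib_left_numeral right_diff_distrib_numeral)
    then show "(G has_vector_derivative (1 - cos (2 * a * (x - c))) / 8 * cos (w * x)) (at x within {c..d})"
      by (simp only: has_real_derivative_iff_has_vector_derivative)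
  qed
  from has_integral_diff[OF has_integral_cos_squared_mult_cos[OF assms(1-4)] this]
  have "((\<lambda>x. (cos (a / 2 * (x - c)))\<^sup>2 * cos (w * x) - (1 - cos (2 * a * (x - c))) / 8 * cos (w * x))
      has_integral ((F d - F c) - (G d - G c))) {c..d}"
    by (simp only: F_def)
  moreover have "(cos (a / 2 * (x - c)))\<^sup>2 * cos (w * x) - (1 - cos (2 * a * (x - c))) / 8 * cos (w * x)
      = (cos (a / 2 * (x - c))) ^ 4 * cos (w * x)" for x
  proof -
    have "cos (2 * a * (x - c)) = 2 * (2 * (cos (a / 2 * (x - c)))\<^sup>2 - 1)\<^sup>2 - 1"
      using cos_double_cos[of "a * (x - c)"] cos_double_cos[of "a / 2 * (x - c)"]
      by (simp only: mult.assoc) simp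
    then show ?thesis by algebra
  qed
  ultimately show ?thesis by simp
qed

subsection \<open>The raised-cosine pulse and its spectrum\<close>

text \<open>Clamping the phase to the interval from 0 to \<open>pi / 2\<close> reproduces passband,
  roll-off and stopband, because cosine is 1 and 0 at the ends. Continuity and scaling become
  visible without cases.\<close>

lemma rrc_response_alt:
  assumes "Ts > 0" "\<beta> > 0"
  shows "rrc_response Ts \<beta> f = cos (min (pi / 2) (max 0 (pi * Ts / (2 * \<beta>) * (\<bar>f\<bar> - (1 - \<beta>) / (2 * Ts)))))"
proof -
  define x where "x = \<bar>f\<bar> - (1 - \<beta>) / (2 * Ts)"
  define k where "k = pi * Ts / (2 * \<beta>)"
  have k: "k > 0" "k * (\<beta> / Ts) = pi / 2"
    using assms by (auto simp: k_def field_simps)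
  have "(1 + \<beta>) / (2 * Ts) = (1 - \<beta>) / (2 * Ts) + \<beta> / Ts"
    using assms by (simp add: field_simps)
  then have eq: "rrc_response Ts \<beta> f = (if x \<le> 0 then 1 else if x \<le> \<beta> / Ts then cos (k * x) else 0)"
    by (auto simp: rrc_response_def x_def k_def)
  consider "x \<le> 0" | "x > 0" "x \<le> \<beta> / Ts" | "x > \<beta> / Ts"
    by linarith
  then have "rrc_response Ts \<beta> f = cos (min (pi / 2) (max 0 (k * x)))"
  proof cases
    case 1
    then have "k * x \<le> 0" using k(1) by (simp add: mult_nonneg_nonpos)
    with 1 show ?thesis by (simp add: eq)
  next
    case 2
    have "k * x \<le> pi / 2" using mult_left_mono[OF 2(2), of k] k(1) unfolding k(2) by linarith
    moreover have "k * x > 0" using 2 k(1) by simp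
    ultimately show ?thesis using 2 by (simp add: eq)
  next
    case 3
    moreover have "\<beta> / Ts > 0" using assms by simp
    moreover have "k * x > pi / 2" using mult_strict_left_mono[OF 3, of k] k(1) unfolding k(2) by linarith
    ultimately have "x > 0" "k * x > pi / 2" by auto
    with 3 show ?thesis using pi_gt_zero by (simp add: eq)
  qed
  then show ?thesis by (simp add: x_def k_def)
qed

lemma continuous_on_rrc_response:
  assumes "Ts > 0" "\<beta> > 0"
  shows "continuous_on UNIV (rrc_response Ts \<beta>)"
  unfolding rrc_response_alt[OF assms, abs_def] using assms
  by (intro continuous_intros) auto

lemma rrc_response_scale:
  assumes "Ts > 0" "\<beta> > 0"
  shows "rrc_response Ts \<beta> f = rrc_response 1 \<beta> (Ts * f)"
proof -
  have "pi * Ts / (2 * \<beta>) * (\<bar>f\<bar> - (1 - \<beta>) / (2 * Ts)) = pi / (2 * \<beta>) * (\<bar>Ts * f\<bar> - (1 - \<beta>) / 2)"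
    using assms by (simp add: field_simps abs_mult)
  then show ?thesis
    by (simp only: rrc_response_alt[OF assms] rrc_response_alt[OF zero_less_one assms(2)] mult_1_right)
qed

lemma rrc_response_minus [simp]: "rrc_response Ts \<beta> (- f) = rrc_response Ts \<beta> f"
  by (simp add: rrc_response_def)

lemma rc_pulse_scale:
  assumes "Ts > 0" "\<beta> > 0"
  shows "rc_pulse Ts \<beta> t = rc_pulse 1 \<beta> (t / Ts)"
proof -
  have "t = Ts / (2 * \<beta>) \<longleftrightarrow> t / Ts = 1 / (2 * \<beta>)" "t = - (Ts / (2 * \<beta>)) \<longleftrightarrow> t / Ts = - (1 / (2 * \<beta>))"
    using assms by (auto simp: field_simps)
  then show ?thesis by (simp add: rc_pulse_def)
qed

lemma autocorr_formula_scale: "autocorr_formula Ts \<beta> t = autocorr_formula 1 \<beta> (t / Ts)"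
  by (simp add: autocorr_formula_def)

text \<open>This form of the pulse has no removable singularity at \<open>1 / (2 * \<beta>)\<close>.\<close>

lemma rc_pulse_alt:
  assumes "\<beta> > 0"
  shows "rc_pulse 1 \<beta> t = nsinc t * (pi / 2 * sinc (pi * (1 - 2 * \<beta> * \<bar>t\<bar>) / 2) / (1 + 2 * \<beta> * \<bar>t\<bar>))"
proof -
  define u where "u = 2 * \<beta> * \<bar>t\<bar>"
  have u: "u \<ge> 0" using assms by (simp add: u_def)
  have t: "t = 1 / (2 * \<beta>) \<or> t = - (1 / (2 * \<beta>)) \<longleftrightarrow> u = 1"
    using assms abs_eq_iff[of t "1 / (2 * \<beta>)"] by (auto simp: u_def field_simps)
  show ?thesis
  proof (cases "u = 1")
    case True
    then have "nsinc t = nsinc (1 / (2 * \<beta>))"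
      using t by (auto simp: nsinc_def)
    with True show ?thesis
      using t by (simp add: rc_pulse_def u_def[symmetric])
  next
    case False
    \<comment> \<open>Passing to the complementary sine exhibits the zero at \<open>u = 1\<close>
      that cancels the factor \<open>1 - u\<close> of \<open>1 - u\<^sup>2\<close>.\<close>
    have "cos (pi * \<beta> * t) = cos (pi * u / 2)"
      by (cases "t \<ge> 0") (simp_all add: u_def mult_ac)
    also have "\<dots> = sin (pi * (1 - u) / 2)"
      by (subst cos_sin_eq) (simp add: field_simps)
    finally have c: "cos (pi * \<beta> * t) = sin (pi * (1 - u) / 2)" .
    have sq: "(2 * \<beta> * t)\<^sup>2 = u\<^sup>2"
      by (simp add: u_def power_mult_distrib)
    have "1 - u\<^sup>2 = (1 - u) * (1 + u)"
      by (simp add: algebra_simps power2_eq_square)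
    moreover have "sinc (pi * (1 - u) / 2) = cos (pi * \<beta> * t) / (pi * (1 - u) / 2)"
      using False by (simp add: c)
    ultimately have "cos (pi * \<beta> * t) / (1 - u\<^sup>2) = pi / 2 * sinc (pi * (1 - u) / 2) / (1 + u)"
      by simp
    then show ?thesis
      using t False by (simp add: rc_pulse_def sq u_def[symmetric])
  qed
qed

lemma continuous_on_rc_pulse:
  assumes "Ts > 0" "\<beta> > 0"
  shows "continuous_on UNIV (rc_pulse Ts \<beta>)"
proof -
  have "1 + 2 * \<beta> * \<bar>t\<bar> \<noteq> 0" for t
    using assms by (smt (verit) mult_nonneg_nonneg abs_ge_zero)
  then have "continuous_on UNIV (\<lambda>t. rc_pulse 1 \<beta> t)"
    unfolding rc_pulse_alt[OF assms(2)] nsinc_def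
    by (intro continuous_intros continuous_on_compose2[OF continuous_on_sinc]) (auto intro!: continuous_intros)
  then show ?thesis
    unfolding rc_pulse_scale[OF assms, abs_def]
    by (rule continuous_on_compose2) (use assms in \<open>auto intro!: continuous_intros\<close>)
qed

lemma abs_nsinc_le: "\<bar>nsinc x\<bar> \<le> 1"
  using abs_sin_x_le_abs_x[of "pi * x"] by (auto simp: nsinc_def divide_le_eq)

text \<open>The Nyquist property of freedom from intersymbol interference. It later gives the
  whiteness of the noise samples and shows that the substitute interfering pulse is not
  zero.\<close>

lemma rc_pulse_int:
  assumes "\<beta> > 0" "k \<noteq> 0"
  shows "rc_pulse 1 \<beta> (of_int k) = 0"
proof -
  have "nsinc (of_int k) = 0"
    using assms by (auto simp: nsinc_def sin_zero_iff_int2 mult.commute)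
  then show ?thesis
    using assms by (simp add: rc_pulse_alt)
qed

lemma rc_pulse_0:
  assumes "\<beta> > 0"
  shows "rc_pulse 1 \<beta> 0 = 1"
  using assms by (simp add: rc_pulse_def nsinc_def)

text \<open>The poles at 0 and at \<open>\<plusminus> a\<close> merge into one factor, which for
  \<open>a = pi / \<beta>\<close> and \<open>w = 2 * pi * t\<close> is the denominator
  \<open>1 - (2 * \<beta> * t)\<^sup>2\<close> of the raised cosine.\<close>

lemma partial_fractions_sinusoid:
  fixes a w :: real
  assumes "w \<noteq> 0" "w \<noteq> a" "w \<noteq> - a"
  shows "1 / w + (1 / (a - w) - 1 / (a + w)) / 2 = 1 / w * (a\<^sup>2 / (a\<^sup>2 - w\<^sup>2))"
proof -
  have nz: "a + w \<noteq> 0" "a - w \<noteq> 0" using assms by auto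
  have sq: "a\<^sup>2 - w\<^sup>2 = (a + w) * (a - w)" by (simp add: algebra_simps power2_eq_square)
  have "(1 / (a - w) - 1 / (a + w)) / 2 = w / (a\<^sup>2 - w\<^sup>2)"
    unfolding sq using nz by (simp add: divide_simps)
  moreover have "1 / w + w / (a\<^sup>2 - w\<^sup>2) = a\<^sup>2 / (w * (a\<^sup>2 - w\<^sup>2))"
    using nz assms(1) by (simp add: sq add_frac_eq) (simp add: algebra_simps power2_eq_square)
  ultimately show ?thesis by (simp only: times_divide_times_eq mult_1_left)
qed

text \<open>\<open>S1\<close> and \<open>S2\<close> stand for \<open>sin (w * f)\<close> at the
  inner and outer edge of the roll-off band. On the left, \<open>S1 / w\<close> is the passband
  contribution, the inner bracket is the roll-off integral, and the factor 2 accounts for negative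
  frequencies.\<close>

lemma rc_transform_algebra:
  fixes a w S1 S2 :: real
  assumes "w \<noteq> 0" "w \<noteq> a" "w \<noteq> - a"
  shows "2 * (S1 / w + ((S2 - S1) / (2 * w) - (S1 + S2) / (4 * (a + w)) + (S1 + S2) / (4 * (a - w))))
      = (S1 + S2) / w * (a\<^sup>2 / (a\<^sup>2 - w\<^sup>2))"
proof -
  have gen: "2 * (S1 * r + ((S2 - S1) * r / 2 - (S1 + S2) * p / 4 + (S1 + S2) * q / 4)) = (S1 + S2) * (r + (q - p) / 2)"
    for p q r :: real by (simp add: field_simps)
  have c: "X / (n * Y) = X * (1 / Y) / n" "X / Y = X * (1 / Y)" for X Y n :: real by simp_all
  show ?thesis
    unfolding c(1)[of _ 2 w] c(1)[of _ 4 "a + w"] c(1)[of _ 4 "a - w"] c(2)[of S1 w] c(2)[of "S1 + S2" w] gen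
      partial_fractions_sinusoid[OF assms] by (simp only: mult.assoc)
qed

text \<open>The counterpart for the correction term of the fourth power, to be used with
  \<open>2 * a\<close> in place of \<open>a\<close> and with \<open>S2 - S1\<close> in place of
  \<open>S\<close>.\<close>

lemma autocorr_transform_algebra:
  fixes a w S :: real
  assumes "w \<noteq> 0" "w \<noteq> a" "w \<noteq> - a"
  shows "2 * (S / (8 * w) - S / (16 * (a + w)) + S / (16 * (a - w))) = S / (4 * w) * (a\<^sup>2 / (a\<^sup>2 - w\<^sup>2))"
proof -
  have gen: "2 * (S * r / 8 - S * p / 16 + S * q / 16) = S / 4 * (r + (q - p) / 2)"
    for p q r :: real by (simp add: field_simps)
  have c: "X / (n * Y) = X * (1 / Y) / n" for X Y n :: real by simp
  show ?thesis
    unfolding c[of _ 8 w] c[of _ 4 w] c[of _ 16 "a + w"] c[of _ 16 "a - w"] gen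
      partial_fractions_sinusoid[OF assms] by simp
qed

section \<open>Transforms of the even powers of the root-raised-cosine response at unit symbol
  period\<close>

context
  fixes \<beta> :: real
  assumes \<beta>: "0 < \<beta>" "\<beta> \<le> 1"
begin

lemma rrc_response_outside:
  assumes "\<bar>f\<bar> \<ge> (1 + \<beta>) / 2"
  shows "rrc_response 1 \<beta> f = 0"
proof -
  define X where "X = pi / (2 * \<beta>) * (\<bar>f\<bar> - (1 - \<beta>) / 2)"
  have "X \<ge> pi / (2 * \<beta>) * \<beta>"
    unfolding X_def using assms \<beta> by (intro mult_left_mono) (auto simp: field_simps)
  then have "X \<ge> pi / 2" using \<beta> by simp
  moreover have "rrc_response 1 \<beta> f = cos (min (pi / 2) (max 0 X))"
    using rrc_response_alt[of 1 \<beta> f] \<beta> by (simp add: X_def)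
  ultimately show ?thesis using pi_gt_zero by (simp add: max_def min_def)
qed

text \<open>The flat passband contributes the sine term and the roll-off band contributes
  \<open>I\<close>. At \<open>\<beta> = 1\<close> the passband shrinks to a point and its term is
  zero.\<close>

lemma has_integral_rrc_power:
  assumes "w \<noteq> 0" and n: "n > 0"
    and I: "((\<lambda>x. cos (pi / (2 * \<beta>) * (x - (1 - \<beta>) / 2)) ^ n * cos (w * x)) has_integral I) {(1-\<beta>)/2..(1+\<beta>)/2}"
  shows "((\<lambda>x. rrc_response 1 \<beta> x ^ n * cos (w * x)) has_integral (sin (w * ((1-\<beta>)/2)) / w + I)) {0..(1+\<beta>)/2}"
proof (rule has_integral_combine[of _ "(1-\<beta>)/2"])
  have "((\<lambda>x. cos (w * x)) has_integral (sin (w * ((1-\<beta>)/2)) / w - sin (w * 0) / w)) {0..(1-\<beta>)/2}"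
    using \<beta> \<open>w \<noteq> 0\<close>
    by (intro fundamental_theorem_of_calculus)
       (auto intro!: derivative_eq_intros simp flip: has_real_derivative_iff_has_vector_derivative)
  then have "((\<lambda>x. cos (w * x)) has_integral (sin (w * ((1-\<beta>)/2)) / w)) {0..(1-\<beta>)/2}"
    by simp
  then show "((\<lambda>x. rrc_response 1 \<beta> x ^ n * cos (w * x)) has_integral (sin (w * ((1-\<beta>)/2)) / w)) {0..(1-\<beta>)/2}"
    by (rule has_integral_eq[rotated]) (auto simp: rrc_response_def)
  show "((\<lambda>x. rrc_response 1 \<beta> x ^ n * cos (w * x)) has_integral I) {(1-\<beta>)/2..(1+\<beta>)/2}"
    using I by (rule has_integral_eq[rotated]) (use \<beta> in \<open>auto simp: rrc_response_def\<close>)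
qed (use \<beta> in auto)

lemma fourier_rrc_power:
  assumes n: "even n" "n > 0" and w: "w \<noteq> 0"
    and I: "((\<lambda>x. cos (pi / (2 * \<beta>) * (x - (1 - \<beta>) / 2)) ^ n * cos (w * x)) has_integral I) {(1-\<beta>)/2..(1+\<beta>)/2}"
  shows "fourier (\<lambda>x. complex_of_real (rrc_response 1 \<beta> x ^ n)) w = of_real (2 * (sin (w * ((1-\<beta>)/2)) / w + I))"
proof -
  have cont: "continuous_on UNIV (\<lambda>x. rrc_response 1 \<beta> x ^ n)"
    using \<beta> by (intro continuous_intros continuous_on_rrc_response) auto
  note * = fourier_even[OF cont _ _ _ has_integral_rrc_power[OF w n(2) I]]
  show "fourier (\<lambda>x. complex_of_real (rrc_response 1 \<beta> x ^ n)) w = of_real (2 * (sin (w * ((1-\<beta>)/2)) / w + I))"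
    by (rule *; use \<beta> n in \<open>simp add: rrc_response_outside\<close>)+
qed

lemma fourier_rc_generic:
  assumes t: "t \<noteq> 0" "t \<noteq> 1 / (2 * \<beta>)" "t \<noteq> - 1 / (2 * \<beta>)"
  shows "fourier (\<lambda>x. complex_of_real ((rrc_response 1 \<beta> x)\<^sup>2)) (2 * pi * t) = of_real (rc_pulse 1 \<beta> t)"
proof -
  define a w S1 S2 f1 f2 where "a = pi / \<beta>" and "w = 2 * pi * t" and "S1 = sin (w * f1)" and "S2 = sin (w * f2)"
    and "f1 = (1-\<beta>)/2" and "f2 = (1+\<beta>)/2"
  note f_defs = f1_def f2_def
  have a0: "a \<noteq> 0" using \<beta> by (simp add: a_def)
  have w_eq: "w = a * (2 * \<beta> * t)"
    using \<beta> by (simp add: w_def a_def)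
  have u: "2 * \<beta> * t \<noteq> 1" "2 * \<beta> * t \<noteq> -1"
    using t \<beta> by (auto simp: field_simps)
  have nz: "w \<noteq> 0" "w \<noteq> a" "w \<noteq> - a"
    using u t a0 \<beta> mult_cancel_left[of a "2 * \<beta> * t" 1] mult_cancel_left[of a "2 * \<beta> * t" "-1"]
    unfolding w_eq by simp_all
  \<comment> \<open>The phase \<open>a * (x - f1)\<close> runs through exactly \<open>pi\<close>
    across the roll-off band, so the sines at the outer edge reduce to \<open>S2\<close> up to sign
    and combine with those at the inner edge to \<open>S1 + S2\<close>.\<close>
  have a\<beta>: "a * (f2 - f1) = pi"
    using \<beta> by (simp add: a_def f_defs field_simps)
  have "f1 \<le> f2" using \<beta> by (simp add: f_defs)
  from has_integral_cos_squared_mult_cos[OF this nz]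
  have I: "((\<lambda>x. (cos (a / 2 * (x - f1)))\<^sup>2 * cos (w * x)) has_integral
      ((S2 - S1) / (2 * w) - (S1 + S2) / (4 * (a + w)) + (S1 + S2) / (4 * (a - w)))) {f1..f2}"
    unfolding a\<beta> S1_def[symmetric] S2_def[symmetric]
    by (rule has_integral_eq_rhs) (simp add: S1_def[symmetric] S2_def[symmetric] add_divide_distrib diff_divide_distrib)
  have "a / 2 = pi / (2 * \<beta>)" by (simp add: a_def)
  note I = I[unfolded this f_defs]
  have "fourier (\<lambda>x. complex_of_real ((rrc_response 1 \<beta> x)\<^sup>2)) w =
      of_real (2 * (S1 / w + ((S2 - S1) / (2 * w) - (S1 + S2) / (4 * (a + w)) + (S1 + S2) / (4 * (a - w)))))"
    using fourier_rrc_power[OF _ _ nz(1) I] by (simp add: S1_def f_defs)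
  also have "2 * (S1 / w + ((S2 - S1) / (2 * w) - (S1 + S2) / (4 * (a + w)) + (S1 + S2) / (4 * (a - w))))
      = (S1 + S2) / w * (a\<^sup>2 / (a\<^sup>2 - w\<^sup>2))"
    by (rule rc_transform_algebra[OF nz])
  also have "S1 + S2 = 2 * (sin (pi * t) * cos (pi * \<beta> * t))"
  proof -
    have "w * f1 = pi * t - pi * \<beta> * t" "w * f2 = pi * t + pi * \<beta> * t"
      by (simp_all add: w_def f_defs field_simps)
    then show ?thesis by (simp add: S1_def S2_def sin_add sin_diff)
  qed
  also have "a\<^sup>2 / (a\<^sup>2 - w\<^sup>2) = 1 / (1 - (2 * \<beta> * t)\<^sup>2)"
  proof -
    have "a\<^sup>2 - w\<^sup>2 = a\<^sup>2 * (1 - (2 * \<beta> * t)\<^sup>2)"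
      unfolding w_eq by (simp add: algebra_simps power_mult_distrib)
    then show ?thesis using a0 by simp
  qed
  also have "2 * (sin (pi * t) * cos (pi * \<beta> * t)) / w * (1 / (1 - (2 * \<beta> * t)\<^sup>2)) = rc_pulse 1 \<beta> t"
    using t by (simp add: rc_pulse_def nsinc_def w_def)
  finally show ?thesis by (simp add: w_def)
qed

end

context
  fixes \<beta> :: real
  assumes \<beta>: "0 < \<beta>" "\<beta> \<le> 1"
begin

text \<open>The phase of the correction runs through \<open>2 * pi\<close> over the roll-off band,
  so signs are kept and the edge values enter as \<open>S2 - S1\<close>. This explains why sine and
  cosine exchange roles in the second term of the formula.\<close>

lemma fourier_autocorr_generic:
  assumes t: "t \<noteq> 0" "t \<noteq> 1 / (2 * \<beta>)" "t \<noteq> - 1 / (2 * \<beta>)" "t \<noteq> 1 / \<beta>" "t \<noteq> - 1 / \<beta>"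
  shows "fourier (\<lambda>x. complex_of_real (rrc_response 1 \<beta> x ^ 4)) (2 * pi * t) = of_real (autocorr_formula 1 \<beta> t)"
proof -
  define a w S1 S2 f1 f2 where "a = pi / \<beta>" and "w = 2 * pi * t" and "S1 = sin (w * f1)" and "S2 = sin (w * f2)"
    and "f1 = (1-\<beta>)/2" and "f2 = (1+\<beta>)/2"
  note f_defs = f1_def f2_def
  have a0: "a \<noteq> 0" using \<beta> by (simp add: a_def)
  have w_eq: "w = a * (2 * \<beta> * t)"
    using \<beta> by (simp add: w_def a_def)
  have u: "2 * \<beta> * t \<noteq> 1" "2 * \<beta> * t \<noteq> -1" "2 * \<beta> * t \<noteq> 2" "2 * \<beta> * t \<noteq> -2"
    using t \<beta> by (auto simp: field_simps)
  have ne: "w \<noteq> a * k" if "2 * \<beta> * t \<noteq> k" for k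
    using that a0 unfolding w_eq by simp
  have nz: "w \<noteq> 0" "w \<noteq> a" "w \<noteq> - a" "w \<noteq> 2 * a" "w \<noteq> - 2 * a"
    using ne[OF u(1)] ne[OF u(2)] ne[OF u(3)] ne[OF u(4)] t(1) by (simp_all add: w_def)
  then have nz2: "w \<noteq> - (2 * a)" by simp
  have a\<beta>: "a * (f2 - f1) = pi" "2 * a * (f2 - f1) = 2 * pi"
    using \<beta> by (simp_all add: a_def f_defs field_simps)
  define X Y where "X = (S2 - S1) / (2 * w) - (S1 + S2) / (4 * (a + w)) + (S1 + S2) / (4 * (a - w))"
    and "Y = (S2 - S1) / (8 * w) - (S2 - S1) / (16 * (2 * a + w)) + (S2 - S1) / (16 * (2 * a - w))"
  have "f1 \<le> f2" using \<beta> by (simp add: f_defs)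
  from has_integral_cos_pow4_mult_cos[OF this nz]
  have I: "((\<lambda>x. (cos (a / 2 * (x - f1))) ^ 4 * cos (w * x)) has_integral X - Y) {f1..f2}"
    unfolding a\<beta> X_def Y_def
    by (rule has_integral_eq_rhs) (simp add: S1_def[symmetric] S2_def[symmetric] add_divide_distrib diff_divide_distrib
        sin_add sin_diff del: distrib_left_numeral right_diff_distrib_numeral)
  have "a / 2 = pi / (2 * \<beta>)" by (simp add: a_def)
  note I = I[unfolded this f_defs]
  have "fourier (\<lambda>x. complex_of_real (rrc_response 1 \<beta> x ^ 4)) w = of_real (2 * (S1 / w + (X - Y)))"
    using fourier_rrc_power[OF \<beta> _ _ nz(1) I] by (simp add: S1_def f_defs)
  also have "2 * (S1 / w + (X - Y)) = 2 * (S1 / w + X) - 2 * Y"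
    by simp
  also have "2 * (S1 / w + X) = (S1 + S2) / w * (a\<^sup>2 / (a\<^sup>2 - w\<^sup>2))"
    unfolding X_def by (rule rc_transform_algebra[OF nz(1-3)])
  also have "2 * Y = (S2 - S1) / (4 * w) * ((2 * a)\<^sup>2 / ((2 * a)\<^sup>2 - w\<^sup>2))"
    unfolding Y_def by (rule autocorr_transform_algebra[OF nz(1,4) nz2])
  also have "S1 + S2 = 2 * (sin (pi * t) * cos (pi * \<beta> * t))"
  proof -
    have "w * f1 = pi * t - pi * \<beta> * t" "w * f2 = pi * t + pi * \<beta> * t"
      by (simp_all add: w_def f_defs field_simps)
    then show ?thesis by (simp add: S1_def S2_def sin_add sin_diff)
  qed
  also have "S2 - S1 = 2 * (cos (pi * t) * sin (pi * \<beta> * t))"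
  proof -
    have "w * f1 = pi * t - pi * \<beta> * t" "w * f2 = pi * t + pi * \<beta> * t"
      by (simp_all add: w_def f_defs field_simps)
    then show ?thesis by (simp add: S1_def S2_def sin_add sin_diff)
  qed
  also have "a\<^sup>2 / (a\<^sup>2 - w\<^sup>2) = 1 / (1 - (2 * \<beta> * t)\<^sup>2)"
  proof -
    have "a\<^sup>2 - w\<^sup>2 = a\<^sup>2 * (1 - (2 * \<beta> * t)\<^sup>2)"
      unfolding w_eq by (simp add: algebra_simps power_mult_distrib)
    then show ?thesis using a0 by simp
  qed
  also have "(2 * a)\<^sup>2 / ((2 * a)\<^sup>2 - w\<^sup>2) = 1 / (1 - (\<beta> * t)\<^sup>2)"
  proof -
    have "(2 * a)\<^sup>2 - w\<^sup>2 = (2 * a)\<^sup>2 * (1 - (\<beta> * t)\<^sup>2)"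
      unfolding w_eq by (simp add: algebra_simps power_mult_distrib)
    then show ?thesis using a0 by simp
  qed
  also have "2 * (sin (pi * t) * cos (pi * \<beta> * t)) / w * (1 / (1 - (2 * \<beta> * t)\<^sup>2))
     - 2 * (cos (pi * t) * sin (pi * \<beta> * t)) / (4 * w) * (1 / (1 - (\<beta> * t)\<^sup>2)) = autocorr_formula 1 \<beta> t"
  proof -
    have "2 * (cos (pi * t) * sin (pi * \<beta> * t)) / (4 * w) * (1 / (1 - (\<beta> * t)\<^sup>2)) =
       \<beta> / 4 * nsinc (\<beta> * t) * (cos (pi * t) / (1 - (\<beta> * t)\<^sup>2))"
      using t \<beta> by (simp add: nsinc_def w_def mult_ac)
    moreover have "2 * (sin (pi * t) * cos (pi * \<beta> * t)) / w * (1 / (1 - (2 * \<beta> * t)\<^sup>2)) =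
      nsinc t * (cos (pi * \<beta> * t) / (1 - (2 * \<beta> * t)\<^sup>2))"
      using t \<beta> by (simp add: nsinc_def w_def)
    ultimately show ?thesis
      by (simp add: autocorr_formula_def mult.left_commute[of \<beta> pi] mult.assoc)
  qed
  finally show ?thesis by (simp add: w_def)
qed

lemma integrable_rrc_power:
  assumes "n > 0" "even n"
  shows "integrable lborel (\<lambda>x. rrc_response 1 \<beta> x ^ n)"
proof -
  have "continuous_on UNIV (\<lambda>x. rrc_response 1 \<beta> x ^ n)"
    using \<beta> by (intro continuous_intros continuous_on_rrc_response) auto
  then have "set_integrable lborel {-((1+\<beta>)/2)..(1+\<beta>)/2} (\<lambda>x. rrc_response 1 \<beta> x ^ n)"
    by (rule borel_integrable_atLeastAtMost'[OF continuous_on_subset]) auto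
  moreover have "indicator {-((1+\<beta>)/2)..(1+\<beta>)/2} x * rrc_response 1 \<beta> x ^ n = rrc_response 1 \<beta> x ^ n" for x
    using rrc_response_outside[OF \<beta>, of x] assms by (cases "\<bar>x\<bar> \<ge> (1+\<beta>)/2") (auto simp: indicator_def field_simps)
  ultimately show ?thesis by (simp only: set_integrable_def real_scaleR_def)
qed

text \<open>Both sides are continuous, so the generic formula extends to the excluded points. In
  particular the special value in \<open>rc_pulse\<close> is the limit there.\<close>

lemma fourier_rc:
  "fourier (\<lambda>x. complex_of_real ((rrc_response 1 \<beta> x)\<^sup>2)) w = of_real (rc_pulse 1 \<beta> (w / (2 * pi)))"
proof -
  have "fourier (\<lambda>x. complex_of_real ((rrc_response 1 \<beta> x)\<^sup>2)) (2 * pi * t) = of_real (rc_pulse 1 \<beta> t)" for t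
  proof (rule continuous_eq_off_finite[where x = t and f = "\<lambda>t. fourier (\<lambda>x. complex_of_real ((rrc_response 1 \<beta> x)\<^sup>2)) (2 * pi * t)"
        and g = "\<lambda>t. complex_of_real (rc_pulse 1 \<beta> t)" and S = "{0, 1 / (2 * \<beta>), - 1 / (2 * \<beta>)}"])
    show "continuous_on UNIV (\<lambda>t. fourier (\<lambda>x. complex_of_real ((rrc_response 1 \<beta> x)\<^sup>2)) (2 * pi * t))"
      using integrable_rrc_power[of 2]
      by (intro continuous_on_compose2[OF continuous_on_fourier])
         (auto intro!: continuous_intros simp del: of_real_power)
    show "continuous_on UNIV (\<lambda>t. complex_of_real (rc_pulse 1 \<beta> t))"
      using \<beta> by (intro continuous_intros continuous_on_rc_pulse) auto
  qed (use fourier_rc_generic[OF \<beta>] in auto)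
  from this[of "w / (2 * pi)"] show ?thesis by simp
qed

text \<open>For \<open>\<bar>t\<bar> < 1 / \<beta>\<close> the pulse is at most the integral of
  \<open>H\<^sup>2\<close>, which is 1, and the right-hand side is at least 1. Beyond that,
  \<open>(2 * \<beta> * t)\<^sup>2\<close> is at least 4, so the denominator is at least half of it
  in modulus; \<open>\<beta> \<le> 1\<close> gives \<open>t\<^sup>2 \<ge> 1\<close>, which absorbs
  the summand 1.\<close>

lemma rc_pulse_decay: "\<bar>rc_pulse 1 \<beta> t\<bar> \<le> (1 + 1 / \<beta>\<^sup>2) / (1 + t\<^sup>2)"
proof (cases "\<bar>t\<bar> < 1 / \<beta>")
  case True
  have "\<bar>rc_pulse 1 \<beta> t\<bar> = norm (fourier (\<lambda>x. complex_of_real ((rrc_response 1 \<beta> x)\<^sup>2)) (2 * pi * t))"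
    by (simp add: fourier_rc del: of_real_power)
  also have "\<dots> \<le> (LBINT x. norm (complex_of_real ((rrc_response 1 \<beta> x)\<^sup>2) * cis (2 * pi * t * x)))"
    unfolding fourier_def by (rule integral_norm_bound)
  also have "\<dots> = (LBINT x. (rrc_response 1 \<beta> x)\<^sup>2)"
    by (simp add: norm_mult norm_power)
  also have "complex_of_real \<dots> = fourier (\<lambda>x. complex_of_real ((rrc_response 1 \<beta> x)\<^sup>2)) 0"
    by (simp add: fourier_def flip: integral_complex_of_real)
  then have "(LBINT x. (rrc_response 1 \<beta> x)\<^sup>2) = 1"
    by (simp add: fourier_rc rc_pulse_0 \<beta> del: of_real_power)
  also have "1 \<le> (1 + 1 / \<beta>\<^sup>2) / (1 + t\<^sup>2)"
  proof -
    have "t\<^sup>2 \<le> (1 / \<beta>)\<^sup>2" using True by (intro abs_le_square_iff[THEN iffD1]) (use \<beta> in auto)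
    then show ?thesis by (simp add: power_divide add_pos_nonneg)
  qed
  finally show ?thesis .
next
  case False
  then have t: "\<bar>t\<bar> \<ge> 1 / \<beta>" by simp
  have "1 / \<beta> \<ge> 1" using \<beta> by simp
  have "1 \<le> \<bar>t\<bar>" using t \<open>1 / \<beta> \<ge> 1\<close> by linarith
  from one_le_power[OF this, of 2] have t2: "t\<^sup>2 \<ge> 1" by simp
  have "1 \<le> \<beta> * \<bar>t\<bar>" using t \<beta> by (simp add: divide_le_eq mult.commute)
  from one_le_power[OF this, of 2] have u: "(2 * \<beta> * t)\<^sup>2 \<ge> 4"
    by (simp add: power_mult_distrib)
  have "t \<noteq> 1 / (2 * \<beta>)" "t \<noteq> - (1 / (2 * \<beta>))"
    using u \<beta> by auto
  then have "\<bar>rc_pulse 1 \<beta> t\<bar> = \<bar>nsinc t\<bar> * \<bar>cos (pi * \<beta> * t)\<bar> / \<bar>1 - (2 * \<beta> * t)\<^sup>2\<bar>"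
    by (simp add: rc_pulse_def abs_mult)
  also have "\<dots> \<le> 1 * 1 / ((2 * \<beta> * t)\<^sup>2 / 2)"
    using u by (intro frac_le mult_mono abs_nsinc_le abs_cos_le_one) auto
  also have "\<dots> = (1 / \<beta>\<^sup>2) / (2 * t\<^sup>2)"
    by (simp add: power_mult_distrib)
  also have "\<dots> \<le> (1 + 1 / \<beta>\<^sup>2) / (1 + t\<^sup>2)"
    using t2 by (intro frac_le) auto
  finally show ?thesis .
qed

end

subsection \<open>Pulses of quadratic decay\<close>

text \<open>A class closed under linear combinations, shifts and products with a conjugate, small
  enough that lattice sums and integrals converge absolutely. Continuity is included so that a pulse
  of zero energy vanishes at every time.\<close>

definition decaying :: "(real \<Rightarrow> complex) \<Rightarrow> bool" where
  "decaying p \<longleftrightarrow> continuous_on UNIV p \<and> (\<exists>C. \<forall>t. norm (p t) \<le> C / (1 + t\<^sup>2))"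

lemma one_plus_square_pos [simp]: "0 < 1 + (t::real)\<^sup>2" "1 + (t::real)\<^sup>2 \<noteq> 0"
  by (auto simp: add_pos_nonneg add_nonneg_eq_0_iff)

lemma decayingE:
  assumes "decaying p"
  obtains C where "C \<ge> 0" "\<And>t. norm (p t) \<le> C / (1 + t\<^sup>2)"
proof -
  obtain C where C: "\<And>t. norm (p t) \<le> C / (1 + t\<^sup>2)"
    using assms by (auto simp: decaying_def)
  from order.trans[OF norm_ge_zero C[of 0]] have "C \<ge> 0" by simp
  with C show ?thesis using that by blast
qed

lemma decaying_continuous: "decaying p \<Longrightarrow> continuous_on UNIV p"
  by (simp add: decaying_def)

lemma decaying_measurable: "decaying p \<Longrightarrow> p \<in> borel_measurable borel"
  by (intro borel_measurable_continuous_onI decaying_continuous)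

lemma decaying_zero [simp]: "decaying (\<lambda>t. 0)"
  by (auto simp: decaying_def intro!: exI[of _ 0])

lemma decaying_add:
  assumes "decaying p" "decaying q"
  shows "decaying (\<lambda>t. p t + q t)"
proof -
  obtain C D where "\<And>t. norm (p t) \<le> C / (1 + t\<^sup>2)" "\<And>t. norm (q t) \<le> D / (1 + t\<^sup>2)"
    using assms[THEN decayingE] by metis
  then have "norm (p t + q t) \<le> (C + D) / (1 + t\<^sup>2)" for t
    by (simp add: add_divide_distrib norm_triangle_mono)
  then show ?thesis
    using assms by (auto simp: decaying_def intro!: continuous_intros)
qed

lemma decaying_cmult:
  assumes "decaying p"
  shows "decaying (\<lambda>t. c * p t)"
proof -
  obtain C where "\<And>t. norm (p t) \<le> C / (1 + t\<^sup>2)"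
    using assms[THEN decayingE] by metis
  then have "norm (c * p t) \<le> (norm c * C) / (1 + t\<^sup>2)" for t
    by (auto simp: norm_mult times_divide_eq_right[symmetric] simp del: times_divide_eq_right intro!: mult_left_mono)
  then show ?thesis
    using assms by (auto simp: decaying_def intro!: continuous_intros)
qed

lemma decaying_diff:
  assumes "decaying p" "decaying q"
  shows "decaying (\<lambda>t. p t - q t)"
  using decaying_add[OF assms(1) decaying_cmult[OF assms(2), of "-1"]] by simp

lemma decaying_sum:
  assumes "\<And>i. i \<in> S \<Longrightarrow> decaying (p i)"
  shows "decaying (\<lambda>t. \<Sum>i\<in>S. p i t)"
  using assms by (induction S rule: infinite_finite_induct) (auto intro: decaying_add)

text \<open>An inequality of Peetre type: recentring the weight costs only a factor depending on the
  shift.\<close>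

lemma inverse_one_plus_square_shift:
  fixes t d :: real
  shows "1 / (1 + (t - d)\<^sup>2) \<le> 2 * (1 + d\<^sup>2) / (1 + t\<^sup>2)"
proof -
  have "0 \<le> (t - 2 * d)\<^sup>2" by simp
  then have "1 + t\<^sup>2 \<le> 2 * (1 + d\<^sup>2) + 2 * (t - d)\<^sup>2"
    by (simp add: power2_eq_square algebra_simps)
  also have "\<dots> \<le> 2 * (1 + d\<^sup>2) * (1 + (t - d)\<^sup>2)"
    by (simp add: algebra_simps)
  finally show ?thesis
    by (simp add: divide_simps add_pos_nonneg)
qed

lemma decaying_shift:
  assumes "decaying p"
  shows "decaying (\<lambda>t. p (t - d))"
proof -
  obtain C where C: "C \<ge> 0" "\<And>t. norm (p t) \<le> C / (1 + t\<^sup>2)"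
    using assms[THEN decayingE] by metis
  have "norm (p (t - d)) \<le> (C * (2 * (1 + d\<^sup>2))) / (1 + t\<^sup>2)" for t
    using C(2)[of "t - d"] mult_left_mono[OF inverse_one_plus_square_shift[of t d] C(1)] by simp
  moreover have "continuous_on UNIV (\<lambda>t. p (t - d))"
    by (intro continuous_on_compose2[OF decaying_continuous[OF assms]]) (auto intro!: continuous_intros)
  ultimately show ?thesis by (auto simp: decaying_def)
qed

lemma decaying_mult_cnj:
  assumes "decaying p" "decaying q"
  shows "decaying (\<lambda>t. p t * cnj (q t))"
proof -
  obtain C D where CD: "C \<ge> 0" "\<And>t. norm (p t) \<le> C / (1 + t\<^sup>2)" "D \<ge> 0" "\<And>t. norm (q t) \<le> D / (1 + t\<^sup>2)"
    using assms[THEN decayingE] by metis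
  have "norm (p t * cnj (q t)) \<le> (C * D) / (1 + t\<^sup>2)" for t
  proof -
    have "norm (q t) \<le> D"
      by (rule order.trans[OF CD(4)]) (use CD(3) in \<open>simp add: divide_le_eq mult_le_cancel_left1\<close>)
    then have "norm (p t) * norm (q t) \<le> (C / (1 + t\<^sup>2)) * D"
      using CD by (intro mult_mono) auto
    then show ?thesis by (simp add: norm_mult)
  qed
  then show ?thesis
    using assms by (auto simp: decaying_def intro!: continuous_intros)
qed

lemma integrable_inverse_1_plus_square_lborel: "integrable lborel (\<lambda>x::real. 1 / (1 + x\<^sup>2))"
  using integrable_inverse_1_plus_square by (simp add: set_integrable_def inverse_eq_divide)

lemma decaying_integrable:
  assumes "decaying p"
  shows "integrable lborel p"
proof -
  obtain C where C: "C \<ge> 0" "\<And>t. norm (p t) \<le> C / (1 + t\<^sup>2)"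
    using assms[THEN decayingE] by metis
  have [measurable]: "p \<in> borel_measurable borel" by (rule decaying_measurable[OF assms])
  show ?thesis
  proof (rule Bochner_Integration.integrable_bound)
    show "integrable lborel (\<lambda>x. C * (1 / (1 + x\<^sup>2)))"
      by (intro integrable_mult_right integrable_inverse_1_plus_square_lborel)
  qed (use C in auto)
qed

text \<open>A summable majorant in \<open>k\<close>, uniform over a bounded window of times; every
  later passage to the limit is dominated by it.\<close>

lemma decaying_lattice_bound:
  assumes "decaying p" "Ts > 0"
  obtains B where "B \<ge> 0" "\<And>v k. \<bar>v\<bar> \<le> r \<Longrightarrow> norm (p (v - of_int k * Ts)) \<le> B * (1 / (1 + (of_int k)\<^sup>2))"
proof -
  obtain C where C: "C \<ge> 0" "\<And>t. norm (p t) \<le> C / (1 + t\<^sup>2)"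
    using assms(1)[THEN decayingE] by metis
  \<comment> \<open>Compares the lattice of spacing \<open>Ts\<close> with the integers:
    \<open>m * (1 + k\<^sup>2)\<close> is at most \<open>1 + (k * Ts)\<^sup>2\<close>.\<close>
  define m where "m = min 1 (Ts\<^sup>2)"
  have m: "m > 0" "m \<le> 1" "m \<le> Ts\<^sup>2" using assms(2) by (auto simp: m_def)
  show ?thesis
  proof (rule that[of "C * (2 * (1 + r\<^sup>2)) / m"])
    show "C * (2 * (1 + r\<^sup>2)) / m \<ge> 0" using C(1) m by simp
    fix v k assume v: "\<bar>v\<bar> \<le> r"
    have "v\<^sup>2 \<le> r\<^sup>2" using v by (metis abs_ge_zero power2_abs power_mono)
    have "m * (1 + (of_int k)\<^sup>2) \<le> 1 + (of_int k * Ts)\<^sup>2"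
      using m mult_right_mono[OF m(3), of "(of_int k)\<^sup>2"] by (simp add: algebra_simps power_mult_distrib)
    then have "1 / (1 + (of_int k * Ts)\<^sup>2) \<le> 1 / (m * (1 + (of_int k)\<^sup>2))"
      using m by (intro divide_left_mono) auto
    then have 1: "2 * (1 + v\<^sup>2) * (1 / (1 + (of_int k * Ts)\<^sup>2)) \<le> 2 * (1 + r\<^sup>2) * (1 / (m * (1 + (of_int k)\<^sup>2)))"
      using \<open>v\<^sup>2 \<le> r\<^sup>2\<close> by (intro mult_mono) auto
    have "norm (p (v - of_int k * Ts)) \<le> C * (1 / (1 + (of_int k * Ts - v)\<^sup>2))"
      using C(2)[of "v - of_int k * Ts"] by (simp add: power2_commute)
    also have "\<dots> \<le> C * (2 * (1 + v\<^sup>2) / (1 + (of_int k * Ts)\<^sup>2))"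
      using C(1) by (intro mult_left_mono inverse_one_plus_square_shift)
    also have "\<dots> \<le> C * (2 * (1 + r\<^sup>2) * (1 / (m * (1 + (of_int k)\<^sup>2))))"
      using C(1) 1 by (intro mult_left_mono) auto
    finally show "norm (p (v - of_int k * Ts)) \<le> C * (2 * (1 + r\<^sup>2)) / m * (1 / (1 + (of_int k)\<^sup>2))"
      by (simp add: mult.assoc)
  qed
qed

lemma summable_on_inverse_square_int: "(\<lambda>k::int. 1 / (1 + (of_int k)\<^sup>2) :: real) summable_on UNIV"
proof -
  have "summable (\<lambda>n. 1 / (1 + (real n)\<^sup>2))"
    by (rule summable_comparison_test'[OF inverse_power_summable[of 2], of 1])
       (auto simp: divide_simps)
  then have s: "(\<lambda>n. 1 / (1 + (real n)\<^sup>2)) summable_on UNIV"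
    by (intro norm_summable_imp_summable_on) simp
  have "(\<lambda>k::int. 1 / (1 + (of_int k)\<^sup>2) :: real) summable_on (int ` UNIV)"
    using s by (subst summable_on_reindex) (auto simp: o_def inj_on_def)
  moreover have "(\<lambda>k::int. 1 / (1 + (of_int k)\<^sup>2) :: real) summable_on ((\<lambda>n. - int n) ` UNIV)"
    using s by (subst summable_on_reindex) (auto simp: o_def inj_on_def)
  ultimately have "(\<lambda>k::int. 1 / (1 + (of_int k)\<^sup>2) :: real) summable_on (int ` UNIV \<union> (\<lambda>n. - int n) ` UNIV)"
    by (rule summable_on_union)
  moreover have "int ` UNIV \<union> (\<lambda>n. - int n) ` UNIV = UNIV"
  proof -
    have "k \<in> int ` UNIV \<union> (\<lambda>n. - int n) ` UNIV" for k
      by (cases k rule: int_cases2) auto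
    then show ?thesis by blast
  qed
  ultimately show ?thesis by simp
qed

text \<open>Symmetric windows eventually contain every finite set of integers. This turns unordered
  sums into sequences, the form in which dominated convergence is available.\<close>

lemma has_sum_int_imp_symmetric_limit:
  fixes f :: "int \<Rightarrow> 'a::{comm_monoid_add, topological_space}"
  assumes "(f has_sum S) UNIV"
  shows "(\<lambda>n. \<Sum>k\<in>{- int n..int n}. f k) \<longlonglongrightarrow> S"
proof -
  have "filterlim (\<lambda>n. {- int n..int n}) (finite_subsets_at_top UNIV) sequentially"
    unfolding filterlim_finite_subsets_at_top
  proof (intro allI impI)
    fix X :: "int set" assume X: "finite X \<and> X \<subseteq> UNIV"
    then have b: "\<bar>x\<bar> \<le> Max (abs ` X)" if "x \<in> X" for x
      using that by (intro Max_ge) auto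
    show "\<forall>\<^sub>F y in sequentially. finite {- int y..int y} \<and> X \<subseteq> {- int y..int y} \<and> {- int y..int y} \<subseteq> UNIV"
      by (rule eventually_sequentiallyI[of "nat (Max (abs ` X))"]) (use b in \<open>force simp: abs_le_iff\<close>)
  qed
  with assms show ?thesis
    unfolding has_sum_def by (rule filterlim_compose)
qed

subsection \<open>Autocorrelation of the raised-cosine pulse\<close>

text \<open>What the standard formula leaves when symbols are uncorrelated: only its term
  \<open>q = 0\<close>. It is identified with the ensemble autocorrelation further on.\<close>

definition rc_autocorr :: "real \<Rightarrow> real \<Rightarrow> real \<Rightarrow> real" where
  "rc_autocorr Ts \<beta> \<tau> = time_autocorr (rc_pulse Ts \<beta>) \<tau> / Ts"

context
  fixes Ts \<beta> :: real
  assumes Ts: "Ts > 0" and \<beta>: "0 < \<beta>" "\<beta> \<le> 1"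
begin

lemma decaying_rc_pulse: "decaying (\<lambda>t. complex_of_real (rc_pulse Ts \<beta> t))"
proof -
  define m where "m = min 1 (1 / Ts\<^sup>2)"
  have m: "m > 0" "m \<le> 1" "m \<le> 1 / Ts\<^sup>2" using Ts by (auto simp: m_def)
  have "norm (complex_of_real (rc_pulse Ts \<beta> t)) \<le> ((1 + 1 / \<beta>\<^sup>2) / m) / (1 + t\<^sup>2)" for t
  proof -
    have "m * (1 + t\<^sup>2) \<le> 1 + (t / Ts)\<^sup>2"
      using m mult_right_mono[OF m(3), of "t\<^sup>2"] by (simp add: algebra_simps power_divide)
    then have "(1 + 1 / \<beta>\<^sup>2) / (1 + (t / Ts)\<^sup>2) \<le> (1 + 1 / \<beta>\<^sup>2) / (m * (1 + t\<^sup>2))"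
      using m by (intro divide_left_mono) auto
    with rc_pulse_decay[OF \<beta>, of "t / Ts"] show ?thesis
      by (simp add: rc_pulse_scale[OF Ts \<beta>(1), of t])
  qed
  moreover have "continuous_on UNIV (\<lambda>t. complex_of_real (rc_pulse Ts \<beta> t))"
    by (intro continuous_intros continuous_on_rc_pulse Ts \<beta>)
  ultimately show ?thesis unfolding decaying_def by blast
qed

lemma integrable_rrc_squared: "integrable lborel (\<lambda>f. (rrc_response Ts \<beta> f)\<^sup>2)"
  using lborel_integrable_real_affine[OF integrable_rrc_power[OF \<beta>, of 2], of Ts 0] Ts
  by (simp add: rrc_response_scale[OF Ts \<beta>(1), symmetric])

text \<open>The rescaling by \<open>Ts\<close> of the transform at unit period. Up to
  \<open>N0\<close> this integral is the correlation of the filtered noise at lag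
  \<open>t\<close>.\<close>

lemma inverse_fourier_rrc_squared:
  "(LBINT f. complex_of_real ((rrc_response Ts \<beta> f)\<^sup>2) * cis (2 * pi * f * t)) = of_real (rc_pulse Ts \<beta> t / Ts)"
proof -
  have "complex_of_real (rc_pulse Ts \<beta> t) = fourier (\<lambda>x. complex_of_real ((rrc_response 1 \<beta> x)\<^sup>2)) (2 * pi * (t / Ts))"
    by (subst rc_pulse_scale[OF Ts \<beta>(1)]) (simp add: fourier_rc[OF \<beta>] del: of_real_power)
  also have "\<dots> = of_real Ts * (LBINT f. complex_of_real ((rrc_response Ts \<beta> f)\<^sup>2) * cis (2 * pi * f * t))"
    unfolding fourier_def using Ts
    by (subst lborel_integral_real_affine[of Ts _ 0])
       (simp_all add: rrc_response_scale[OF Ts \<beta>(1)] scaleR_conv_of_real mult_ac)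
  finally show ?thesis using Ts by (simp add: field_simps)
qed

text \<open>Parseval for the probability density \<open>H\<^sup>2\<close>, which is squared in the
  process and becomes the fourth power. The factor \<open>2 * pi / Ts\<close> converts between time
  and the variable of \<open>F\<close>.\<close>

lemma integral_rc_pulse_mult:
  "(LBINT t. complex_of_real (rc_pulse Ts \<beta> t * rc_pulse Ts \<beta> (t + \<tau>))) =
    of_real Ts * fourier (\<lambda>x. complex_of_real (rrc_response 1 \<beta> x ^ 4)) (2 * pi * (\<tau> / Ts))"
proof -
  let ?D = "\<lambda>x. (rrc_response 1 \<beta> x)\<^sup>2"
  define F where "F = fourier (\<lambda>x. complex_of_real (?D x))"
  have F: "F w = of_real (rc_pulse 1 \<beta> (w / (2 * pi)))" for w
    by (simp add: F_def fourier_rc[OF \<beta>] del: of_real_power)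
  have Fg: "F (2 * pi / Ts * t) = of_real (rc_pulse Ts \<beta> t)" for t
    by (simp add: F rc_pulse_scale[OF Ts \<beta>(1), of t])
  have intF: "integrable lborel F"
  proof -
    have "integrable lborel (\<lambda>t. F (0 + 2 * pi / Ts * t))"
      using decaying_integrable[OF decaying_rc_pulse] by (simp add: Fg del: times_divide_eq_left)
    then show ?thesis
      using lborel_integrable_real_affine_iff[of "2 * pi / Ts" F 0] Ts by simp
  qed
  have "complex_of_real (LBINT x. ?D x) = fourier (\<lambda>x. complex_of_real (?D x)) 0"
    by (simp add: fourier_def flip: integral_complex_of_real)
  then have one: "(LBINT x. ?D x) = 1"
    by (simp add: fourier_rc \<beta> rc_pulse_0 del: of_real_power)
  have "continuous_on UNIV ?D"
    by (intro continuous_intros continuous_on_rrc_response \<beta>) simp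
  from parseval_autocorrelation[OF this _ _ one, of "2 * pi / Ts * \<tau>"] intF
  have P: "(LBINT w. F w * F (w + 2 * pi / Ts * \<tau>)) = of_real (2 * pi) * fourier (\<lambda>x. complex_of_real ((?D x)\<^sup>2)) (2 * pi / Ts * \<tau>)"
    using integrable_rrc_power[OF \<beta>, of 2] by (simp add: F_def)
  have "(LBINT w. F w * F (w + 2 * pi / Ts * \<tau>)) =
      of_real (2 * pi / Ts) * (LBINT t. F (2 * pi / Ts * t) * F (2 * pi / Ts * (t + \<tau>)))"
    using Ts by (subst lborel_integral_real_affine[of "2 * pi / Ts" _ 0]) (simp_all add: distrib_left scaleR_conv_of_real)
  also have "(LBINT t. F (2 * pi / Ts * t) * F (2 * pi / Ts * (t + \<tau>))) =
      (LBINT t. complex_of_real (rc_pulse Ts \<beta> t * rc_pulse Ts \<beta> (t + \<tau>)))"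
    unfolding Fg by simp
  finally have "of_real (2 * pi / Ts) * (LBINT t. complex_of_real (rc_pulse Ts \<beta> t * rc_pulse Ts \<beta> (t + \<tau>))) =
    of_real (2 * pi) * fourier (\<lambda>x. complex_of_real ((?D x)\<^sup>2)) (2 * pi / Ts * \<tau>)"
    by (simp only: P)
  moreover have "(?D x)\<^sup>2 = rrc_response 1 \<beta> x ^ 4" for x
    by (simp flip: power_mult)
  ultimately show ?thesis
    using Ts by (simp add: field_simps del: of_real_power)
qed

lemma of_real_rc_autocorr:
  "complex_of_real (rc_autocorr Ts \<beta> \<tau>) = fourier (\<lambda>x. complex_of_real (rrc_response 1 \<beta> x ^ 4)) (2 * pi * (\<tau> / Ts))"
  using integral_rc_pulse_mult[of \<tau>] Ts
  unfolding rc_autocorr_def time_autocorr_def integral_complex_of_real by simp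

lemma continuous_on_rc_autocorr: "continuous_on UNIV (rc_autocorr Ts \<beta>)"
proof -
  have "continuous_on UNIV (\<lambda>\<tau>. complex_of_real (rc_autocorr Ts \<beta> \<tau>))"
    unfolding of_real_rc_autocorr using integrable_rrc_power[OF \<beta>, of 4]
    by (intro continuous_on_compose2[OF continuous_on_fourier])
       (use Ts in \<open>auto intro!: continuous_intros simp del: of_real_power\<close>)
  from continuous_on_Re[OF this] show ?thesis by simp
qed

lemma rc_autocorr_eq:
  assumes "\<bar>\<tau>\<bar> \<noteq> Ts / (2 * \<beta>)" "\<bar>\<tau>\<bar> \<noteq> Ts / \<beta>"
  shows "rc_autocorr Ts \<beta> \<tau> = autocorr_formula Ts \<beta> \<tau>"
proof -
  have generic: "rc_autocorr Ts \<beta> \<tau> = autocorr_formula Ts \<beta> \<tau>"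
    if "\<tau> \<noteq> 0" "\<bar>\<tau>\<bar> \<noteq> Ts / (2 * \<beta>)" "\<bar>\<tau>\<bar> \<noteq> Ts / \<beta>" for \<tau>
  proof -
    have "\<bar>\<tau> / Ts\<bar> \<noteq> 1 / (2 * \<beta>)" "\<bar>\<tau> / Ts\<bar> \<noteq> 1 / \<beta>" "\<tau> / Ts \<noteq> 0"
      using that Ts \<beta> by (auto simp: abs_divide field_simps)
    then have "\<tau> / Ts \<noteq> 0" "\<tau> / Ts \<noteq> 1 / (2 * \<beta>)" "\<tau> / Ts \<noteq> - 1 / (2 * \<beta>)" "\<tau> / Ts \<noteq> 1 / \<beta>" "\<tau> / Ts \<noteq> - 1 / \<beta>"
      using \<beta> by (auto simp del: divide_eq_eq eq_divide_eq abs_divide)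
    from fourier_autocorr_generic[OF \<beta> this]
    have "complex_of_real (rc_autocorr Ts \<beta> \<tau>) = of_real (autocorr_formula 1 \<beta> (\<tau> / Ts))"
      by (simp only: of_real_rc_autocorr)
    then show ?thesis by (simp add: autocorr_formula_scale[of Ts])
  qed
  show ?thesis
  proof (cases "\<tau> = 0")
    case True
    \<comment> \<open>The generic computation excludes frequency zero, but \<open>nsinc\<close> is
      continuous there, so the closed form takes its limit value at lag zero.\<close>
    have "rc_autocorr Ts \<beta> 0 = autocorr_formula Ts \<beta> 0"
    proof (rule tendsto_unique)
      show "(rc_autocorr Ts \<beta> \<longlongrightarrow> rc_autocorr Ts \<beta> 0) (at 0)"
        using continuous_on_rc_autocorr by (simp add: continuous_on_def)
      have "isCont (autocorr_formula Ts \<beta>) 0"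
        unfolding autocorr_formula_def nsinc_def using Ts
        by (intro continuous_intros isCont_o2[OF _ isCont_sinc]) auto
      then have "(autocorr_formula Ts \<beta> \<longlongrightarrow> autocorr_formula Ts \<beta> 0) (at 0)"
        by (simp add: isCont_def)
      moreover have "\<forall>\<^sub>F x in at 0. autocorr_formula Ts \<beta> x = rc_autocorr Ts \<beta> x"
        by (rule eventually_mono[OF eventually_not_in_finite[of "{0, Ts / (2 * \<beta>), - (Ts / (2 * \<beta>)), Ts / \<beta>, - (Ts / \<beta>)}"]])
           (auto simp: generic abs_if split: if_splits)
      ultimately show "(rc_autocorr Ts \<beta> \<longlongrightarrow> autocorr_formula Ts \<beta> 0) (at 0)"
        by (rule Lim_transform_eventually)
    qed simp
    with True show ?thesis by simp
  qed (use generic assms in auto)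
qed

text \<open>The limit is over punctured neighbourhoods, so it determines the autocorrelation also at
  the singular lags, where the formula itself divides by zero.\<close>

lemma autocorr_formula_tendsto: "(autocorr_formula Ts \<beta> \<longlongrightarrow> rc_autocorr Ts \<beta> \<tau>) (at \<tau>)"
proof (rule Lim_transform_eventually)
  show "(rc_autocorr Ts \<beta> \<longlongrightarrow> rc_autocorr Ts \<beta> \<tau>) (at \<tau>)"
    using continuous_on_rc_autocorr by (simp add: continuous_on_def)
  show "\<forall>\<^sub>F x in at \<tau>. rc_autocorr Ts \<beta> x = autocorr_formula Ts \<beta> x"
    by (rule eventually_mono[OF eventually_not_in_finite[of "{Ts / (2 * \<beta>), - (Ts / (2 * \<beta>)), Ts / \<beta>, - (Ts / \<beta>)}"]])
       (auto simp: rc_autocorr_eq abs_if split: if_splits)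
qed

lemma rc_autocorr_0: "rc_autocorr Ts \<beta> 0 = 1 - \<beta> / 4"
  using rc_autocorr_eq[of 0] Ts \<beta> by (simp add: autocorr_formula_def nsinc_def)

lemma integral_shifted_rc_pulses:
  "(LBINT t. complex_of_real (rc_pulse Ts \<beta> (t - a)) * cnj (complex_of_real (rc_pulse Ts \<beta> (t - b)))) =
     of_real (Ts * rc_autocorr Ts \<beta> (a - b))"
proof -
  have "(LBINT t. complex_of_real (rc_pulse Ts \<beta> (t - a)) * cnj (complex_of_real (rc_pulse Ts \<beta> (t - b)))) =
      (LBINT t. complex_of_real (rc_pulse Ts \<beta> t * rc_pulse Ts \<beta> (t + (a - b))))"
    by (subst lborel_integral_real_affine[of 1 _ a]) (simp_all add: algebra_simps)
  then show ?thesis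
    using Ts by (simp add: integral_complex_of_real rc_autocorr_def time_autocorr_def del: of_real_mult)
qed

lemma integrable_rc_pulse_mult: "integrable lborel (\<lambda>t. rc_pulse Ts \<beta> t * rc_pulse Ts \<beta> (t + \<tau>))"
proof -
  have "decaying (\<lambda>t. complex_of_real (rc_pulse Ts \<beta> t) * cnj (complex_of_real (rc_pulse Ts \<beta> (t - (- \<tau>)))))"
    by (intro decaying_mult_cnj decaying_rc_pulse decaying_shift[of "\<lambda>t. complex_of_real (rc_pulse Ts \<beta> t)"])
  from integrable_Re[OF decaying_integrable[OF this]] show ?thesis by simp
qed

lemma rc_pulse_at_symbols:
  "rc_pulse Ts \<beta> (of_int k * Ts) = (if k = 0 then 1 else 0)"
  using Ts \<beta> by (simp add: rc_pulse_scale[OF Ts \<beta>(1), of "of_int k * Ts"] rc_pulse_int rc_pulse_0)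

end

subsection \<open>Linearly modulated signals\<close>

lemma borel_measurable_cnj [measurable]: "cnj \<in> borel_measurable borel"
  by (intro borel_measurable_continuous_onI continuous_intros)

definition lin_mod :: "real \<Rightarrow> (int \<Rightarrow> 'w \<Rightarrow> real) \<Rightarrow> (real \<Rightarrow> complex) \<Rightarrow> real \<Rightarrow> 'w \<Rightarrow> complex" where
  "lin_mod Ts I p t \<omega> = (\<Sum>\<^sub>\<infinity>k\<in>UNIV. of_real (I k \<omega>) * p (t - of_int k * Ts))"

lemma sum_indicator_shifted_windows:
  fixes t Ts x :: real
  assumes "Ts > 0"
  shows "(\<Sum>k\<in>{- int n..int n}. indicator {t - of_int k * Ts<..t + Ts - of_int k * Ts} x) =
    (indicator {t - real n * Ts<..t + Ts + real n * Ts} x :: real)"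
proof (induction n)
  case (Suc n)
  have eq: "{- int (Suc n)..int (Suc n)} = insert (int (Suc n)) (insert (- int (Suc n)) {- int n..int n})"
    by auto
  have "(\<Sum>k\<in>{- int (Suc n)..int (Suc n)}. indicator {t - of_int k * Ts<..t + Ts - of_int k * Ts} x) =
     indicator {t - real (Suc n) * Ts<..t + Ts - real (Suc n) * Ts} x
     + (indicator {t + real (Suc n) * Ts<..t + Ts + real (Suc n) * Ts} x
     + (indicator {t - real n * Ts<..t + Ts + real n * Ts} x :: real))"
    unfolding eq Suc.IH[symmetric] by (subst sum.insert, simp, simp)+ (simp add: algebra_simps)
  also have "\<dots> = indicator {t - real (Suc n) * Ts<..t + Ts + real (Suc n) * Ts} x"
  proof -
    define r where "r = real (Suc n) * Ts"
    have "t - real n * Ts = t + Ts - r" "t + Ts + real n * Ts = t + r" "r \<ge> Ts"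
      using assms by (simp_all add: r_def algebra_simps)
    then show ?thesis
      unfolding r_def[symmetric] using assms by (auto simp: indicator_def)
  qed
  finally show ?case .
qed simp

text \<open>Unfolding: integrating the lattice sum over one period collects the integrals of
  \<open>F\<close> over adjacent windows that exhaust the line. The lattice bound allows the sum to
  be exchanged with the integral.\<close>

lemma integral_periodization:
  fixes F :: "real \<Rightarrow> complex"
  assumes F: "decaying F" and Ts: "Ts > 0"
    and G: "\<And>v. (\<lambda>n. \<Sum>k\<in>{- int n..int n}. F (v - of_int k * Ts)) \<longlonglongrightarrow> G v"
  shows "set_integrable lborel {t..t + Ts} G"
    and "(LINT v:{t..t + Ts}|lborel. G v) = (LBINT v. F v)"
proof -
  have [measurable]: "F \<in> borel_measurable borel" by (rule decaying_measurable[OF F])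
  have [measurable]: "G \<in> borel_measurable borel"
    by (rule borel_measurable_LIMSEQ_metric[OF _ G]) measurable
  obtain B where B: "B \<ge> 0"
    "\<And>v k. \<bar>v\<bar> \<le> \<bar>t\<bar> + Ts \<Longrightarrow> norm (F (v - of_int k * Ts)) \<le> B * (1 / (1 + (of_int k)\<^sup>2))"
    using decaying_lattice_bound[OF F Ts, of "\<bar>t\<bar> + Ts"] by blast
  define K where "K = (\<Sum>\<^sub>\<infinity>k::int. B * (1 / (1 + (of_int k)\<^sup>2)))"
  have summ: "(\<lambda>k::int. B * (1 / (1 + (of_int k)\<^sup>2))) summable_on UNIV"
    by (intro summable_on_cmult_right summable_on_inverse_square_int)
  let ?S = "\<lambda>n v. \<Sum>k\<in>{- int n..int n}. F (v - of_int k * Ts)"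
  have K: "norm (?S n v) \<le> K" if "v \<in> {t..t + Ts}" for n v
  proof -
    have v: "\<bar>v\<bar> \<le> \<bar>t\<bar> + Ts" using that Ts by auto
    have "norm (?S n v) \<le> (\<Sum>k\<in>{- int n..int n}. norm (F (v - of_int k * Ts)))"
      by (rule norm_sum)
    also have "\<dots> \<le> (\<Sum>k\<in>{- int n..int n}. B * (1 / (1 + (of_int k)\<^sup>2)))"
      by (intro sum_mono B v)
    also have "\<dots> \<le> K"
      unfolding K_def by (rule finite_sum_le_infsum[OF summ]) (use B in auto)
    finally show ?thesis .
  qed
  have lim: "AE v in lborel. (\<lambda>n. indicator {t..t+Ts} v *\<^sub>R ?S n v) \<longlonglongrightarrow> indicator {t..t+Ts} v *\<^sub>R G v"
    by (intro AE_I2 tendsto_scaleR tendsto_const G)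
  have bnd: "AE v in lborel. norm (indicator {t..t+Ts} v *\<^sub>R ?S n v) \<le> K * indicator {t..t+Ts} v" for n
    using K by (intro AE_I2) (auto simp: indicator_def)
  have int: "integrable lborel (\<lambda>v. K * indicator {t..t+Ts} v)"
    by (intro integrable_mult_right integrable_real_indicator) (auto simp: emeasure_lborel_Icc_eq)
  show "set_integrable lborel {t..t + Ts} G"
    unfolding set_integrable_def
    by (rule integrable_dominated_convergence[OF _ _ int lim bnd]) measurable
  have "(\<lambda>n. LBINT v. indicator {t..t+Ts} v *\<^sub>R ?S n v) \<longlonglongrightarrow> (LBINT v. indicator {t..t+Ts} v *\<^sub>R G v)"
    by (rule integral_dominated_convergence[OF _ _ int lim bnd]) measurable
  moreover have "(LBINT v. indicator {t..t+Ts} v *\<^sub>R ?S n v) =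
      (LBINT x. indicator {t - real n * Ts<..t + Ts + real n * Ts} x *\<^sub>R F x)" for n
  proof -
    have intk: "integrable lborel (\<lambda>x. indicator {t - of_int k * Ts<..t + Ts - of_int k * Ts} x *\<^sub>R F x)" for k
      by (intro integrable_mult_indicator decaying_integrable[OF F]) simp
    have shift: "(LBINT v. indicator {t<..t+Ts} v *\<^sub>R F (v - of_int k * Ts)) =
        (LBINT x. indicator {t - of_int k * Ts<..t + Ts - of_int k * Ts} x *\<^sub>R F x)"
      and shift_int: "integrable lborel (\<lambda>v. indicator {t<..t+Ts} v *\<^sub>R F (v - of_int k * Ts))" for k
    proof -
      have "indicator {t - of_int k * Ts<..t + Ts - of_int k * Ts} (v - of_int k * Ts) = (indicator {t<..t+Ts} v :: real)" for v
        by (auto simp: indicator_def)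
      then show "(LBINT v. indicator {t<..t+Ts} v *\<^sub>R F (v - of_int k * Ts)) =
        (LBINT x. indicator {t - of_int k * Ts<..t + Ts - of_int k * Ts} x *\<^sub>R F x)"
        and "integrable lborel (\<lambda>v. indicator {t<..t+Ts} v *\<^sub>R F (v - of_int k * Ts))"
        using lborel_integral_real_affine[of 1 "\<lambda>x. indicator {t - of_int k * Ts<..t + Ts - of_int k * Ts} x *\<^sub>R F x" "- (of_int k * Ts)"]
         lborel_integrable_real_affine[OF intk[of k], of 1 "- (of_int k * Ts)"]
        by simp_all
    qed
    \<comment> \<open>Dropping the left endpoint, a null set, gives half-open windows whose
      translates tile without overlap.\<close>
    have "(LBINT v. indicator {t..t+Ts} v *\<^sub>R ?S n v) = (LBINT v. indicator {t<..t+Ts} v *\<^sub>R ?S n v)"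
      by (rule integral_discrete_difference[where X = "{t}"]) (auto simp: indicator_def)
    also have "\<dots> = (\<Sum>k\<in>{- int n..int n}. LBINT v. indicator {t<..t+Ts} v *\<^sub>R F (v - of_int k * Ts))"
      unfolding scaleR_sum_right by (rule Bochner_Integration.integral_sum) (rule shift_int)
    also have "\<dots> = (LBINT x. \<Sum>k\<in>{- int n..int n}. indicator {t - of_int k * Ts<..t + Ts - of_int k * Ts} x *\<^sub>R F x)"
      unfolding shift by (rule Bochner_Integration.integral_sum[symmetric]) (rule intk)
    also have "\<dots> = (LBINT x. indicator {t - real n * Ts<..t + Ts + real n * Ts} x *\<^sub>R F x)"
      unfolding scaleR_sum_left[symmetric] sum_indicator_shifted_windows[OF Ts] ..
    finally show ?thesis .
  qed
  moreover have "(\<lambda>n. LBINT x. indicator {t - real n * Ts<..t + Ts + real n * Ts} x *\<^sub>R F x) \<longlonglongrightarrow> (LBINT x. F x)"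
  proof (rule integral_dominated_convergence)
    show "integrable lborel (\<lambda>x. norm (F x))" using decaying_integrable[OF F] by simp
    show "AE x in lborel. (\<lambda>n. indicator {t - real n * Ts<..t + Ts + real n * Ts} x *\<^sub>R F x) \<longlonglongrightarrow> F x"
    proof (rule AE_I2)
      fix x
      obtain m where m: "\<bar>x - t\<bar> / Ts < real m" using reals_Archimedean2 by blast
      have "\<forall>\<^sub>F n in sequentially. F x = indicator {t - real n * Ts<..t + Ts + real n * Ts} x *\<^sub>R F x"
      proof (rule eventually_sequentiallyI[of m])
        fix n assume "m \<le> n"
        then have "\<bar>x - t\<bar> / Ts < real n" using m by linarith
        then have "\<bar>x - t\<bar> < real n * Ts" using Ts by (simp add: pos_divide_less_eq)
        then show "F x = indicator {t - real n * Ts<..t + Ts + real n * Ts} x *\<^sub>R F x"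
          using Ts by (auto simp: indicator_def abs_less_iff)
      qed
      then show "(\<lambda>n. indicator {t - real n * Ts<..t + Ts + real n * Ts} x *\<^sub>R F x) \<longlonglongrightarrow> F x"
        by (rule Lim_transform_eventually[OF tendsto_const])
    qed
    show "AE x in lborel. norm (indicator {t - real n * Ts<..t + Ts + real n * Ts} x *\<^sub>R F x) \<le> norm (F x)" for n
      by (intro AE_I2) (auto simp: indicator_def)
  qed measurable
  ultimately show "(LINT v:{t..t + Ts}|lborel. G v) = (LBINT v. F v)"
    unfolding set_lebesgue_integral_def by (simp add: LIMSEQ_unique)
qed

section \<open>Modulated signals as random variables: linearity, means and correlations\<close>

locale symbol_source = prob_space M for M :: "'w measure" +
  fixes A :: "real set" and I :: "int \<Rightarrow> 'w \<Rightarrow> real" and Ts :: real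
  assumes symbols: "symbol_sequence M A I" and Ts: "Ts > 0"
begin

lemma symbol_measurable [measurable]: "I k \<in> borel_measurable M"
  using symbols measurable_compose[of "I k" M "count_space A" "\<lambda>x. x" borel] by (simp add: symbol_sequence_def)

lemma symbol_bound:
  obtains b where "b \<ge> 0" "\<And>k \<omega>. \<omega> \<in> space M \<Longrightarrow> \<bar>I k \<omega>\<bar> \<le> b"
proof (rule that[of "\<Sum>a\<in>A. \<bar>a\<bar>"])
  fix k \<omega> assume "\<omega> \<in> space M"
  then have "I k \<omega> \<in> A"
    using symbols measurable_space[of "I k" M "count_space A" \<omega>] by (simp add: symbol_sequence_def)
  then show "\<bar>I k \<omega>\<bar> \<le> (\<Sum>a\<in>A. \<bar>a\<bar>)"
    using symbols by (intro member_le_sum[of _ _ abs]) (auto simp: symbol_sequence_def)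
qed (simp add: sum_nonneg)

lemma integrable_symbol_bounded:
  assumes [measurable]: "f \<in> borel_measurable M" and "\<And>\<omega>. \<omega> \<in> space M \<Longrightarrow> norm (f \<omega> :: 'b::{banach, second_countable_topology}) \<le> c"
  shows "integrable M f"
  by (rule integrable_const_bound[of _ c]) (use assms in auto)

lemma integrable_symbol [simp]: "integrable M (I k)"
  by (rule symbol_bound) (rule integrable_symbol_bounded, auto)

lemma integrable_symbol_mult [simp]: "integrable M (\<lambda>\<omega>. I k \<omega> * I l \<omega>)"
proof (rule symbol_bound)
  fix b assume b: "b \<ge> 0" "\<And>k \<omega>. \<omega> \<in> space M \<Longrightarrow> \<bar>I k \<omega>\<bar> \<le> b"
  then show ?thesis
    by (intro integrable_symbol_bounded[of _ "b * b"]) (auto simp: abs_mult intro!: mult_mono)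
qed

lemma expectation_symbol: "expectation (I k) = 0"
  using symbols by (simp add: symbol_sequence_def)

lemma expectation_symbol_mult: "expectation (\<lambda>\<omega>. I k \<omega> * I l \<omega>) = (if k = l then 1 else 0)"
proof (cases "k = l")
  case True
  then show ?thesis using symbols by (simp add: symbol_sequence_def power2_eq_square)
next
  case False
  moreover have "\<forall>k q. q \<noteq> 0 \<longrightarrow> expectation (\<lambda>\<omega>. I k \<omega> * I (k + q) \<omega>) = 0"
    using symbols by (simp add: symbol_sequence_def)
  from this[rule_format, of "l - k" k] False have "expectation (\<lambda>\<omega>. I k \<omega> * I l \<omega>) = 0"
    by simp
  ultimately show ?thesis by simp
qed

lemma summable_lin_mod_norm:
  assumes p: "decaying p" and \<omega>: "\<omega> \<in> space M"
  shows "(\<lambda>k. norm (complex_of_real (I k \<omega>) * p (t - of_int k * Ts))) summable_on UNIV"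
proof -
  obtain b where b: "b \<ge> 0" "\<And>k \<omega>. \<omega> \<in> space M \<Longrightarrow> \<bar>I k \<omega>\<bar> \<le> b"
    using symbol_bound by blast
  obtain B where B: "B \<ge> 0" "\<And>k. norm (p (t - of_int k * Ts)) \<le> B * (1 / (1 + (of_int k)\<^sup>2))"
    using decaying_lattice_bound[OF p Ts, of "\<bar>t\<bar>"] by (metis order_refl)
  show ?thesis
  proof (rule summable_on_comparison_test)
    show "(\<lambda>k::int. b * (B * (1 / (1 + (of_int k)\<^sup>2)))) summable_on UNIV"
      by (intro summable_on_cmult_right summable_on_inverse_square_int)
    show "norm (complex_of_real (I k \<omega>) * p (t - of_int k * Ts)) \<le> b * (B * (1 / (1 + (of_int k)\<^sup>2)))" for k
      unfolding norm_mult norm_of_real by (intro mult_mono b B \<omega>) (use b in auto)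
  qed auto
qed

lemma summable_lin_mod:
  assumes "decaying p" "\<omega> \<in> space M"
  shows "(\<lambda>k. complex_of_real (I k \<omega>) * p (t - of_int k * Ts)) summable_on UNIV"
  by (rule abs_summable_summable[OF summable_lin_mod_norm[OF assms]])

lemma lin_mod_add:
  assumes "decaying p" "decaying q" "\<omega> \<in> space M"
  shows "lin_mod Ts I (\<lambda>t. p t + q t) t \<omega> = lin_mod Ts I p t \<omega> + lin_mod Ts I q t \<omega>"
  unfolding lin_mod_def
  by (simp add: distrib_left infsum_add summable_lin_mod assms)

text \<open>Multiplication by a scalar commutes with \<open>infsum\<close> irrespective of
  convergence, so the equation holds for every \<omega>.\<close>

lemma lin_mod_cmult: "lin_mod Ts I (\<lambda>t. c * p t) t \<omega> = c * lin_mod Ts I p t \<omega>"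
  unfolding lin_mod_def by (simp add: mult.left_commute[of _ c] infsum_cmult_right')

lemma lin_mod_zero [simp]: "lin_mod Ts I (\<lambda>t. 0) t \<omega> = 0"
  by (simp add: lin_mod_def)

lemma lin_mod_sum:
  assumes "\<And>i. i \<in> S \<Longrightarrow> decaying (p i)" "\<omega> \<in> space M"
  shows "lin_mod Ts I (\<lambda>t. \<Sum>i\<in>S. p i t) t \<omega> = (\<Sum>i\<in>S. lin_mod Ts I (p i) t \<omega>)"
  using assms by (induction S rule: infinite_finite_induct) (auto simp: lin_mod_add decaying_sum)

text \<open>Dominated convergence of these partial sums lets expectations pass to the infinite sum.\<close>

lemma lin_mod_partial_sums:
  fixes t :: real
  assumes p: "decaying p"
  defines "S \<equiv> \<lambda>n \<omega>. \<Sum>k\<in>{- int n..int n}. complex_of_real (I k \<omega>) * p (t - of_int k * Ts)"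
  shows "\<omega> \<in> space M \<Longrightarrow> (\<lambda>n. S n \<omega>) \<longlonglongrightarrow> lin_mod Ts I p t \<omega>"
    and "\<exists>K\<ge>0. \<forall>n. \<forall>\<omega>\<in>space M. norm (S n \<omega>) \<le> K"
    and "S n \<in> borel_measurable M"
proof -
  show "(\<lambda>n. S n \<omega>) \<longlonglongrightarrow> lin_mod Ts I p t \<omega>" if "\<omega> \<in> space M"
    unfolding S_def lin_mod_def
    by (intro has_sum_int_imp_symmetric_limit has_sum_infsum summable_lin_mod p that)
  show "S n \<in> borel_measurable M" unfolding S_def by measurable
  obtain b where b: "b \<ge> 0" "\<And>k \<omega>. \<omega> \<in> space M \<Longrightarrow> \<bar>I k \<omega>\<bar> \<le> b"
    using symbol_bound by blast
  obtain B where B: "B \<ge> 0" "\<And>k. norm (p (t - of_int k * Ts)) \<le> B * (1 / (1 + (of_int k)\<^sup>2))"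
    using decaying_lattice_bound[OF p Ts, of "\<bar>t\<bar>"] by (metis order_refl)
  have summ: "(\<lambda>k::int. b * (B * (1 / (1 + (of_int k)\<^sup>2)))) summable_on UNIV"
    by (intro summable_on_cmult_right summable_on_inverse_square_int)
  let ?K = "\<Sum>\<^sub>\<infinity>k::int. b * (B * (1 / (1 + (of_int k)\<^sup>2)))"
  have "norm (S n \<omega>) \<le> ?K" if "\<omega> \<in> space M" for n \<omega>
  proof -
    have "norm (S n \<omega>) \<le> (\<Sum>k\<in>{- int n..int n}. norm (complex_of_real (I k \<omega>) * p (t - of_int k * Ts)))"
      unfolding S_def by (rule norm_sum)
    also have "\<dots> \<le> (\<Sum>k\<in>{- int n..int n}. b * (B * (1 / (1 + (of_int k)\<^sup>2))))"
      unfolding norm_mult norm_of_real by (intro sum_mono mult_mono b B that) (use b in auto)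
    also have "\<dots> \<le> ?K"
      by (rule finite_sum_le_infsum[OF summ]) (use b B in auto)
    finally show ?thesis .
  qed
  moreover have "?K \<ge> 0" by (intro infsum_nonneg) (use b B in auto)
  ultimately show "\<exists>K\<ge>0. \<forall>n. \<forall>\<omega>\<in>space M. norm (S n \<omega>) \<le> K" by blast
qed

lemma lin_mod_measurable:
  assumes "decaying p"
  shows "lin_mod Ts I p t \<in> borel_measurable M"
  by (rule borel_measurable_LIMSEQ_metric[OF lin_mod_partial_sums(3,1)[OF assms]])

lemma lin_mod_mean:
  assumes p: "decaying p"
  shows "integrable M (lin_mod Ts I p t)" "expectation (lin_mod Ts I p t) = 0"
proof -
  obtain K where K: "K \<ge> 0" "\<And>n \<omega>. \<omega> \<in> space M \<Longrightarrow> norm (\<Sum>k\<in>{- int n..int n}. complex_of_real (I k \<omega>) * p (t - of_int k * Ts)) \<le> K"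
    using lin_mod_partial_sums(2)[OF p, of t] by blast
  note dom = lin_mod_measurable[OF p] lin_mod_partial_sums(3)[OF p] _ _ AE_I2[OF K(2)]
  show "integrable M (lin_mod Ts I p t)"
    by (rule integrable_dominated_convergence[OF dom]) (auto intro!: lin_mod_partial_sums(1) p)
  have "(\<lambda>n. expectation (\<lambda>\<omega>. \<Sum>k\<in>{- int n..int n}. complex_of_real (I k \<omega>) * p (t - of_int k * Ts))) \<longlonglongrightarrow>
      expectation (lin_mod Ts I p t)"
    by (rule integral_dominated_convergence[OF dom]) (auto intro!: lin_mod_partial_sums(1) p)
  moreover have "expectation (\<lambda>\<omega>. \<Sum>k\<in>{- int n..int n}. complex_of_real (I k \<omega>) * p (t - of_int k * Ts)) = 0" for n
    by (subst Bochner_Integration.integral_sum) (auto simp: expectation_symbol)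
  ultimately show "expectation (lin_mod Ts I p t) = 0"
    by (simp add: LIMSEQ_const_iff)
qed

text \<open>The product of two partial sums is a double sum of which only the diagonal survives the
  expectation. The uniform bounds on both factors dominate the limit.\<close>

lemma lin_mod_correlation:
  assumes p: "decaying p" and q: "decaying q"
  shows "integrable M (\<lambda>\<omega>. lin_mod Ts I p t \<omega> * cnj (lin_mod Ts I q t \<omega>))"
    and "(\<lambda>n. \<Sum>k\<in>{- int n..int n}. p (t - of_int k * Ts) * cnj (q (t - of_int k * Ts)))
      \<longlonglongrightarrow> expectation (\<lambda>\<omega>. lin_mod Ts I p t \<omega> * cnj (lin_mod Ts I q t \<omega>))"
proof -
  let ?S = "\<lambda>p n \<omega>. \<Sum>k\<in>{- int n..int n}. complex_of_real (I k \<omega>) * p (t - of_int k * Ts)"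
  obtain K where K: "K \<ge> 0" "\<And>n \<omega>. \<omega> \<in> space M \<Longrightarrow> norm (?S p n \<omega>) \<le> K"
    using lin_mod_partial_sums(2)[OF p, of t] by blast
  obtain L where L: "L \<ge> 0" "\<And>n \<omega>. \<omega> \<in> space M \<Longrightarrow> norm (?S q n \<omega>) \<le> L"
    using lin_mod_partial_sums(2)[OF q, of t] by blast
  have [measurable]: "lin_mod Ts I p t \<in> borel_measurable M" "lin_mod Ts I q t \<in> borel_measurable M"
    by (intro lin_mod_measurable p q)+
  have bnd: "AE \<omega> in M. norm (?S p n \<omega> * cnj (?S q n \<omega>)) \<le> K * L" for n
    using K L by (intro AE_I2) (auto simp: norm_mult simp del: cnj_sum intro!: mult_mono)
  have lim: "AE \<omega> in M. (\<lambda>n. ?S p n \<omega> * cnj (?S q n \<omega>)) \<longlonglongrightarrow> lin_mod Ts I p t \<omega> * cnj (lin_mod Ts I q t \<omega>)"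
    by (intro AE_I2 tendsto_mult tendsto_cnj lin_mod_partial_sums(1) p q)
  have m: "(\<lambda>\<omega>. lin_mod Ts I p t \<omega> * cnj (lin_mod Ts I q t \<omega>)) \<in> borel_measurable M"
    "(\<lambda>\<omega>. ?S p n \<omega> * cnj (?S q n \<omega>)) \<in> borel_measurable M" for n
    by measurable
  note dom = m _ lim bnd
  show "integrable M (\<lambda>\<omega>. lin_mod Ts I p t \<omega> * cnj (lin_mod Ts I q t \<omega>))"
    by (rule integrable_dominated_convergence[OF dom]) simp
  have "(\<lambda>n. expectation (\<lambda>\<omega>. ?S p n \<omega> * cnj (?S q n \<omega>))) \<longlonglongrightarrow>
      expectation (\<lambda>\<omega>. lin_mod Ts I p t \<omega> * cnj (lin_mod Ts I q t \<omega>))"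
    by (rule integral_dominated_convergence[OF dom]) simp
  moreover have "expectation (\<lambda>\<omega>. ?S p n \<omega> * cnj (?S q n \<omega>)) =
      (\<Sum>k\<in>{- int n..int n}. p (t - of_int k * Ts) * cnj (q (t - of_int k * Ts)))" for n
  proof -
    have "expectation (\<lambda>\<omega>. ?S p n \<omega> * cnj (?S q n \<omega>)) = expectation (\<lambda>\<omega>. \<Sum>k\<in>{- int n..int n}. \<Sum>l\<in>{- int n..int n}.
        (p (t - of_int k * Ts) * cnj (q (t - of_int l * Ts))) * complex_of_real (I k \<omega> * I l \<omega>))"
      by (simp add: sum_product mult_ac)
    also have "\<dots> = (\<Sum>k\<in>{- int n..int n}. \<Sum>l\<in>{- int n..int n}.
        (p (t - of_int k * Ts) * cnj (q (t - of_int l * Ts))) * complex_of_real (expectation (\<lambda>\<omega>. I k \<omega> * I l \<omega>)))"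
      by (subst Bochner_Integration.integral_sum | subst integral_mult_right | subst integral_complex_of_real |
          auto intro!: Bochner_Integration.integrable_sum integrable_mult_right integrable_of_real sum.cong simp del: of_real_mult)+
    also have "\<dots> = (\<Sum>k\<in>{- int n..int n}. p (t - of_int k * Ts) * cnj (q (t - of_int k * Ts)))"
      by (simp add: expectation_symbol_mult if_distrib[of "\<lambda>x. _ * x"] if_distrib[of complex_of_real] cong: if_cong)
    finally show ?thesis .
  qed
  ultimately show "(\<lambda>n. \<Sum>k\<in>{- int n..int n}. p (t - of_int k * Ts) * cnj (q (t - of_int k * Ts)))
      \<longlonglongrightarrow> expectation (\<lambda>\<omega>. lin_mod Ts I p t \<omega> * cnj (lin_mod Ts I q t \<omega>))"
    by simp
qed

text \<open>Averaging over a period makes modulation an isometry up to the factor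
  \<open>1 / Ts\<close>; all statistics of the signals become integrals of pulses.\<close>

lemma lin_mod_avg_correlation:
  assumes p: "decaying p" and q: "decaying q"
  shows "has_avg_expectation M Ts (\<lambda>t \<omega>. lin_mod Ts I p t \<omega> * cnj (lin_mod Ts I q t \<omega>)) t
    ((1 / Ts) *\<^sub>R (LBINT v. p v * cnj (q v)))"
  unfolding has_avg_expectation_def avg_expectation_def
  using lin_mod_correlation[OF p q] integral_periodization[OF decaying_mult_cnj[OF p q] Ts lin_mod_correlation(2)[OF p q]]
  by simp

end

subsection \<open>Filtered white Gaussian noise\<close>

context prob_space
begin

lemma distributed_cong_AE:
  assumes "distributed M N X f" "Y \<in> measurable M N" "AE \<omega> in M. X \<omega> = Y \<omega>"
  shows "distributed M N Y f"
proof -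
  have "distr M N X = distr M N Y"
    using assms by (intro distr_cong_AE) (auto simp: distributed_def)
  with assms show ?thesis by (simp add: distributed_def)
qed

lemma indep_var_cong_AE:
  assumes ind: "indep_var S X T Y" and meas: "X' \<in> measurable M S" "Y' \<in> measurable M T"
    and eq: "AE \<omega> in M. X \<omega> = X' \<omega>" "AE \<omega> in M. Y \<omega> = Y' \<omega>"
  shows "indep_var S X' T Y'"
proof -
  have [measurable]: "X \<in> measurable M S" "Y \<in> measurable M T"
    using ind by (auto simp: indep_var_distribution_eq)
  have "distr M S X = distr M S X'" "distr M T Y = distr M T Y'"
    using meas eq by (auto intro!: distr_cong_AE)
  moreover have "distr M (S \<Otimes>\<^sub>M T) (\<lambda>\<omega>. (X \<omega>, Y \<omega>)) = distr M (S \<Otimes>\<^sub>M T) (\<lambda>\<omega>. (X' \<omega>, Y' \<omega>))"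
    using meas eq by (intro distr_cong_AE) auto
  ultimately show ?thesis
    using ind meas by (simp add: indep_var_distribution_eq)
qed

text \<open>White noise is linear only up to null sets, so Gaussian laws have to be transported
  along almost sure equality.\<close>

lemma circular_gaussian_cong_AE:
  assumes cg: "circular_gaussian M X v" and Y: "Y \<in> borel_measurable M" and eq: "AE \<omega> in M. X \<omega> = Y \<omega>"
  shows "circular_gaussian M Y v"
proof -
  have eqs: "AE \<omega> in M. Re (X \<omega>) = Re (Y \<omega>)" "AE \<omega> in M. Im (X \<omega>) = Im (Y \<omega>)"
    using eq by (auto elim: eventually_mono)
  have meas: "(\<lambda>\<omega>. Re (Y \<omega>)) \<in> borel_measurable M" "(\<lambda>\<omega>. Im (Y \<omega>)) \<in> borel_measurable M"
    using Y by measurable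
  show ?thesis
  proof (cases "v = 0")
    case True
    have "AE \<omega> in M. X \<omega> = 0" using cg True by (simp add: circular_gaussian_def)
    with eq have "AE \<omega> in M. Y \<omega> = 0" by eventually_elim simp
    with True Y show ?thesis by (simp add: circular_gaussian_def)
  next
    case False
    then have "distributed M lborel (\<lambda>\<omega>. Re (X \<omega>)) (normal_density 0 (sqrt (v / 2)))"
      "distributed M lborel (\<lambda>\<omega>. Im (X \<omega>)) (normal_density 0 (sqrt (v / 2)))"
      "indep_var borel (\<lambda>\<omega>. Re (X \<omega>)) borel (\<lambda>\<omega>. Im (X \<omega>))" "v \<ge> 0"
      using cg by (auto simp: circular_gaussian_def)
    with False Y show ?thesis
      using distributed_cong_AE[OF _ _ eqs(1)] distributed_cong_AE[OF _ _ eqs(2)]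
        indep_var_cong_AE[OF _ meas eqs] meas
      unfolding circular_gaussian_def by simp
  qed
qed

lemma centered_normal_moments:
  assumes D: "distributed M lborel X (normal_density 0 \<sigma>)" and \<sigma>: "\<sigma> > 0"
  shows "integrable M X" "expectation X = 0" "integrable M (\<lambda>\<omega>. (X \<omega>)\<^sup>2)" "expectation (\<lambda>\<omega>. (X \<omega>)\<^sup>2) = \<sigma>\<^sup>2"
proof -
  show "integrable M X"
    using distributed_integrable[OF D, of "\<lambda>x. x"] integrable_normal_moment_nz_1[OF \<sigma>, of 0] by simp
  show "integrable M (\<lambda>\<omega>. (X \<omega>)\<^sup>2)"
    using distributed_integrable[OF D, of "\<lambda>x. x\<^sup>2"] integrable_normal_moment[OF \<sigma>, of 0 2] by simp
  show *: "expectation X = 0" by (rule normal_distributed_expectation[OF \<sigma> D])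
  show "expectation (\<lambda>\<omega>. (X \<omega>)\<^sup>2) = \<sigma>\<^sup>2"
    using normal_distributed_variance[OF \<sigma> D] by (simp add: *)
qed

lemma circular_gaussian_moments:
  assumes cg: "circular_gaussian M X v"
  shows "X \<in> borel_measurable M" "integrable M X" "expectation X = 0"
    "integrable M (\<lambda>\<omega>. (cmod (X \<omega>))\<^sup>2)" "expectation (\<lambda>\<omega>. (cmod (X \<omega>))\<^sup>2) = v"
proof -
  show [measurable]: "X \<in> borel_measurable M" using cg by (simp add: circular_gaussian_def)
  have "integrable M X \<and> expectation X = 0 \<and> integrable M (\<lambda>\<omega>. (cmod (X \<omega>))\<^sup>2) \<and> expectation (\<lambda>\<omega>. (cmod (X \<omega>))\<^sup>2) = v"
  proof (cases "v = 0")
    case True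
    then have z: "AE \<omega> in M. X \<omega> = 0" using cg by (simp add: circular_gaussian_def)
    then have "AE \<omega> in M. (cmod (X \<omega>))\<^sup>2 = 0" by eventually_elim simp
    then show ?thesis
      using True z integrable_cong_AE[of X M "\<lambda>_. 0"] integral_cong_AE[of X M "\<lambda>_. 0"]
        integrable_cong_AE[of "\<lambda>\<omega>. (cmod (X \<omega>))\<^sup>2" M "\<lambda>_. 0"] integral_cong_AE[of "\<lambda>\<omega>. (cmod (X \<omega>))\<^sup>2" M "\<lambda>_. 0"]
      by simp
  next
    case False
    then have D: "distributed M lborel (\<lambda>\<omega>. Re (X \<omega>)) (normal_density 0 (sqrt (v / 2)))"
      "distributed M lborel (\<lambda>\<omega>. Im (X \<omega>)) (normal_density 0 (sqrt (v / 2)))" and v: "v > 0"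
      using cg by (auto simp: circular_gaussian_def)
    then have s: "sqrt (v / 2) > 0" by simp
    note re = centered_normal_moments[OF D(1) s] and im = centered_normal_moments[OF D(2) s]
    have eq: "X = (\<lambda>\<omega>. of_real (Re (X \<omega>)) + \<i> * of_real (Im (X \<omega>)))"
      by (simp add: complex_eq_iff fun_eq_iff)
    have "integrable M X" by (subst eq) (intro Bochner_Integration.integrable_add integrable_mult_right integrable_of_real re im)
    moreover have "expectation X = 0"
      by (subst eq, subst Bochner_Integration.integral_add)
         (auto intro!: integrable_mult_right integrable_of_real simp: re im integral_complex_of_real)
    ultimately show ?thesis
      using re im v by (simp add: cmod_power2)
  qed
  then show "integrable M X" "expectation X = 0"
    "integrable M (\<lambda>\<omega>. (cmod (X \<omega>))\<^sup>2)" "expectation (\<lambda>\<omega>. (cmod (X \<omega>))\<^sup>2) = v" by auto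
qed

end

lemma cmod_add_square:
  "(cmod (x + c * y))\<^sup>2 = (cmod x)\<^sup>2 + (cmod c)\<^sup>2 * (cmod y)\<^sup>2 + 2 * Re (cnj c * (x * cnj y))"
  unfolding cmod_power2 by (simp add: power2_eq_square algebra_simps)

lemma integrable_mult_cnj_L2:
  fixes X Y :: "'a \<Rightarrow> complex"
  assumes [measurable]: "X \<in> borel_measurable N" "Y \<in> borel_measurable N"
    and "integrable N (\<lambda>x. (cmod (X x))\<^sup>2)" "integrable N (\<lambda>x. (cmod (Y x))\<^sup>2)"
  shows "integrable N (\<lambda>x. X x * cnj (Y x))"
proof (rule Bochner_Integration.integrable_bound)
  show "integrable N (\<lambda>x. (cmod (X x))\<^sup>2 + (cmod (Y x))\<^sup>2)" using assms by simp
  show "(\<lambda>x. X x * cnj (Y x)) \<in> borel_measurable N" by measurable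
  show "AE x in N. norm (X x * cnj (Y x)) \<le> norm ((cmod (X x))\<^sup>2 + (cmod (Y x))\<^sup>2)"
  proof (rule AE_I2)
    fix x
    have "cmod (X x) * cmod (Y x) \<le> (cmod (X x))\<^sup>2 + (cmod (Y x))\<^sup>2"
      using sum_squares_bound[of "cmod (X x)" "cmod (Y x)"] mult_nonneg_nonneg[OF norm_ge_zero[of "X x"] norm_ge_zero[of "Y x"]]
      by linarith
    then show "norm (X x * cnj (Y x)) \<le> norm ((cmod (X x))\<^sup>2 + (cmod (Y x))\<^sup>2)" by (simp add: norm_mult)
  qed
qed

text \<open>The free factor \<open>c\<close> makes it possible to recover a complex inner product
  from norms alone.\<close>

lemma L2_polarization:
  fixes X Y :: "'a \<Rightarrow> complex"
  assumes meas: "X \<in> borel_measurable N" "Y \<in> borel_measurable N"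
    and L2: "integrable N (\<lambda>x. (cmod (X x))\<^sup>2)" "integrable N (\<lambda>x. (cmod (Y x))\<^sup>2)"
  shows "integrable N (\<lambda>x. (cmod (X x + c * Y x))\<^sup>2)"
    and "(\<integral>x. (cmod (X x + c * Y x))\<^sup>2 \<partial>N) =
      (\<integral>x. (cmod (X x))\<^sup>2 \<partial>N) + (cmod c)\<^sup>2 * (\<integral>x. (cmod (Y x))\<^sup>2 \<partial>N) + 2 * Re (cnj c * (\<integral>x. X x * cnj (Y x) \<partial>N))"
proof -
  have int: "integrable N (\<lambda>x. cnj c * (X x * cnj (Y x)))"
    by (intro integrable_mult_right integrable_mult_cnj_L2 assms)
  then have intR: "integrable N (\<lambda>x. Re (cnj c * (X x * cnj (Y x))))" by (rule integrable_Re)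
  show "integrable N (\<lambda>x. (cmod (X x + c * Y x))\<^sup>2)"
    unfolding cmod_add_square using L2 intR by (intro Bochner_Integration.integrable_add integrable_mult_right)
  have "Re (cnj c * (\<integral>x. X x * cnj (Y x) \<partial>N)) = (\<integral>x. Re (cnj c * (X x * cnj (Y x))) \<partial>N)"
    using integral_Re[OF int] by (simp only: integral_mult_right_zero)
  then show "(\<integral>x. (cmod (X x + c * Y x))\<^sup>2 \<partial>N) =
      (\<integral>x. (cmod (X x))\<^sup>2 \<partial>N) + (cmod c)\<^sup>2 * (\<integral>x. (cmod (Y x))\<^sup>2 \<partial>N) + 2 * Re (cnj c * (\<integral>x. X x * cnj (Y x) \<partial>N))"
    unfolding cmod_add_square using L2 intR
    by (simp only: Bochner_Integration.integral_add Bochner_Integration.integrable_add integrable_mult_right integral_mult_right_zero)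
qed

lemma square_integrable_lincomb:
  assumes "square_integrable f" "square_integrable g"
  shows "square_integrable (\<lambda>x. a * f x + b * g x)"
proof -
  have f: "f \<in> borel_measurable lborel" "integrable lborel (\<lambda>x. (cmod (f x))\<^sup>2)"
    and g: "g \<in> borel_measurable lborel" "integrable lborel (\<lambda>x. (cmod (g x))\<^sup>2)"
    using assms by (auto simp: square_integrable_def)
  have "integrable lborel (\<lambda>x. (cmod (a * f x))\<^sup>2)"
    using f(2) by (simp add: norm_mult power_mult_distrib)
  moreover have "(\<lambda>x. a * f x) \<in> borel_measurable lborel" using f(1) by simp
  ultimately have "integrable lborel (\<lambda>x. (cmod (a * f x + b * g x))\<^sup>2)"
    by (intro L2_polarization(1) g)
  with f(1) g(1) show ?thesis by (simp add: square_integrable_def)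
qed

section \<open>Second-order structure of white noise and of its filtered version\<close>

context prob_space
begin

context
  fixes N0 W
  assumes W: "white_gaussian_noise M N0 W"
begin

lemma noise_gaussian:
  "square_integrable f \<Longrightarrow> circular_gaussian M (W f) (N0 * (LBINT x. (cmod (f x))\<^sup>2))"
  using W by (simp add: white_gaussian_noise_def)

lemma noise_linear:
  "square_integrable f \<Longrightarrow> square_integrable g \<Longrightarrow> AE \<omega> in M. W (\<lambda>x. a * f x + b * g x) \<omega> = a * W f \<omega> + b * W g \<omega>"
  using W unfolding white_gaussian_noise_def by blast

text \<open>The definition of white noise prescribes variances only. Applying it to
  \<open>f + c * g\<close> and comparing with the polarization identity on the line yields the
  covariance.\<close>

lemma noise_correlation:
  assumes f: "square_integrable f" and g: "square_integrable g"
  shows "integrable M (\<lambda>\<omega>. W f \<omega> * cnj (W g \<omega>))"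
    and "expectation (\<lambda>\<omega>. W f \<omega> * cnj (W g \<omega>)) = of_real N0 * (LBINT x. f x * cnj (g x))"
proof -
  note mf = circular_gaussian_moments[OF noise_gaussian[OF f]]
    and mg = circular_gaussian_moments[OF noise_gaussian[OF g]]
  show "integrable M (\<lambda>\<omega>. W f \<omega> * cnj (W g \<omega>))"
    by (intro integrable_mult_cnj_L2 mf mg)
  have key: "Re (cnj c * expectation (\<lambda>\<omega>. W f \<omega> * cnj (W g \<omega>))) = Re (cnj c * (of_real N0 * (LBINT x. f x * cnj (g x))))" for c
  proof -
    have h: "square_integrable (\<lambda>x. 1 * f x + c * g x)" by (rule square_integrable_lincomb[OF f g])
    have "expectation (\<lambda>\<omega>. (cmod (W f \<omega> + c * W g \<omega>))\<^sup>2) = expectation (\<lambda>\<omega>. (cmod (W (\<lambda>x. 1 * f x + c * g x) \<omega>))\<^sup>2)"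
    proof (rule integral_cong_AE)
      show "AE \<omega> in M. (cmod (W f \<omega> + c * W g \<omega>))\<^sup>2 = (cmod (W (\<lambda>x. 1 * f x + c * g x) \<omega>))\<^sup>2"
        using noise_linear[OF f g, of 1 c] by eventually_elim simp
    qed (use mf(1) mg(1) circular_gaussian_moments(1)[OF noise_gaussian[OF h]] in measurable)
    also have "\<dots> = N0 * (LBINT x. (cmod (f x + c * g x))\<^sup>2)"
      using circular_gaussian_moments(5)[OF noise_gaussian[OF h]] by simp
    finally have "expectation (\<lambda>\<omega>. (cmod (W f \<omega> + c * W g \<omega>))\<^sup>2) = N0 * (LBINT x. (cmod (f x + c * g x))\<^sup>2)" .
    moreover have "expectation (\<lambda>\<omega>. (cmod (W f \<omega> + c * W g \<omega>))\<^sup>2) =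
        N0 * (LBINT x. (cmod (f x))\<^sup>2) + (cmod c)\<^sup>2 * (N0 * (LBINT x. (cmod (g x))\<^sup>2))
        + 2 * Re (cnj c * expectation (\<lambda>\<omega>. W f \<omega> * cnj (W g \<omega>)))"
      using L2_polarization(2)[OF mf(1) mg(1) mf(4) mg(4), of c] by (simp only: mf(5) mg(5))
    moreover have "(LBINT x. (cmod (f x + c * g x))\<^sup>2) =
        (LBINT x. (cmod (f x))\<^sup>2) + (cmod c)\<^sup>2 * (LBINT x. (cmod (g x))\<^sup>2) + 2 * Re (cnj c * (LBINT x. f x * cnj (g x)))"
      using f g by (intro L2_polarization(2)) (auto simp: square_integrable_def)
    ultimately show ?thesis by (simp add: algebra_simps)
  qed
  show "expectation (\<lambda>\<omega>. W f \<omega> * cnj (W g \<omega>)) = of_real N0 * (LBINT x. f x * cnj (g x))"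
    \<comment> \<open>The choice \<open>c = 1\<close> gives equality of real parts,
      \<open>c = \<i>\<close> that of imaginary parts.\<close>
    using key[of 1] key[of \<i>] by (simp add: complex_eq_iff)
qed

text \<open>A finite combination of noise variables is again a single \<open>W g\<close> almost
  surely, so joint Gaussianity of the samples follows from the Gaussianity of one variable.\<close>

lemma noise_finite_combination:
  assumes "finite S" "\<And>i. i \<in> S \<Longrightarrow> square_integrable (f i)"
  shows "\<exists>g. square_integrable g \<and> (AE \<omega> in M. W g \<omega> = (\<Sum>i\<in>S. c i * W (f i) \<omega>))"
  using assms
proof (induction S rule: finite_induct)
  case empty
  have z: "square_integrable (\<lambda>_. 0)" by (simp add: square_integrable_def)
  \<comment> \<open>Linearity with both coefficients zero forces \<open>W\<close> of the zero
    function to vanish almost surely.\<close>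
  from noise_linear[OF z z, of 0 0] z show ?case by auto
next
  case (insert i S)
  then obtain g where g: "square_integrable g" "AE \<omega> in M. W g \<omega> = (\<Sum>i\<in>S. c i * W (f i) \<omega>)" by auto
  have f: "square_integrable (f i)" using insert by simp
  have "AE \<omega> in M. W (\<lambda>x. c i * f i x + 1 * g x) \<omega> = (\<Sum>i\<in>insert i S. c i * W (f i) \<omega>)"
    using g(2) noise_linear[OF f g(1), of "c i" 1] by eventually_elim (simp add: insert.hyps)
  then show ?case using square_integrable_lincomb[OF f g(1)] by blast
qed

context
  fixes H :: "real \<Rightarrow> real"
  assumes H: "H \<in> borel_measurable borel" "integrable lborel (\<lambda>f. (H f)\<^sup>2)"
begin

lemma filter_square_integrable:
  "square_integrable (\<lambda>f. complex_of_real (H f) * cis (2 * pi * f * t))"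
  using H by (simp add: square_integrable_def norm_mult)

lemma filtered_noise_gaussian: "circular_gaussian M (filtered_noise W H t) (N0 * (LBINT f. (H f)\<^sup>2))"
  using noise_gaussian[OF filter_square_integrable[of t]] by (simp add: filtered_noise_def norm_mult)

lemma filtered_noise_zero_mean: "zero_mean M (filtered_noise W H)"
  using circular_gaussian_moments[OF filtered_noise_gaussian] by (simp add: zero_mean_def)

lemma filtered_noise_gaussian_process: "circular_gaussian_process M (filtered_noise W H)"
  unfolding circular_gaussian_process_def
proof (intro allI impI)
  fix S :: "real set" and c assume "finite S"
  from noise_finite_combination[OF this, of "\<lambda>t f. complex_of_real (H f) * cis (2 * pi * f * t)" c]
  obtain g where g: "square_integrable g" "AE \<omega> in M. W g \<omega> = (\<Sum>t\<in>S. c t * filtered_noise W H t \<omega>)"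
    by (auto simp: filter_square_integrable filtered_noise_def)
  have "(\<lambda>\<omega>. \<Sum>t\<in>S. c t * filtered_noise W H t \<omega>) \<in> borel_measurable M"
    using circular_gaussian_moments(1)[OF filtered_noise_gaussian] by measurable
  from circular_gaussian_cong_AE[OF noise_gaussian[OF g(1)] this g(2)]
  show "\<exists>v. circular_gaussian M (\<lambda>\<omega>. \<Sum>t\<in>S. c t * filtered_noise W H t \<omega>) v" by blast
qed

text \<open>The phases at \<open>t + \<tau>\<close> and \<open>t\<close> combine to one depending on
  the lag alone, which is wide-sense stationarity.\<close>

lemma filtered_noise_correlation:
  shows "integrable M (\<lambda>\<omega>. filtered_noise W H (t + \<tau>) \<omega> * cnj (filtered_noise W H t \<omega>))"
    and "expectation (\<lambda>\<omega>. filtered_noise W H (t + \<tau>) \<omega> * cnj (filtered_noise W H t \<omega>)) =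
      of_real N0 * (LBINT f. complex_of_real ((H f)\<^sup>2) * cis (2 * pi * f * \<tau>))"
proof -
  have eq: "complex_of_real (H f) * cis (2 * pi * f * (t + \<tau>)) * cnj (complex_of_real (H f) * cis (2 * pi * f * t)) =
      complex_of_real ((H f)\<^sup>2) * cis (2 * pi * f * \<tau>)" for f
    by (simp add: cis_cnj power2_eq_square distrib_left mult_ac flip: cis_mult)
       (simp add: cis_mult)
  show "integrable M (\<lambda>\<omega>. filtered_noise W H (t + \<tau>) \<omega> * cnj (filtered_noise W H t \<omega>))"
    and "expectation (\<lambda>\<omega>. filtered_noise W H (t + \<tau>) \<omega> * cnj (filtered_noise W H t \<omega>)) =
      of_real N0 * (LBINT f. complex_of_real ((H f)\<^sup>2) * cis (2 * pi * f * \<tau>))"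
    using noise_correlation[OF filter_square_integrable[of "t + \<tau>"] filter_square_integrable[of t]]
    unfolding filtered_noise_def eq by simp_all
qed

lemma filtered_noise_spectral_density: "has_spectral_density M (filtered_noise W H) (\<lambda>f. N0 * (H f)\<^sup>2)"
  using H filtered_noise_correlation by (simp add: has_spectral_density_def mult.assoc)

end

end

end

text \<open>Rounding to -174 means lying in the half-open interval from -174.5 to -173.5. The
  corresponding decimal logarithms are -17.45 and -17.35; multiplied by 20 they become the integers
  -349 and -347, so comparing twentieth powers with powers of ten replaces numerical
  logarithms.\<close>

lemma thermal_noise_room_temperature:
  assumes "290 \<le> T" "T \<le> 300"
  shows "round (in_dBm_per_Hz (thermal_noise_density T)) = - 174"
proof -
  define x where "x = thermal_noise_density T / (1 / 1000)"
  have x: "x \<ge> 4 / 10 ^ 18" "x \<le> 415 / 10 ^ 20"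
    using assms by (simp_all add: x_def thermal_noise_density_def field_simps)
  then have pos: "x > 0" by (simp add: less_le_trans)
  have log20: "log 10 (x ^ 20) = 20 * log 10 x"
    using pos by (simp add: log_nat_power)
  have "(4 / 10 ^ 18) ^ 20 \<le> x ^ 20" "x ^ 20 \<le> (415 / 10 ^ 20) ^ 20"
    using x pos by (intro power_mono; simp)+
  moreover have "(10::real) powr (-349) \<le> (4 / 10 ^ 18) ^ 20" "(415 / 10 ^ 20) ^ 20 < (10::real) powr (-347)"
    by (simp_all add: powr_minus powr_numeral field_simps)
  ultimately have "10 powr (-349) \<le> x ^ 20" "x ^ 20 < 10 powr (-347)" by linarith+
  then have "-349 \<le> log 10 (x ^ 20)" "log 10 (x ^ 20) < -347"
    using pos by (simp_all add: le_log_iff log_less_iff)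
  then have "- 174.5 \<le> in_dBm_per_Hz (thermal_noise_density T)" "in_dBm_per_Hz (thermal_noise_density T) < - 173.5"
    unfolding log20 in_dBm_per_Hz_def x_def[symmetric] by simp_all
  then show ?thesis
    unfolding round_def by (intro floor_unique) simp_all
qed

subsection \<open>The error signal of a multipath channel\<close>

text \<open>The pulse that modulates the error signal divided by \<open>sqrt Es\<close>. The
  coefficient \<open>h\<close> is left free here and later fixed by orthogonality.\<close>

definition error_pulse ::
  "real \<Rightarrow> real \<Rightarrow> nat \<Rightarrow> (nat \<Rightarrow> complex) \<Rightarrow> (nat \<Rightarrow> real) \<Rightarrow> real \<Rightarrow> complex \<Rightarrow> real \<Rightarrow> complex" where
  "error_pulse Ts \<beta> N \<gamma> \<tau> \<tau>h h t =
     (\<Sum>n<N. \<gamma> n * complex_of_real (rc_pulse Ts \<beta> (t - \<tau> n))) - h * complex_of_real (rc_pulse Ts \<beta> (t - \<tau>h))"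

lemma has_avg_expectation_cong:
  assumes "\<And>v \<omega>. \<omega> \<in> space M \<Longrightarrow> X v \<omega> = Y v \<omega>"
  shows "has_avg_expectation M Ts X t y \<longleftrightarrow> has_avg_expectation M Ts Y t y"
proof -
  have "integrable M (X v) \<longleftrightarrow> integrable M (Y v)" "integral\<^sup>L M (X v) = integral\<^sup>L M (Y v)" for v
    using assms by (auto intro!: Bochner_Integration.integrable_cong Bochner_Integration.integral_cong)
  then show ?thesis by (simp add: has_avg_expectation_def avg_expectation_def)
qed

text \<open>Correlations are computed for complex signals, whereas variances and the autocorrelation
  of \<open>s\<close> are real; this lemma bridges the two.\<close>

lemma has_avg_expectation_of_real:
  assumes "has_avg_expectation M Ts (\<lambda>t \<omega>. complex_of_real (X t \<omega>)) t (of_real y)"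
  shows "has_avg_expectation M Ts X t y"
proof -
  have int: "set_integrable lborel {t..t + Ts} (\<lambda>v. integral\<^sup>L M (X v))"
  proof -
    have "set_integrable lborel {t..t + Ts} (\<lambda>v. complex_of_real (integral\<^sup>L M (X v)))"
      using assms unfolding has_avg_expectation_def integral_complex_of_real by blast
    then show ?thesis
      unfolding set_integrable_def by (simp add: scaleR_conv_of_real complex_of_real_integrable_eq flip: of_real_mult)
  qed
  have "complex_of_real (avg_expectation M Ts X t) = avg_expectation M Ts (\<lambda>t \<omega>. complex_of_real (X t \<omega>)) t"
    unfolding avg_expectation_def integral_complex_of_real set_lebesgue_integral_def scaleR_conv_of_real
      of_real_mult[symmetric] by simp
  with assms int show ?thesis
    by (simp add: has_avg_expectation_def complex_of_real_integrable_eq)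
qed

section \<open>The Hermitian inner product of pulses\<close>

definition pulse_inner :: "(real \<Rightarrow> complex) \<Rightarrow> (real \<Rightarrow> complex) \<Rightarrow> complex" where
  "pulse_inner p q = (LBINT v. p v * cnj (q v))"

lemma pulse_inner_commute: "pulse_inner p q = cnj (pulse_inner q p)"
  unfolding pulse_inner_def by (simp add: mult.commute flip: Bochner_Integration.integral_cnj)

lemma pulse_inner_self: "pulse_inner p p = of_real (LBINT v. (cmod (p v))\<^sup>2)"
  unfolding pulse_inner_def by (simp add: complex_norm_square[symmetric] flip: integral_complex_of_real of_real_power)

lemma pulse_inner_diff_left:
  assumes "decaying p" "decaying p'" "decaying q"
  shows "pulse_inner (\<lambda>t. p t - p' t) q = pulse_inner p q - pulse_inner p' q"
  unfolding pulse_inner_def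
  by (simp add: left_diff_distrib Bochner_Integration.integral_diff decaying_integrable decaying_mult_cnj assms)

lemma pulse_inner_cmult_left: "pulse_inner (\<lambda>t. c * p t) q = c * pulse_inner p q"
  unfolding pulse_inner_def by (simp add: mult.assoc)

lemma pulse_inner_sum_left:
  assumes "\<And>i. i \<in> S \<Longrightarrow> decaying (p i)" "decaying q"
  shows "pulse_inner (\<lambda>t. \<Sum>i\<in>S. p i t) q = (\<Sum>i\<in>S. pulse_inner (p i) q)"
  unfolding pulse_inner_def
  by (simp add: sum_distrib_right Bochner_Integration.integral_sum decaying_integrable decaying_mult_cnj assms)

text \<open>The zero set of a continuous pulse is closed, and a closed set of full measure is the
  whole line. Almost everywhere thus improves to everywhere.\<close>

lemma pulse_inner_self_eq_0D:
  assumes p: "decaying p" and 0: "(LBINT v. (cmod (p v))\<^sup>2) = 0"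
  shows "p t = 0"
proof -
  have "integrable lborel (\<lambda>v. (cmod (p v))\<^sup>2)"
    using integrable_norm[OF decaying_integrable[OF decaying_mult_cnj[OF p p]]]
    by (simp add: norm_mult power2_eq_square)
  then have "AE v in lborel. (cmod (p v))\<^sup>2 = 0"
    using 0 by (subst (asm) integral_nonneg_eq_0_iff_AE) auto
  then have "AE v in lborel. v \<in> {v. p v = 0}" by simp
  then have "AE v in lebesgue. v \<in> {v. p v = 0}" by (rule AE_completion)
  moreover have "closed {v. p v = 0}"
    using decaying_continuous[OF p] by (intro closed_Collect_eq continuous_intros) auto
  ultimately have "t \<in> {v. p v = 0}" by (rule mem_closed_if_AE_lebesgue[rotated])
  then show ?thesis by simp
qed

context symbol_source
begin

lemma modulated_zero_mean:
  assumes p: "decaying p" and X: "\<And>t \<omega>. \<omega> \<in> space M \<Longrightarrow> X t \<omega> = lin_mod Ts I p t \<omega>"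
  shows "zero_mean M X"
proof -
  have "integrable M (X t) \<longleftrightarrow> integrable M (lin_mod Ts I p t)" "integral\<^sup>L M (X t) = integral\<^sup>L M (lin_mod Ts I p t)" for t
    using X by (auto intro!: Bochner_Integration.integrable_cong Bochner_Integration.integral_cong)
  then show ?thesis using lin_mod_mean[OF p] by (simp add: zero_mean_def)
qed

lemma modulated_variance:
  assumes p: "decaying p" and X: "\<And>t \<omega>. \<omega> \<in> space M \<Longrightarrow> X t \<omega> = lin_mod Ts I p t \<omega>"
  shows "has_variance M Ts X ((LBINT v. (cmod (p v))\<^sup>2) / Ts)"
proof -
  have zm: "integrable M (X t)" "expectation (X t) = 0" for t
    using modulated_zero_mean[OF p X] by (auto simp: zero_mean_def)
  have "has_avg_expectation M Ts (\<lambda>t \<omega>. complex_of_real ((cmod (X t \<omega>))\<^sup>2)) t (of_real ((LBINT v. (cmod (p v))\<^sup>2) / Ts))" for t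
  proof (rule has_avg_expectation_cong[THEN iffD2])
    show "has_avg_expectation M Ts (\<lambda>t \<omega>. lin_mod Ts I p t \<omega> * cnj (lin_mod Ts I p t \<omega>)) t (of_real ((LBINT v. (cmod (p v))\<^sup>2) / Ts))"
      using lin_mod_avg_correlation[OF p p, of t]
      by (simp add: pulse_inner_self[unfolded pulse_inner_def] scaleR_conv_of_real)
  qed (simp add: X complex_norm_square del: of_real_power)
  then show ?thesis
    using zm by (simp add: has_variance_def has_avg_expectation_of_real)
qed

lemma modulated_uncorrelated:
  assumes p: "decaying p" and X: "\<And>t \<omega>. \<omega> \<in> space M \<Longrightarrow> X t \<omega> = lin_mod Ts I p t \<omega>"
    and q: "decaying q" and Y: "\<And>t \<omega>. \<omega> \<in> space M \<Longrightarrow> Y t \<omega> = lin_mod Ts I q t \<omega>"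
    and 0: "pulse_inner p q = 0"
  shows "uncorrelated M Ts X Y"
proof -
  have zm: "integrable M (X t)" "expectation (X t) = 0" "integrable M (Y t)" "expectation (Y t) = 0" for t
    using modulated_zero_mean[OF p X] modulated_zero_mean[OF q Y] by (auto simp: zero_mean_def)
  have "has_avg_expectation M Ts (\<lambda>t \<omega>. X t \<omega> * cnj (Y t \<omega>)) t 0" for t
  proof (rule has_avg_expectation_cong[THEN iffD2])
    show "has_avg_expectation M Ts (\<lambda>t \<omega>. lin_mod Ts I p t \<omega> * cnj (lin_mod Ts I q t \<omega>)) t 0"
      using lin_mod_avg_correlation[OF p q, of t] 0 by (simp add: pulse_inner_def)
  qed (simp add: X Y)
  then show ?thesis using zm by (simp add: uncorrelated_def)
qed

text \<open>The pulse is scaled by \<open>1 / sqrt V\<close> before modulation. Mean, variance and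
  orthogonality then follow from pulse integrals, with \<open>q\<close> in the role of the desired
  pulse.\<close>

lemma normalized_interference:
  assumes p: "decaying p" and V: "V = (LBINT v. (cmod (p v))\<^sup>2) / Ts" "V > 0"
    and q: "decaying q" and Y: "\<And>t \<omega>. \<omega> \<in> space M \<Longrightarrow> Y t \<omega> = lin_mod Ts I q t \<omega>"
    and 0: "pulse_inner p q = 0"
  shows "\<exists>u. zero_mean M u \<and> has_variance M Ts u 1 \<and> uncorrelated M Ts u Y \<and>
    (\<forall>t \<omega>. of_real (sqrt V) * u t \<omega> = lin_mod Ts I p t \<omega>)"
proof -
  let ?p = "\<lambda>t. of_real (1 / sqrt V) * p t"
  have dec: "decaying ?p" by (rule decaying_cmult[OF p])
  have "(LBINT v. (cmod (?p v))\<^sup>2) / Ts = 1"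
    using V Ts by (auto simp: norm_mult norm_divide power_mult_distrib power_divide)
  then have "has_variance M Ts (lin_mod Ts I ?p) 1"
    using modulated_variance[OF dec refl] by metis
  moreover have "zero_mean M (lin_mod Ts I ?p)" by (rule modulated_zero_mean[OF dec refl])
  moreover have "uncorrelated M Ts (lin_mod Ts I ?p) Y"
    by (rule modulated_uncorrelated[OF dec refl q Y]) (simp_all only: pulse_inner_cmult_left 0 mult_zero_right)
  moreover have "of_real (sqrt V) * lin_mod Ts I ?p t \<omega> = lin_mod Ts I p t \<omega>" for t \<omega>
    unfolding lin_mod_cmult using V(2) by simp
  ultimately show ?thesis by blast
qed

section \<open>The transmitted signal and its ensemble autocorrelation\<close>

context
  fixes \<beta> :: real
  assumes \<beta>: "0 < \<beta>" "\<beta> \<le> 1"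
begin

abbreviation rc_at :: "real \<Rightarrow> real \<Rightarrow> complex" where
  "rc_at d \<equiv> \<lambda>t. complex_of_real (rc_pulse Ts \<beta> (t - d))"

lemma decaying_rc_at: "decaying (rc_at d)"
  by (rule decaying_shift[OF decaying_rc_pulse[OF Ts \<beta>]])

lemma tx_signal_summable:
  assumes "\<omega> \<in> space M"
  shows "(\<lambda>k. I k \<omega> * rc_pulse Ts \<beta> (t - of_int k * Ts)) summable_on UNIV"
proof (rule abs_summable_summable)
  show "(\<lambda>k. norm (I k \<omega> * rc_pulse Ts \<beta> (t - of_int k * Ts))) summable_on UNIV"
    using summable_lin_mod_norm[OF decaying_rc_pulse[OF Ts \<beta>] assms, of t]
    by (simp add: norm_mult abs_mult)
qed

lemma of_real_tx_signal:
  assumes "\<omega> \<in> space M"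
  shows "complex_of_real (tx_signal Ts \<beta> I (t - d) \<omega>) = lin_mod Ts I (rc_at d) t \<omega>"
proof -
  have "((\<lambda>k. complex_of_real (I k \<omega> * rc_pulse Ts \<beta> (t - d - of_int k * Ts))) has_sum
      complex_of_real (tx_signal Ts \<beta> I (t - d) \<omega>)) UNIV"
    unfolding tx_signal_def by (intro has_sum_of_real has_sum_infsum tx_signal_summable assms)
  from infsumI[OF this] show ?thesis
    by (simp add: lin_mod_def algebra_simps)
qed

lemma pulse_inner_rc_at: "pulse_inner (rc_at a) (rc_at b) = of_real (Ts * rc_autocorr Ts \<beta> (a - b))"
  unfolding pulse_inner_def by (rule integral_shifted_rc_pulses[OF Ts \<beta>])

lemma rc_autocorr_minus: "rc_autocorr Ts \<beta> (a - b) = rc_autocorr Ts \<beta> (b - a)"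
  using pulse_inner_commute[of "rc_at a" "rc_at b"] Ts by (simp add: pulse_inner_rc_at del: of_real_mult)

text \<open>Advancing the signal by \<open>\<tau>\<close> is modulating with the pulse delayed by
  \<open>- \<tau>\<close>; the inner product of the pulses at \<open>0\<close> and
  \<open>- \<tau>\<close> has lag \<open>\<tau>\<close>.\<close>

lemma tx_signal_avg_autocorr:
  "has_avg_expectation M Ts (\<lambda>t \<omega>. tx_signal Ts \<beta> I t \<omega> * tx_signal Ts \<beta> I (t + \<tau>) \<omega>) t (rc_autocorr Ts \<beta> \<tau>)"
proof (rule has_avg_expectation_of_real, rule has_avg_expectation_cong[THEN iffD2])
  show "has_avg_expectation M Ts (\<lambda>t \<omega>. lin_mod Ts I (rc_at 0) t \<omega> * cnj (lin_mod Ts I (rc_at (- \<tau>)) t \<omega>)) t (of_real (rc_autocorr Ts \<beta> \<tau>))"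
    using lin_mod_avg_correlation[OF decaying_rc_at[of 0] decaying_rc_at[of "- \<tau>"], of t] pulse_inner_rc_at[of 0 "- \<tau>"] Ts
    by (simp add: pulse_inner_def scaleR_conv_of_real)
next
  fix v \<omega> assume \<omega>: "\<omega> \<in> space M"
  have "lin_mod Ts I (rc_at 0) v \<omega> = of_real (tx_signal Ts \<beta> I v \<omega>)"
    "lin_mod Ts I (rc_at (- \<tau>)) v \<omega> = of_real (tx_signal Ts \<beta> I (v + \<tau>) \<omega>)"
    using of_real_tx_signal[OF \<omega>, of v 0] of_real_tx_signal[OF \<omega>, of v "- \<tau>"] by simp_all
  then show "complex_of_real (tx_signal Ts \<beta> I v \<omega> * tx_signal Ts \<beta> I (v + \<tau>) \<omega>) =
      lin_mod Ts I (rc_at 0) v \<omega> * cnj (lin_mod Ts I (rc_at (- \<tau>)) v \<omega>)"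
    by (simp only:) simp
qed

lemma autocorr_tx_signal: "autocorr M Ts (tx_signal Ts \<beta> I) = rc_autocorr Ts \<beta>"
  using tx_signal_avg_autocorr[of _ 0] by (auto simp: has_avg_expectation_def autocorr_def)

lemma has_sum_symbol_autocorr:
  "((\<lambda>q. symbol_autocorr M I q * time_autocorr (rc_pulse Ts \<beta>) (\<tau> - of_int q * Ts)) has_sum (Ts * rc_autocorr Ts \<beta> \<tau>)) UNIV"
proof -
  have "symbol_autocorr M I q = (if q = 0 then 1 else 0)" for q
    by (simp add: symbol_autocorr_def expectation_symbol_mult)
  then show ?thesis
    using Ts by (intro has_sum_finite_neutralI[of "{0}"]) (auto simp: rc_autocorr_def)
qed

section \<open>Orthogonality and energy of the error pulse\<close>

context
  fixes N :: nat and \<gamma> :: "nat \<Rightarrow> complex" and \<tau> :: "nat \<Rightarrow> real" and \<tau>h :: real and h :: complex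
  assumes h: "h = desired_fading \<beta> (rc_autocorr Ts \<beta>) N \<gamma> \<tau> \<tau>h"
begin

abbreviation err :: "real \<Rightarrow> complex" where
  "err \<equiv> error_pulse Ts \<beta> N \<gamma> \<tau> \<tau>h h"

lemma decaying_error_pulse: "decaying err"
  unfolding error_pulse_def[abs_def] by (intro decaying_diff decaying_sum decaying_cmult decaying_rc_at)

text \<open>The normal equation of the least-squares projection of the composite pulse onto the
  desired one.\<close>

lemma desired_fading_mult: "h * of_real (1 - \<beta> / 4) = (\<Sum>n<N. \<gamma> n * complex_of_real (rc_autocorr Ts \<beta> (\<tau> n - \<tau>h)))"
  using \<beta> by (simp add: h desired_fading_def del: of_real_diff)

lemma error_pulse_inner_left:
  assumes q: "decaying q"
  shows "pulse_inner err q = (\<Sum>n<N. \<gamma> n * pulse_inner (rc_at (\<tau> n)) q) - h * pulse_inner (rc_at \<tau>h) q"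
proof -
  have "pulse_inner err q = pulse_inner (\<lambda>t. \<Sum>n<N. \<gamma> n * rc_at (\<tau> n) t) q - pulse_inner (\<lambda>t. h * rc_at \<tau>h t) q"
    unfolding error_pulse_def[abs_def]
    by (intro pulse_inner_diff_left decaying_sum decaying_cmult decaying_rc_at q)
  also have "pulse_inner (\<lambda>t. \<Sum>n<N. \<gamma> n * rc_at (\<tau> n) t) q = (\<Sum>n<N. pulse_inner (\<lambda>t. \<gamma> n * rc_at (\<tau> n) t) q)"
    by (intro pulse_inner_sum_left decaying_cmult decaying_rc_at q)
  finally show ?thesis by (simp only: pulse_inner_cmult_left)
qed

lemma error_pulse_inner_rc_at:
  "pulse_inner err (rc_at b) =
     of_real Ts * ((\<Sum>n<N. \<gamma> n * complex_of_real (rc_autocorr Ts \<beta> (\<tau> n - b))) - h * of_real (rc_autocorr Ts \<beta> (\<tau>h - b)))"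
  unfolding error_pulse_inner_left[OF decaying_rc_at] pulse_inner_rc_at
  by (simp add: sum_distrib_left algebra_simps)

lemma error_pulse_orthogonal: "pulse_inner err (rc_at \<tau>h) = 0"
  unfolding error_pulse_inner_rc_at desired_fading_mult[symmetric] by (simp add: rc_autocorr_0[OF Ts \<beta>])

text \<open>Only one of the two error pulses is expanded at a time. Orthogonality removes the
  desired pulse from the first expansion; the second leaves the double sum over paths minus
  \<open>(1 - \<beta> / 4)\<close> times the squared modulus of \<open>h\<close>. The diagonal of
  the double sum supplies the path powers.\<close>

lemma error_pulse_energy:
  "complex_of_real ((1 - 0.25 * \<beta>) * ((\<Sum>n<N. (cmod (\<gamma> n))\<^sup>2) - (cmod h)\<^sup>2))
     + (\<Sum>n<N. \<Sum>m\<in>{..<N} - {n}. \<gamma> n * cnj (\<gamma> m) * complex_of_real (rc_autocorr Ts \<beta> (\<tau> n - \<tau> m)))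
   = of_real ((LBINT v. (cmod (err v))\<^sup>2) / Ts)"
proof -
  let ?R = "\<lambda>x. complex_of_real (rc_autocorr Ts \<beta> x)"
  have "pulse_inner err err = cnj ((\<Sum>m<N. \<gamma> m * pulse_inner (rc_at (\<tau> m)) err) - h * pulse_inner (rc_at \<tau>h) err)"
    using pulse_inner_commute[of err err] by (simp only: error_pulse_inner_left[OF decaying_error_pulse])
  also have "pulse_inner (rc_at \<tau>h) err = 0"
    by (subst pulse_inner_commute) (simp add: error_pulse_orthogonal)
  also have "cnj ((\<Sum>m<N. \<gamma> m * pulse_inner (rc_at (\<tau> m)) err) - h * 0) =
      (\<Sum>m<N. cnj (\<gamma> m) * pulse_inner err (rc_at (\<tau> m)))"
    by (simp add: pulse_inner_commute[of err])
  also have "\<dots> = of_real Ts * ((\<Sum>m<N. \<Sum>n<N. \<gamma> n * cnj (\<gamma> m) * ?R (\<tau> n - \<tau> m)) - h * (\<Sum>m<N. cnj (\<gamma> m) * ?R (\<tau> m - \<tau>h)))"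
    unfolding error_pulse_inner_rc_at rc_autocorr_minus[of \<tau>h]
    by (simp add: sum_distrib_left right_diff_distrib sum_subtractf mult_ac)
  also have "(\<Sum>m<N. cnj (\<gamma> m) * ?R (\<tau> m - \<tau>h)) = cnj h * of_real (1 - \<beta> / 4)"
    using arg_cong[OF desired_fading_mult, of cnj] by simp
  also have "(\<Sum>m<N. \<Sum>n<N. \<gamma> n * cnj (\<gamma> m) * ?R (\<tau> n - \<tau> m)) = (\<Sum>n<N. \<Sum>m<N. \<gamma> n * cnj (\<gamma> m) * ?R (\<tau> n - \<tau> m))"
    by (rule sum.swap)
  also have "\<dots> = (\<Sum>n<N. of_real (1 - \<beta> / 4) * of_real ((cmod (\<gamma> n))\<^sup>2) + (\<Sum>m\<in>{..<N} - {n}. \<gamma> n * cnj (\<gamma> m) * ?R (\<tau> n - \<tau> m)))"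
    by (intro sum.cong refl, subst sum.remove) (auto simp: rc_autocorr_0[OF Ts \<beta>] complex_norm_square simp del: of_real_power)
  finally have "of_real (LBINT v. (cmod (err v))\<^sup>2) = of_real Ts *
     ((\<Sum>n<N. of_real (1 - \<beta> / 4) * of_real ((cmod (\<gamma> n))\<^sup>2) + (\<Sum>m\<in>{..<N} - {n}. \<gamma> n * cnj (\<gamma> m) * ?R (\<tau> n - \<tau> m)))
       - h * (cnj h * of_real (1 - \<beta> / 4)))"
    by (simp only: pulse_inner_self)
  then have "of_real ((LBINT v. (cmod (err v))\<^sup>2) / Ts) =
     (\<Sum>n<N. of_real (1 - \<beta> / 4) * of_real ((cmod (\<gamma> n))\<^sup>2) + (\<Sum>m\<in>{..<N} - {n}. \<gamma> n * cnj (\<gamma> m) * ?R (\<tau> n - \<tau> m)))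
       - of_real ((1 - \<beta> / 4) * (cmod h)\<^sup>2)"
    using Ts by (simp add: complex_norm_square mult_ac del: of_real_power)
  then show ?thesis
    by (simp add: sum.distrib sum_distrib_left right_diff_distrib)
qed

text \<open>The radicand, complex by its form, is a real nonnegative energy, so its principal root
  is the ordinary square root.\<close>

lemma interference_fading_eq:
  "interference_fading \<beta> (rc_autocorr Ts \<beta>) N \<gamma> \<tau> \<tau>h = of_real (sqrt ((LBINT v. (cmod (err v))\<^sup>2) / Ts))"
  unfolding interference_fading_def h[symmetric] error_pulse_energy
  using Ts by (intro of_real_sqrt[symmetric]) auto

lemma received_error:
  assumes "\<omega> \<in> space M"
  shows "received Es N \<gamma> \<tau> (tx_signal Ts \<beta> I) t \<omega> - complex_of_real (sqrt Es) * h * complex_of_real (tx_signal Ts \<beta> I (t - \<tau>h) \<omega>)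
    = complex_of_real (sqrt Es) * lin_mod Ts I err t \<omega>"
proof -
  have "lin_mod Ts I err t \<omega> = lin_mod Ts I (\<lambda>t. (\<Sum>n<N. \<gamma> n * rc_at (\<tau> n) t) + (- h) * rc_at \<tau>h t) t \<omega>"
    by (simp add: error_pulse_def[abs_def])
  also have "\<dots> = lin_mod Ts I (\<lambda>t. \<Sum>n<N. \<gamma> n * rc_at (\<tau> n) t) t \<omega> + lin_mod Ts I (\<lambda>t. (- h) * rc_at \<tau>h t) t \<omega>"
    by (intro lin_mod_add decaying_sum decaying_cmult decaying_rc_at assms)
  also have "lin_mod Ts I (\<lambda>t. \<Sum>n<N. \<gamma> n * rc_at (\<tau> n) t) t \<omega> = (\<Sum>n<N. lin_mod Ts I (\<lambda>t. \<gamma> n * rc_at (\<tau> n) t) t \<omega>)"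
    by (intro lin_mod_sum decaying_cmult decaying_rc_at assms)
  finally have "lin_mod Ts I err t \<omega> = (\<Sum>n<N. \<gamma> n * lin_mod Ts I (rc_at (\<tau> n)) t \<omega>) + (- h) * lin_mod Ts I (rc_at \<tau>h) t \<omega>"
    by (simp only: lin_mod_cmult)
  then show ?thesis
    unfolding received_def of_real_tx_signal[OF assms] by (simp only:) (simp add: algebra_simps)
qed

text \<open>Dividing by \<open>sqrt V\<close> settles the case of positive energy. The energy can be
  zero, for instance when all path gains vanish, and then \<open>u\<close> has to be found
  elsewhere.\<close>

lemma interference_exists:
  defines "V \<equiv> (LBINT v. (cmod (err v))\<^sup>2) / Ts"
  shows "\<exists>u. zero_mean M u \<and> has_variance M Ts u 1 \<and>
    uncorrelated M Ts u (\<lambda>t \<omega>. complex_of_real (tx_signal Ts \<beta> I (t - \<tau>h) \<omega>)) \<and>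
    (\<forall>t \<omega>. of_real (sqrt V) * u t \<omega> = lin_mod Ts I err t \<omega>)"
proof (cases "V = 0")
  case False
  moreover have "V \<ge> 0" using Ts by (simp add: V_def)
  ultimately have "V > 0" by simp
  from normalized_interference[OF decaying_error_pulse V_def[THEN meta_eq_to_obj_eq] this decaying_rc_at of_real_tx_signal error_pulse_orthogonal]
  show ?thesis .
next
  case True
  then have "err t = 0" for t
    using Ts by (intro pulse_inner_self_eq_0D decaying_error_pulse) (simp add: V_def)
  then have zero: "lin_mod Ts I err t \<omega> = 0" for t \<omega>
    by (simp add: lin_mod_def)
  \<comment> \<open>The interference has vanished, so any normalised signal orthogonal to the desired one serves
    as \<open>u\<close>: take the next symbol slot and project out the desired pulse.\<close>
  define c where "c = complex_of_real (rc_autocorr Ts \<beta> Ts / (1 - \<beta> / 4))"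
  define p where "p = (\<lambda>t. rc_at (\<tau>h + Ts) t - c * rc_at \<tau>h t)"
  have p: "decaying p" unfolding p_def by (intro decaying_diff decaying_cmult decaying_rc_at)
  have orth: "pulse_inner p (rc_at \<tau>h) = 0"
  proof -
    have "pulse_inner p (rc_at \<tau>h) = of_real (Ts * rc_autocorr Ts \<beta> Ts) - c * of_real (Ts * (1 - \<beta> / 4))"
      unfolding p_def
      by (subst pulse_inner_diff_left)
         (simp_all add: decaying_cmult decaying_rc_at pulse_inner_cmult_left pulse_inner_rc_at rc_autocorr_0[OF Ts \<beta>])
    also have "\<dots> = 0"
      unfolding c_def of_real_mult[symmetric] using \<beta> by simp
    finally show ?thesis .
  qed
  have g: "rc_pulse Ts \<beta> 0 = 1" "rc_pulse Ts \<beta> Ts = 0"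
    using rc_pulse_at_symbols[OF Ts \<beta>, of 0] rc_pulse_at_symbols[OF Ts \<beta>, of 1] by simp_all
  \<comment> \<open>By the Nyquist property the desired pulse is zero one symbol later, where the
    next pulse equals 1. A nonzero value of a continuous pulse means positive energy.\<close>
  have "p (\<tau>h + Ts) = 1" by (simp_all add: p_def g)
  define V' where "V' = (LBINT v. (cmod (p v))\<^sup>2) / Ts"
  have "V' \<noteq> 0"
    using pulse_inner_self_eq_0D[OF p, of "\<tau>h + Ts"] \<open>p (\<tau>h + Ts) = 1\<close> Ts by (auto simp: V'_def)
  moreover have "V' \<ge> 0" using Ts by (simp add: V'_def)
  ultimately have "V' > 0" by simp
  from normalized_interference[OF p V'_def this decaying_rc_at of_real_tx_signal orth]
  obtain u where "zero_mean M u \<and> has_variance M Ts u 1 \<and>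
    uncorrelated M Ts u (\<lambda>t \<omega>. complex_of_real (tx_signal Ts \<beta> I (t - \<tau>h) \<omega>))"
    by metis
  then show ?thesis
    by (intro exI[of _ u]) (simp add: zero True)
qed

end

end

end

theorem proposition1:
  fixes M :: "'w measure"
    and A :: "real set" and I :: "int \<Rightarrow> 'w \<Rightarrow> real"
    and Ts \<beta> Es Fc \<tau>h \<kappa> temp N0 \<sigma>2 :: real
    and N :: nat and \<alpha> \<tau> \<phi> :: "nat \<Rightarrow> real" and \<gamma> :: "nat \<Rightarrow> complex"
    and W :: "(real \<Rightarrow> complex) \<Rightarrow> 'w \<Rightarrow> complex"
    and s :: "real \<Rightarrow> 'w \<Rightarrow> real" and R :: "real \<Rightarrow> real"
    and r r' n desired e :: "real \<Rightarrow> 'w \<Rightarrow> complex" and h\<^sub>o \<eta>\<^sub>o :: complex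
  assumes prob: "prob_space M"
    and Ts: "Ts > 0" and \<beta>: "0 < \<beta>" "\<beta> \<le> 1"
    and symbols: "symbol_sequence M A I"
    and s_def: "s = tx_signal Ts \<beta> I"
    and N: "N \<ge> 1" and Es: "Es > 0" and Fc: "Fc > 0"
    and earliest: "\<forall>k<N. \<tau> 0 \<le> \<tau> k"
    and phases: "\<forall>k<N. \<phi> k = 2 * pi * Fc * \<tau> k"
    and \<gamma>_def: "\<gamma> = path_coeff \<alpha> \<phi>"
    and \<kappa>: "\<kappa> > 1" and medium: "mediumband \<kappa> Ts (delay_spread N \<tau>)"
    and r_def: "r = received Es N \<gamma> \<tau> s"
    and temp: "temp > 0" and N0_def: "N0 = thermal_noise_density temp"
    and W: "white_gaussian_noise M N0 W"
    and n_def: "n = filtered_noise W (rrc_response Ts \<beta>)"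
    and r'_def: "r' = (\<lambda>t \<omega>. r t \<omega> + n t \<omega>)"
    and R_def: "R = autocorr M Ts s"
    and h_def: "h\<^sub>o = desired_fading \<beta> R N \<gamma> \<tau> \<tau>h"
    and \<eta>_def: "\<eta>\<^sub>o = interference_fading \<beta> R N \<gamma> \<tau> \<tau>h"
    and desired_def: "desired = (\<lambda>t \<omega>. complex_of_real (s (t - \<tau>h) \<omega>))"
    and e_def: "e = (\<lambda>t \<omega>. r t \<omega> - complex_of_real (sqrt Es) * h\<^sub>o * desired t \<omega>)"
    and \<sigma>2_def: "\<sigma>2 = N0 * noise_bandwidth (rrc_response Ts \<beta>)"
  shows
    \<comment> \<open>the transmitted signal is well defined\<close>
    "(\<forall>t. \<forall>\<omega>\<in>space M. (\<lambda>k. I k \<omega> * rc_pulse Ts \<beta> (t - of_int k * Ts)) summable_on UNIV)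
    \<comment> \<open>its autocorrelation function\<close>
     \<and> (\<forall>\<tau>' t. has_avg_expectation M Ts (\<lambda>t \<omega>. s t \<omega> * s (t + \<tau>') \<omega>) t (R \<tau>'))
     \<and> (\<forall>\<tau>'. integrable lborel (\<lambda>t. rc_pulse Ts \<beta> t * rc_pulse Ts \<beta> (t + \<tau>')))
     \<and> (\<forall>\<tau>'. ((\<lambda>q. symbol_autocorr M I q * time_autocorr (rc_pulse Ts \<beta>) (\<tau>' - of_int q * Ts))
                 has_sum (Ts * R \<tau>')) UNIV)
     \<and> (\<forall>\<tau>'. \<bar>\<tau>'\<bar> \<noteq> Ts / (2 * \<beta>) \<longrightarrow> \<bar>\<tau>'\<bar> \<noteq> Ts / \<beta> \<longrightarrow> R \<tau>' = autocorr_formula Ts \<beta> \<tau>')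
     \<and> (\<forall>\<tau>'. (autocorr_formula Ts \<beta> \<longlongrightarrow> R \<tau>') (at \<tau>'))
    \<comment> \<open>the error signal\<close>
     \<and> \<eta>\<^sub>o \<in> \<real>\<^sub>\<ge>\<^sub>0
     \<and> zero_mean M e \<and> has_variance M Ts e (Es * (Re \<eta>\<^sub>o)\<^sup>2) \<and> uncorrelated M Ts e desired
    \<comment> \<open>the received signal without and with noise\<close>
     \<and> (\<exists>u :: real \<Rightarrow> 'w \<Rightarrow> complex.
          zero_mean M u \<and> has_variance M Ts u 1 \<and> uncorrelated M Ts u desired \<and>
          (\<forall>t. \<forall>\<omega>\<in>space M.
             r t \<omega> = complex_of_real (sqrt Es) * h\<^sub>o * desired t \<omega>
                     + complex_of_real (sqrt Es) * \<eta>\<^sub>o * u t \<omega> \<and>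
             r' t \<omega> = complex_of_real (sqrt Es) * h\<^sub>o * desired t \<omega>
                      + complex_of_real (sqrt Es) * \<eta>\<^sub>o * u t \<omega> + n t \<omega>))
    \<comment> \<open>the noise: zero-mean Gaussian of variance \<open>\<sigma>2\<close>, flat within the filter, white at symbol spacing\<close>
     \<and> zero_mean M n
     \<and> circular_gaussian_process M n
     \<and> (\<forall>t. circular_gaussian M (n t) \<sigma>2)
     \<and> (\<forall>t. integrable M (\<lambda>\<omega>. (cmod (n t \<omega>))\<^sup>2) \<and> integral\<^sup>L M (\<lambda>\<omega>. (cmod (n t \<omega>))\<^sup>2) = \<sigma>2)
     \<and> has_spectral_density M n (\<lambda>f. N0 * (rrc_response Ts \<beta> f)\<^sup>2)
     \<and> (\<forall>t. \<forall>k::int. k \<noteq> 0 \<longrightarrow>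
          integral\<^sup>L M (\<lambda>\<omega>. n (t + of_int k * Ts) \<omega> * cnj (n t \<omega>)) = 0)
    \<comment> \<open>the thermal noise level at room temperature, rounded to an integer in dBm/Hz\<close>
     \<and> (290 \<le> temp \<and> temp \<le> 300 \<longrightarrow> round (in_dBm_per_Hz N0) = -174)"
proof -
  interpret symbol_source M A I Ts
    by (intro symbol_source.intro prob symbol_source_axioms.intro symbols Ts)
  note TB = Ts \<beta>
  have R: "R = rc_autocorr Ts \<beta>"
    by (simp add: R_def s_def autocorr_tx_signal[OF \<beta>])
  have h: "h\<^sub>o = desired_fading \<beta> (rc_autocorr Ts \<beta>) N \<gamma> \<tau> \<tau>h"
    by (simp add: h_def R)
  define p where "p = error_pulse Ts \<beta> N \<gamma> \<tau> \<tau>h h\<^sub>o"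
  define V where "V = (LBINT v. (cmod (p v))\<^sup>2) / Ts"
  have "V \<ge> 0" using Ts by (simp add: V_def)
  have p: "decaying p"
    unfolding p_def by (rule decaying_error_pulse[OF \<beta> h])
  have \<eta>: "\<eta>\<^sub>o = of_real (sqrt V)"
    unfolding \<eta>_def R V_def p_def by (rule interference_fading_eq[OF \<beta> h])
  have desired: "desired t \<omega> = lin_mod Ts I (\<lambda>t. complex_of_real (rc_pulse Ts \<beta> (t - \<tau>h))) t \<omega>"
    if "\<omega> \<in> space M" for t \<omega>
    using of_real_tx_signal[OF \<beta> that] by (simp add: desired_def s_def)
  have dec_desired: "decaying (\<lambda>t. complex_of_real (rc_pulse Ts \<beta> (t - \<tau>h)))"
    by (rule decaying_rc_at[OF \<beta>])
  have orth: "pulse_inner p (\<lambda>t. complex_of_real (rc_pulse Ts \<beta> (t - \<tau>h))) = 0"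
    unfolding p_def by (rule error_pulse_orthogonal[OF \<beta> h])
  have e_p: "e t \<omega> = of_real (sqrt Es) * lin_mod Ts I p t \<omega>" if "\<omega> \<in> space M" for t \<omega>
    using received_error[OF \<beta> h that] by (simp add: e_def r_def s_def desired_def p_def)
  \<comment> \<open>Absorbing \<open>sqrt Es\<close> into the pulse makes \<open>e\<close> itself a
    modulated signal.\<close>
  define q where "q = (\<lambda>t. complex_of_real (sqrt Es) * p t)"
  have q: "decaying q" unfolding q_def by (rule decaying_cmult[OF p])
  have e_q: "e t \<omega> = lin_mod Ts I q t \<omega>" if "\<omega> \<in> space M" for t \<omega>
    using e_p[OF that] by (simp only: q_def lin_mod_cmult)
  have "(LBINT v. (cmod (q v))\<^sup>2) / Ts = Es * (Re \<eta>\<^sub>o)\<^sup>2"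
    using Es \<open>V \<ge> 0\<close> by (simp add: q_def norm_mult power_mult_distrib \<eta> V_def)
  then have var_e: "has_variance M Ts e (Es * (Re \<eta>\<^sub>o)\<^sup>2)"
    using modulated_variance[OF q e_q] by simp
  have unc_e: "uncorrelated M Ts e desired"
    by (rule modulated_uncorrelated[OF q e_q dec_desired desired])
       (simp_all only: q_def pulse_inner_cmult_left orth mult_zero_right)
  obtain u where u: "zero_mean M u" "has_variance M Ts u 1" "uncorrelated M Ts u desired"
    and u_p: "\<And>t \<omega>. of_real (sqrt V) * u t \<omega> = lin_mod Ts I p t \<omega>"
    using interference_exists[OF \<beta> h] unfolding p_def[symmetric] V_def[symmetric] desired_def s_def by metis
  have r_u: "r t \<omega> = complex_of_real (sqrt Es) * h\<^sub>o * desired t \<omega> + complex_of_real (sqrt Es) * \<eta>\<^sub>o * u t \<omega>"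
    if "\<omega> \<in> space M" for t \<omega>
  proof -
    have "r t \<omega> = complex_of_real (sqrt Es) * h\<^sub>o * desired t \<omega> + e t \<omega>"
      by (simp add: e_def)
    then show ?thesis
      by (simp only: e_p[OF that] u_p[symmetric] \<eta> mult.assoc)
  qed
  have part_u: "\<exists>u. zero_mean M u \<and> has_variance M Ts u 1 \<and> uncorrelated M Ts u desired \<and>
      (\<forall>t. \<forall>\<omega>\<in>space M.
             r t \<omega> = complex_of_real (sqrt Es) * h\<^sub>o * desired t \<omega>
                     + complex_of_real (sqrt Es) * \<eta>\<^sub>o * u t \<omega> \<and>
             r' t \<omega> = complex_of_real (sqrt Es) * h\<^sub>o * desired t \<omega>
                      + complex_of_real (sqrt Es) * \<eta>\<^sub>o * u t \<omega> + n t \<omega>)"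
    using u r_u by (intro exI[of _ u]) (simp add: r'_def)

  let ?H = "rrc_response Ts \<beta>"
  have H: "?H \<in> borel_measurable borel" "integrable lborel (\<lambda>f. (?H f)\<^sup>2)"
    by (intro borel_measurable_continuous_onI continuous_on_rrc_response integrable_rrc_squared TB)+
  \<comment> \<open>Unit gain at frequency zero reduces the noise bandwidth to the plain integral of
    the squared response.\<close>
  have "?H 0 = 1" using TB by (simp add: rrc_response_def)
  then have \<sigma>2: "\<sigma>2 = N0 * (LBINT f. (?H f)\<^sup>2)"
    by (simp add: \<sigma>2_def noise_bandwidth_def)
  have gauss: "circular_gaussian M (n t) \<sigma>2" for t
    unfolding n_def \<sigma>2 by (rule filtered_noise_gaussian[OF W H])
  \<comment> \<open>The noise correlation at lag \<open>k * Ts\<close> is \<open>N0 / Ts\<close>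
    times the raised-cosine pulse at a symbol instant, which is zero unless
    \<open>k = 0\<close>.\<close>
  have white: "integral\<^sup>L M (\<lambda>\<omega>. n (t + of_int k * Ts) \<omega> * cnj (n t \<omega>)) = 0" if "k \<noteq> 0" for t and k :: int
    unfolding n_def filtered_noise_correlation(2)[OF W H] inverse_fourier_rrc_squared[OF TB]
    using that by (simp add: rc_pulse_at_symbols[OF TB])

  show ?thesis
  proof (intro conjI)
    show "\<forall>t. \<forall>\<omega>\<in>space M. (\<lambda>k. I k \<omega> * rc_pulse Ts \<beta> (t - of_int k * Ts)) summable_on UNIV"
      using tx_signal_summable[OF \<beta>] by blast
    show "\<forall>\<tau>' t. has_avg_expectation M Ts (\<lambda>t \<omega>. s t \<omega> * s (t + \<tau>') \<omega>) t (R \<tau>')"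
      unfolding s_def R using tx_signal_avg_autocorr[OF \<beta>] by blast
    show "\<forall>\<tau>'. integrable lborel (\<lambda>t. rc_pulse Ts \<beta> t * rc_pulse Ts \<beta> (t + \<tau>'))"
      using integrable_rc_pulse_mult[OF TB] by blast
    show "\<forall>\<tau>'. ((\<lambda>q. symbol_autocorr M I q * time_autocorr (rc_pulse Ts \<beta>) (\<tau>' - of_int q * Ts))
                 has_sum (Ts * R \<tau>')) UNIV"
      unfolding R using has_sum_symbol_autocorr[OF \<beta>] by blast
    show "\<forall>\<tau>'. \<bar>\<tau>'\<bar> \<noteq> Ts / (2 * \<beta>) \<longrightarrow> \<bar>\<tau>'\<bar> \<noteq> Ts / \<beta> \<longrightarrow> R \<tau>' = autocorr_formula Ts \<beta> \<tau>'"
      unfolding R using rc_autocorr_eq[OF TB] by blast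
    show "\<forall>\<tau>'. (autocorr_formula Ts \<beta> \<longlongrightarrow> R \<tau>') (at \<tau>')"
      unfolding R using autocorr_formula_tendsto[OF TB] by blast
    show "\<eta>\<^sub>o \<in> \<real>\<^sub>\<ge>\<^sub>0"
      using \<open>V \<ge> 0\<close> by (simp add: \<eta>)
    show "zero_mean M e" by (rule modulated_zero_mean[OF q e_q])
    show "zero_mean M n" unfolding n_def by (rule filtered_noise_zero_mean[OF W H])
    show "circular_gaussian_process M n" unfolding n_def by (rule filtered_noise_gaussian_process[OF W H])
    show "has_spectral_density M n (\<lambda>f. N0 * (?H f)\<^sup>2)"
      unfolding n_def by (rule filtered_noise_spectral_density[OF W H])
    show "\<forall>t. integrable M (\<lambda>\<omega>. (cmod (n t \<omega>))\<^sup>2) \<and> integral\<^sup>L M (\<lambda>\<omega>. (cmod (n t \<omega>))\<^sup>2) = \<sigma>2"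
      using circular_gaussian_moments(4,5)[OF gauss] by blast
    show "290 \<le> temp \<and> temp \<le> 300 \<longrightarrow> round (in_dBm_per_Hz N0) = -174"
      using thermal_noise_room_temperature by (simp add: N0_def)
  qed (use gauss white part_u var_e unc_e in blast)+
qed

end
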